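(* Let $0<s<1/2$ and let $f=U''(U^{-1}(\cdot))$, $g=U'(U^{-1}(\cdot))\in W^{2,\infty}(\mathbb T)$ with $g^2>c>0$. Let $W$ be a solution of the linearized Euler equations $$\partial_t W=\frac{i f(y)}{k}\Phi,\qquad \Big(-1+\big(g(y)(\tfrac{\partial_y}{k}-it)\big)^2\Big)\Phi=W,\qquad \Phi|_{y=0,1}=0,\qquad W|_{t=0}=\omega_0,$$ for $y\in[0,1]$ and $k\in\frac{2\pi}{L}(\mathbb Z\setminus\{0\})$, such that $\|\partial_yW(t)\|_{L^2_xH^s_y}$ and $\|W(t)\|_{L^2_xH^1_y}$ are uniformly bounded in time. Then there exists $W_\infty\in L^2_xH^s_y$ such that, as $t\to\infty$, $$\|V_2(t)\|_{L^2}=\mathcal O(t^{-(1+s)}),\qquad W(t)\xrightarrow{L^2}W_\infty,\qquad \|W(t)-W_\infty\|_{L^2}=\mathcal O(t^{-s}).$$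
   Context: Setting: $L>0$, and $U:[a,b]\to\mathbb R$ is a strictly monotone shear profile, normalized so that $U([a,b])=[0,1]$; $f,g$ are functions on $[0,1]$. The displayed system is the linearized 2D Euler equation around $(U(y),0)$ in the periodic channel of period $L$ in $x$, in coordinates moving with the flow, after a Fourier transform in $x$ ($W=W(t,k,y)$, $\Phi=\Phi(t,k,y)$, $\omega_0=\omega_0(k,y)$) and the change of variables $y\mapsto U(y)$; the mode $k=0$ is removed, and $\Phi$ is $k^2$ times the Fourier transform of the stream function. $V_2$ is the vertical velocity perturbation in these coordinates, with Fourier transform $V_2(t,k,y)=\frac{i}{k}\Phi(t,k,y)$, so that $\partial_tW=fV_2$. Norms: $L^2$ is $L^2_xL^2_y$ and $\|W\|_{L^2_xH^s_y}^2=\sum_k\|W(k,\cdot)\|_{H^s_y}^2$; $H^1_y=H^1([0,1])$; $H^s_y=H^s(\mathbb T)$, $\mathbb T=\mathbb R/\mathbb Z$, with $\|u\|_{H^s(\mathbb T)}^2=\sum_n(1+n^2)^s|u_n|^2$, functions on $[0,1]$ being viewed as functions on $\mathbb T$. *)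

theory Defs
  imports "HOL-Analysis.Analysis" "HOL-Library.Landau_Symbols"
begin

text \<open>
  Functions of \<open>y\<close> are represented by functions on the reals of which only the restriction to
  \<open>[0,1]\<close> matters, up to equality almost everywhere.
\<close>

abbreviation leb01 :: "real measure" where
  "leb01 \<equiv> lebesgue_on {0..1}"

definition L2 :: "(real \<Rightarrow> complex) set" where
  "L2 = {u. u \<in> borel_measurable leb01 \<and> integrable leb01 (\<lambda>y. (cmod (u y))\<^sup>2)}"

definition L2_norm :: "(real \<Rightarrow> complex) \<Rightarrow> real" where
  "L2_norm u = sqrt (integral\<^sup>L leb01 (\<lambda>y. (cmod (u y))\<^sup>2))"

definition Linf :: "(real \<Rightarrow> real) set" where
  "Linf = {u. u \<in> borel_measurable leb01 \<and> (\<exists>M. AE y in leb01. \<bar>u y\<bar> \<le> M)}"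

text \<open>
  Weak derivatives on the open interval \<open>(0,1)\<close> and on the torus differ only in the test
  functions: \<open>C\<^sup>1\<close> with compact support in \<open>(0,1)\<close>, respectively \<open>C\<^sup>1\<close> and \<open>1\<close>-periodic.
\<close>

definition interval_tests :: "(real \<Rightarrow> real) set" where
  "interval_tests = {\<phi>. \<phi> C1_differentiable_on UNIV \<and>
     (\<exists>a b. 0 < a \<and> b < 1 \<and> (\<forall>y. y \<notin> {a..b} \<longrightarrow> \<phi> y = 0))}"

definition torus_tests :: "(real \<Rightarrow> real) set" where
  "torus_tests = {\<phi>. \<phi> C1_differentiable_on UNIV \<and> (\<forall>y. \<phi> (y + 1) = \<phi> y)}"

definition has_weak_deriv ::
    "(real \<Rightarrow> real) set \<Rightarrow> (real \<Rightarrow> 'a::{banach, second_countable_topology}) \<Rightarrow> (real \<Rightarrow> 'a) \<Rightarrow> bool"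
  where
  "has_weak_deriv T u v \<longleftrightarrow> integrable leb01 u \<and> integrable leb01 v \<and>
     (\<forall>\<phi>\<in>T. integral\<^sup>L leb01 (\<lambda>y. deriv \<phi> y *\<^sub>R u y) = - integral\<^sup>L leb01 (\<lambda>y. \<phi> y *\<^sub>R v y))"

definition W2inf_torus :: "(real \<Rightarrow> real) set" where
  "W2inf_torus = {u \<in> Linf. \<exists>u' \<in> Linf. \<exists>u'' \<in> Linf.
     has_weak_deriv torus_tests u u' \<and> has_weak_deriv torus_tests u' u''}"

text \<open>
  The weak derivative on \<open>(0,1)\<close>; it is determined up to a null set and meaningful only for
  functions that are weakly differentiable.
\<close>

definition wderiv :: "(real \<Rightarrow> complex) \<Rightarrow> real \<Rightarrow> complex" where
  "wderiv u = (SOME v. has_weak_deriv interval_tests u v)"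

definition H1 :: "(real \<Rightarrow> complex) set" where
  "H1 = {u \<in> L2. \<exists>v \<in> L2. has_weak_deriv interval_tests u v}"

definition H1_norm :: "(real \<Rightarrow> complex) \<Rightarrow> real" where
  "H1_norm u = sqrt ((L2_norm u)\<^sup>2 + (L2_norm (wderiv u))\<^sup>2)"

text \<open>The boundary values of an \<open>H\<^sup>1\<close> function are those of its continuous representative.\<close>

definition H1_dirichlet :: "(real \<Rightarrow> complex) set" where
  "H1_dirichlet = {u \<in> H1. \<exists>v. continuous_on {0..1} v \<and> (AE y in leb01. u y = v y) \<and>
     v 0 = 0 \<and> v 1 = 0}"

definition fourier_coeff :: "(real \<Rightarrow> complex) \<Rightarrow> int \<Rightarrow> complex" where
  "fourier_coeff u n = integral\<^sup>L leb01 (\<lambda>y. u y * cis (- 2 * pi * of_int n * y))"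

definition Hs_torus :: "real \<Rightarrow> (real \<Rightarrow> complex) set" where
  "Hs_torus s = {u \<in> L2.
     (\<lambda>n. (1 + (of_int n)\<^sup>2) powr s * (cmod (fourier_coeff u n))\<^sup>2) summable_on UNIV}"

definition Hs_torus_norm :: "real \<Rightarrow> (real \<Rightarrow> complex) \<Rightarrow> real" where
  "Hs_torus_norm s u =
     sqrt (\<Sum>\<^sub>\<infinity>n. (1 + (of_int n)\<^sup>2) powr s * (cmod (fourier_coeff u n))\<^sup>2)"

text \<open>
  Functions of \<open>(x,y)\<close>, of period \<open>L\<close> and mean zero in \<open>x\<close>, are given by their Fourier
  transform \<open>u k y\<close> in \<open>x\<close>.  For a space \<open>X\<close> of functions of \<open>y\<close> with norm \<open>N\<close>, \<open>L2x L X N\<close> is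
  the space \<open>L\<^sup>2\<^sub>x X\<^sub>y\<close>, whose squared norm is the sum over \<open>k\<close> of the squared norms in \<open>X\<close>.
\<close>

definition modes :: "real \<Rightarrow> real set" where
  "modes L = (\<lambda>n::int. 2 * pi / L * of_int n) ` (UNIV - {0})"

definition L2x ::
    "real \<Rightarrow> (real \<Rightarrow> complex) set \<Rightarrow> ((real \<Rightarrow> complex) \<Rightarrow> real) \<Rightarrow> (real \<Rightarrow> real \<Rightarrow> complex) set"
  where
  "L2x L X N = {u. (\<forall>k\<in>modes L. u k \<in> X) \<and> (\<lambda>k. (N (u k))\<^sup>2) summable_on modes L}"

definition L2x_norm ::
    "real \<Rightarrow> ((real \<Rightarrow> complex) \<Rightarrow> real) \<Rightarrow> (real \<Rightarrow> real \<Rightarrow> complex) \<Rightarrow> real" where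
  "L2x_norm L N u = sqrt (\<Sum>\<^sub>\<infinity>k\<in>modes L. (N (u k))\<^sup>2)"

text \<open>The first-order operator \<open>g(y) (\<partial>\<^sub>y/k - it)\<close>.\<close>

definition shear_deriv ::
    "(real \<Rightarrow> real) \<Rightarrow> real \<Rightarrow> real \<Rightarrow> (real \<Rightarrow> complex) \<Rightarrow> real \<Rightarrow> complex" where
  "shear_deriv g t k u =
     (\<lambda>y. of_real (g y) * (wderiv u y / of_real k - \<i> * of_real t * u y))"

definition vertical_velocity :: "(real \<Rightarrow> real \<Rightarrow> complex) \<Rightarrow> real \<Rightarrow> real \<Rightarrow> complex" where
  "vertical_velocity \<Phi> = (\<lambda>k y. \<i> / of_real k * \<Phi> k y)"

text \<open>
  Solutions on \<open>[0,\<infinity>)\<close>, mode by mode: the time derivative is the strong derivative in \<open>L\<^sup>2\<^sub>y\<close>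
  (one-sided at \<open>t = 0\<close>), and the elliptic equation holds almost everywhere in \<open>y\<close>, where \<open>\<Phi>\<close> and
  \<open>g (\<partial>\<^sub>y/k - it) \<Phi>\<close> are in \<open>H\<^sup>1\<close>, so that both derivatives make sense.
\<close>

definition linearized_euler_solution ::
    "real \<Rightarrow> (real \<Rightarrow> real) \<Rightarrow> (real \<Rightarrow> real) \<Rightarrow> (real \<Rightarrow> real \<Rightarrow> complex) \<Rightarrow>
     (real \<Rightarrow> real \<Rightarrow> real \<Rightarrow> complex) \<Rightarrow> (real \<Rightarrow> real \<Rightarrow> real \<Rightarrow> complex) \<Rightarrow> bool" where
  "linearized_euler_solution L f g \<omega>\<^sub>0 W \<Phi> \<longleftrightarrow>
     (\<forall>k\<in>modes L.
        (AE y in leb01. W 0 k y = \<omega>\<^sub>0 k y) \<and>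
        (\<forall>t\<ge>0.
           W t k \<in> L2 \<and>
           ((\<lambda>\<tau>. L2_norm (\<lambda>y. (W \<tau> k y - W t k y) / of_real (\<tau> - t)
                 - \<i> * of_real (f y) / of_real k * \<Phi> t k y)) \<longlongrightarrow> 0) (at t within {0..}) \<and>
           \<Phi> t k \<in> H1_dirichlet \<and>
           shear_deriv g t k (\<Phi> t k) \<in> H1 \<and>
           (AE y in leb01.
              - \<Phi> t k y + shear_deriv g t k (shear_deriv g t k (\<Phi> t k)) y = W t k y)))"

end

theory Submission
  imports Defs
begin

text \<open>
  After conjugation with \<open>e\<^sup>i\<^sup>k\<^sup>t\<^sup>y\<close> the elliptic equation no longer depends on \<open>t\<close>, and its right-hand
  side becomes \<open>e\<^sup>-\<^sup>i\<^sup>k\<^sup>t\<^sup>y W\<close>.  By duality \<open>\<parallel>\<Phi>\<parallel>\<^sup>2\<close> is controlled by an oscillatory integral of \<open>W\<close> against a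
  function \<open>h\<close> in \<open>H\<^sup>2 \<inter> H\<^sup>1\<^sub>0\<close>.  One integration by parts gains \<open>1/(kt)\<close>.  It leaves \<open>\<partial>\<^sub>yW h\<close>, where the
  vanishing of \<open>h\<close> at the boundary makes \<open>h\<close> periodic and the \<open>H\<^sup>s\<close> bound gains \<open>(kt)\<^sup>-\<^sup>s\<close>, and \<open>W \<partial>\<^sub>yh\<close>, which
  is integrated by parts once more.  Hence \<open>\<parallel>V\<^sub>2\<parallel> = O(t\<^sup>-\<^sup>1\<^sup>-\<^sup>s)\<close>, which is integrable in time, so that
  \<open>\<partial>\<^sub>tW = f V\<^sub>2\<close> yields the limit with rate \<open>t\<^sup>-\<^sup>s\<close>.  The limit lies in \<open>H\<^sup>s\<close> because \<open>H\<^sup>1([0,1])\<close> embeds into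
  \<open>H\<^sup>s\<close> of the torus for \<open>s < 1/2\<close> and bounds on Fourier coefficients pass to the limit.
\<close>

subsection \<open>Absolutely continuous functions on the unit interval\<close>

text \<open>Uniformity in k shapes the estimates. The dual function h has derivatives of size |k|
  and k^2 relative to \<Phi>, while each integration by parts gains 1/(|k| t). The powers of k
  cancel, so constants depend on k only through the smallest mode 2 pi / L, and the bounds for
  single modes can be summed in l^2. Duality moves the y-derivatives of the elliptic problem onto h.
  Its second derivative contains the oscillating \<Phi> only undifferentiated, so no power of t is
  lost. It also contains the second derivative of the weight 1/|g|; since g' = f/g, one weak
  derivative of f provides two of the weight. W need not vanish at the boundary, so the second
  integration by parts leaves boundary values. They enter with t^(-2), which is below t^(-1-s). Weak
  derivatives, on the interval and on the torus, are converted into the relation \<open>ac\<close>,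
  where the product rule and integration by parts hold with genuine boundary values.\<close>

abbreviation int01 :: "(real \<Rightarrow> 'a::{banach, second_countable_topology}) \<Rightarrow> 'a" where
  "int01 \<equiv> integral\<^sup>L leb01"

text \<open>The cut-off sits inside an integral over the fixed measure \<open>leb01\<close>. Hence
  \<open>prim v\<close> makes sense for every real argument (0 below the interval, constant above
  it), and Fubini applies without varying domains.\<close>

definition prim :: "(real \<Rightarrow> complex) \<Rightarrow> real \<Rightarrow> complex" where
  "prim v y = int01 (\<lambda>x. indicator {..y} x *\<^sub>R v x)"

text \<open>\<open>ac u u'\<close>: on \<open>[0,1]\<close>, \<open>u\<close> is absolutely continuous with almost everywhere derivative \<open>u'\<close>.\<close>

definition ac :: "(real \<Rightarrow> complex) \<Rightarrow> (real \<Rightarrow> complex) \<Rightarrow> bool" where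
  "ac u u' \<longleftrightarrow> integrable leb01 u' \<and> (\<forall>y\<in>{0..1}. u y = u 0 + prim u' y)"

lemma finite_leb01: "finite_measure leb01"
  by (rule finite_measure_lebesgue_on) auto

interpretation leb01: finite_measure leb01 by (rule finite_leb01)

lemma leb01_borel_measurable: "f \<in> borel_measurable borel \<Longrightarrow> f \<in> borel_measurable leb01"
  by (intro measurable_restrict_space1 measurable_completion) simp

lemma leb01_indicator [measurable (raw)]:
  "A \<in> sets borel \<Longrightarrow> (indicator A :: real \<Rightarrow> real) \<in> borel_measurable leb01"
  by (rule leb01_borel_measurable, rule borel_measurable_indicator)

lemma integrable_indicator_leb01:
  fixes v :: "real \<Rightarrow> 'a::{banach, second_countable_topology}"
  assumes "integrable leb01 v" "A \<in> sets borel"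
  shows "integrable leb01 (\<lambda>x. indicator A x *\<^sub>R v x)"
proof (rule Bochner_Integration.integrable_bound[OF assms(1)])
  show "(\<lambda>x. indicator A x *\<^sub>R v x) \<in> borel_measurable leb01"
    using assms by measurable
qed (auto simp: indicator_def)

lemma AE_leb01_mono: "(\<And>y. y \<in> {0..1} \<Longrightarrow> P y) \<Longrightarrow> AE y in leb01. P y"
  by (rule AE_I2) auto

lemma AE_leb01_not_eq: "AE y in leb01. y \<noteq> (a::real)"
proof -
  have "AE y in lebesgue. y \<noteq> a"
    by (intro AE_completion AE_lborel_singleton)
  then show ?thesis
    by (subst AE_restrict_space_iff) (auto elim: eventually_mono)
qed

text \<open>Dynkin's theorem: the half-lines {..a} are stable under intersection and generate the
  Borel sets. The sets over which D integrates to 0 are closed under complement, as the total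
  integral is \<open>prim D 1\<close>, and under countable disjoint union by dominated
  convergence.\<close>

lemma set_integral_zero_if_prim_zero:
  fixes D :: "real \<Rightarrow> complex"
  assumes D: "integrable leb01 D" and z: "\<And>y. y \<in> {0..1} \<Longrightarrow> prim D y = 0"
    and A: "A \<in> sets borel"
  shows "int01 (\<lambda>x. indicator A x *\<^sub>R D x) = 0"
proof -
  have z': "prim D y = 0" for y
  proof -
    consider "y < 0" | "y \<in> {0..1}" | "y > 1" by fastforce
    then show ?thesis
    proof cases
      case 1
      then show ?thesis unfolding prim_def
        by (intro integral_eq_zero_AE AE_leb01_mono) (auto simp: indicator_def)
    next
      case 3
      then have "prim D y = prim D 1" unfolding prim_def
        by (intro Bochner_Integration.integral_cong) (auto simp: indicator_def)
      then show ?thesis using z by simp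
    qed (use z in auto)
  qed
  have gen: "A \<in> sigma_sets UNIV (range (\<lambda>a::real. {..a}))"
    using A by (simp add: borel_eq_atMost)
  have tot: "int01 D = 0"
  proof -
    have "int01 D = prim D 1" unfolding prim_def
      by (intro Bochner_Integration.integral_cong) (auto simp: indicator_def)
    then show ?thesis using z by simp
  qed
  have subset_Pow_UNIV: "range (\<lambda>a::real. {..a}) \<subseteq> Pow UNIV" by simp
  have st: "Int_stable (range (\<lambda>a::real. {..a}))"
    by (auto simp: Int_stable_def)
  show ?thesis
    using gen
  proof (induction rule: sigma_sets_induct_disjoint[OF st subset_Pow_UNIV, consumes 1, case_names basic empty compl union])
    case (basic A)
    then show ?case using z' by (auto simp: prim_def)
  next
    case empty
    then show ?case by simp
  next
    case (compl A)
    have Ab: "A \<in> sets borel" using compl(1) by (simp add: borel_eq_atMost)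
    have "int01 (\<lambda>x. indicator (UNIV - A) x *\<^sub>R D x) =
        int01 (\<lambda>x. D x - indicator A x *\<^sub>R D x)"
      by (intro Bochner_Integration.integral_cong) (auto simp: indicator_def)
    also have "\<dots> = 0"
      using D integrable_indicator_leb01[OF D Ab] compl(2) tot by (simp)
    finally show ?case .
  next
    case (union A)
    have Ab: "A i \<in> sets borel" for i using union(2) by (auto simp: borel_eq_atMost)
    have "(\<lambda>i. int01 (\<lambda>x. indicator (A i) x *\<^sub>R D x)) sums
        int01 (\<lambda>x. indicator (\<Union>(range A)) x *\<^sub>R D x)"
    proof -
      have "(\<lambda>n. int01 (\<lambda>x. indicator (\<Union>i<n. A i) x *\<^sub>R D x)) \<longlonglongrightarrow>
        int01 (\<lambda>x. indicator (\<Union>(range A)) x *\<^sub>R D x)"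
      proof (rule integral_dominated_convergence[where w="\<lambda>x. norm (D x)"])
        show "(\<lambda>x. indicator (\<Union> (range A)) x *\<^sub>R D x) \<in> borel_measurable leb01"
          using Ab D by (intro borel_measurable_integrable integrable_indicator_leb01) auto
        show "(\<lambda>x. indicator (\<Union>i<n. A i) x *\<^sub>R D x) \<in> borel_measurable leb01" for n
          using Ab D by (intro borel_measurable_integrable integrable_indicator_leb01) auto
        show "integrable leb01 (\<lambda>x. norm (D x))" using D by simp
        show "AE x in leb01. (\<lambda>n. indicator (\<Union>i<n. A i) x *\<^sub>R D x) \<longlonglongrightarrow> indicator (\<Union>(range A)) x *\<^sub>R D x"
          by (intro AE_I2 tendsto_scaleR tendsto_const LIMSEQ_indicator_UN)
        show "AE x in leb01. norm (indicator (\<Union>i<n. A i) x *\<^sub>R D x) \<le> norm (D x)" for n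
          by (intro AE_I2) (auto simp: indicator_def)
      qed
      moreover have "int01 (\<lambda>x. indicator (\<Union>i<n. A i) x *\<^sub>R D x) =
          (\<Sum>i<n. int01 (\<lambda>x. indicator (A i) x *\<^sub>R D x))" for n
      proof -
        have "indicator (\<Union>i<n. A i) x = (\<Sum>i<n. indicator (A i) x :: real)" for x
          by (rule indicator_UN_disjoint) (use union(1) in \<open>auto simp: disjoint_family_on_def\<close>)
        then have "int01 (\<lambda>x. indicator (\<Union>i<n. A i) x *\<^sub>R D x) =
          int01 (\<lambda>x. \<Sum>i<n. indicator (A i) x *\<^sub>R D x)"
          by (simp add: scaleR_left.sum)
        also have "\<dots> = (\<Sum>i<n. int01 (\<lambda>x. indicator (A i) x *\<^sub>R D x))"
          using integrable_indicator_leb01[OF D Ab] by (intro Bochner_Integration.integral_sum) auto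
        finally show ?thesis .
      qed
      ultimately show ?thesis by (simp add: sums_def)
    qed
    then show ?case using union(3) by (simp add: sums_iff)
  qed
qed

text \<open>A Lebesgue set is a Borel set up to a null set, so D integrates to 0 over every
  measurable set, and an integrable function is determined by these integrals. Thus a primitive
  determines its integrand.\<close>

lemma AE_zero_if_prim_zero:
  fixes D :: "real \<Rightarrow> complex"
  assumes D: "integrable leb01 D" and z: "\<And>y. y \<in> {0..1} \<Longrightarrow> prim D y = 0"
  shows "AE y in leb01. D y = 0"
proof -
  have "set_lebesgue_integral leb01 A D = set_lebesgue_integral leb01 A (\<lambda>_. 0)" if A: "A \<in> sets leb01" for A
  proof -
    obtain A' where A': "A = {0..1} \<inter> A'" "A' \<in> sets lebesgue"
      using A by (auto simp: sets_restrict_space)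
    then obtain S N N' where SN: "A' = S \<union> N" "S \<in> sets lborel" "N' \<in> null_sets lborel" "N \<subseteq> N'"
      by (auto elim!: sets_completionE)
    have "N' \<in> null_sets lebesgue"
      using SN(3) null_sets_completionI by blast
    then have "AE x in lebesgue. x \<notin> N'" by (rule AE_not_in)
    then have ae: "AE x in leb01. x \<notin> N'"
      by (subst AE_restrict_space_iff) (auto elim: eventually_mono)
    have S: "S \<in> sets borel" using SN by simp
    have "set_lebesgue_integral leb01 A D = int01 (\<lambda>x. indicator S x *\<^sub>R D x)"
      unfolding set_lebesgue_integral_def
    proof (rule integral_cong_AE)
      show "(\<lambda>x. indicat_real A x *\<^sub>R D x) \<in> borel_measurable leb01"
        using A D by measurable
      show "(\<lambda>x. indicat_real S x *\<^sub>R D x) \<in> borel_measurable leb01"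
        using S D by measurable
      have *: "indicat_real A x *\<^sub>R D x = indicat_real S x *\<^sub>R D x" if "x \<in> {0..1}" "x \<notin> N'" for x
        using that SN A' by (auto simp: indicator_def)
      show "AE x in leb01. indicat_real A x *\<^sub>R D x = indicat_real S x *\<^sub>R D x"
        using ae AE_space[of leb01] by eventually_elim (simp add: *)
    qed
    also have "\<dots> = 0"
      by (rule set_integral_zero_if_prim_zero[OF D z S])
    finally show ?thesis by (simp add: set_lebesgue_integral_def)
  qed
  then show ?thesis
    by (intro leb01.density_unique_banach) (use D in auto)
qed

lemma continuous_measurable_leb01:
  fixes v :: "real \<Rightarrow> 'a::euclidean_space"
  shows "continuous_on {0..1} v \<Longrightarrow> v \<in> borel_measurable leb01"
  by (rule continuous_imp_measurable_on_sets_lebesgue) auto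

lemma integrable_mult_bounded:
  fixes u v :: "real \<Rightarrow> complex"
  assumes "integrable leb01 u" "v \<in> borel_measurable leb01" "AE y in leb01. cmod (v y) \<le> B"
  shows "integrable leb01 (\<lambda>y. u y * v y)" "integrable leb01 (\<lambda>y. v y * u y)"
proof -
  have i: "integrable leb01 (\<lambda>y. B * cmod (u y))" using assms by simp
  show *: "integrable leb01 (\<lambda>y. u y * v y)"
  proof (rule Bochner_Integration.integrable_bound[OF i])
    show "(\<lambda>y. u y * v y) \<in> borel_measurable leb01" using assms by measurable
    show "AE y in leb01. norm (u y * v y) \<le> norm (B * cmod (u y))"
      using assms(3)
    proof eventually_elim
      case (elim y)
      then have "0 \<le> B" using norm_ge_zero order_trans by blast
      then show ?case using elim by (simp add: norm_mult abs_mult mult.commute[of "cmod (u y)"] mult_right_mono)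
    qed
  qed
  then show "integrable leb01 (\<lambda>y. v y * u y)" by (simp add: mult.commute)
qed

lemma continuous_bounded_01:
  fixes v :: "real \<Rightarrow> 'a::euclidean_space"
  assumes "continuous_on {0..1} v"
  obtains B where "B > 0" "\<And>y. y \<in> {0..1} \<Longrightarrow> norm (v y) \<le> B"
proof -
  have "bounded (v ` {0..1})" using assms compact_continuous_image compact_imp_bounded by blast
  then show ?thesis using that by (auto simp: bounded_pos)
qed

lemma integrable_mult_continuous:
  fixes u v :: "real \<Rightarrow> complex"
  assumes "integrable leb01 u" "continuous_on {0..1} v"
  shows "integrable leb01 (\<lambda>y. u y * v y)" "integrable leb01 (\<lambda>y. v y * u y)"
proof -
  obtain B where "\<And>y. y \<in> {0..1} \<Longrightarrow> norm (v y) \<le> B"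
    using continuous_bounded_01[OF assms(2)] by blast
  then have "AE y in leb01. cmod (v y) \<le> B" by (intro AE_leb01_mono)
  then show "integrable leb01 (\<lambda>y. u y * v y)" "integrable leb01 (\<lambda>y. v y * u y)"
    using integrable_mult_bounded[OF assms(1) continuous_measurable_leb01[OF assms(2)]] by auto
qed

lemma integrable_continuous_leb01:
  fixes v :: "real \<Rightarrow> 'a::euclidean_space"
  assumes "continuous_on {0..1} v" shows "integrable leb01 v"
  using continuous_imp_integrable_real[OF assms] .

lemma prim_eq_integral:
  assumes "integrable leb01 v" "y \<in> {0..1}"
  shows "prim v y = integral {0..y} v" "v integrable_on {0..y}"
proof -
  have i: "integrable leb01 (\<lambda>x. indicator {..y} x *\<^sub>R v x)"
    by (rule integrable_indicator_leb01[OF assms(1)]) simp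
  have "prim v y = integral {0..1} (\<lambda>x. indicator {..y} x *\<^sub>R v x)"
    unfolding prim_def by (rule lebesgue_integral_eq_integral[OF i]) simp
  also have "\<dots> = integral {0..1} (\<lambda>x. if x \<in> {..y} then v x else 0)"
    by (intro Henstock_Kurzweil_Integration.integral_cong) (auto simp: indicator_def)
  also have "\<dots> = integral ({..y} \<inter> {0..1}) v"
    by (rule integral_restrict_Int)
  also have "{..y} \<inter> {0..1} = {0..y}" using assms by auto
  finally show "prim v y = integral {0..y} v" .
  show "v integrable_on {0..y}"
    using integrable_on_lebesgue_on[OF assms(1)] assms(2)
    by (auto intro: integrable_on_subinterval)
qed

lemma prim_0 [simp]: "prim v 0 = 0"
proof -
  have "AE x in leb01. indicator {..0} x *\<^sub>R v x = 0"
    using AE_leb01_not_eq[of 0] AE_space[of leb01] by eventually_elim auto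
  then show ?thesis unfolding prim_def by (rule integral_eq_zero_AE)
qed

lemma prim_1: "prim v 1 = int01 v"
  unfolding prim_def by (intro Bochner_Integration.integral_cong) (auto simp: indicator_def)

lemma continuous_prim:
  assumes "integrable leb01 v" shows "continuous_on {0..1} (prim v)"
proof -
  have "continuous_on {0..1} (\<lambda>y. integral {0..y} v)"
    by (rule indefinite_integral_continuous_1) (use integrable_on_lebesgue_on[OF assms] in auto)
  then show ?thesis
    by (rule continuous_on_eq) (use prim_eq_integral[OF assms] in auto)
qed

lemma prim_add:
  assumes "integrable leb01 u" "integrable leb01 v"
  shows "prim (\<lambda>x. u x + v x) y = prim u y + prim v y"
  unfolding prim_def scaleR_add_right
  by (intro Bochner_Integration.integral_add integrable_indicator_leb01 assms) simp_all

lemma prim_cmult: "prim (\<lambda>x. c * v x) y = c * prim v y"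
  unfolding prim_def by (simp flip: mult_scaleR_right)

lemma prim_cong_AE:
  assumes "integrable leb01 u" "integrable leb01 v" "AE x in leb01. u x = v x"
  shows "prim u y = prim v y"
  unfolding prim_def
  by (intro integral_cong_AE borel_measurable_integrable integrable_indicator_leb01 assms)
    (use assms(3) in auto)

text \<open>Fubini on a triangle: the two terms integrate b x * a y over the complementary triangles
  x <= y and y <= x, whose common diagonal is a null set. This is integration by parts for merely
  integrable derivatives, with no pointwise differentiation.\<close>

lemma integral_by_parts_prim:
  assumes a: "integrable leb01 a" and b: "integrable leb01 b"
  shows "int01 (\<lambda>y. a y * prim b y) + int01 (\<lambda>x. b x * prim a x) =
    int01 a * int01 b"
proof -
  interpret P: pair_sigma_finite leb01 leb01
    by (intro pair_sigma_finite.intro leb01.sigma_finite_measure_axioms)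
  note [measurable] = borel_measurable_integrable[OF a] borel_measurable_integrable[OF b]
  have [measurable]: "fst \<in> borel_measurable (leb01 \<Otimes>\<^sub>M leb01)" "snd \<in> borel_measurable (leb01 \<Otimes>\<^sub>M leb01)"
    using measurable_compose[OF measurable_fst id_borel_measurable_lebesgue_on[of "{0..1}"]]
      measurable_compose[OF measurable_snd id_borel_measurable_lebesgue_on[of "{0..1}"]]
    by simp_all
  define G where "G = (\<lambda>(x,y). b x * a y)"
  define G2 where "G2 = (\<lambda>x y. indicator {..x} y *\<^sub>R (b x * a y))"
  have Gm [measurable]: "G \<in> borel_measurable (leb01 \<Otimes>\<^sub>M leb01)"
    unfolding G_def by measurable
  have Gi: "integrable (leb01 \<Otimes>\<^sub>M leb01) G"
    by (rule P.Fubini_integrable) (use a b in \<open>auto simp: G_def norm_mult intro!: AE_I2\<close>)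
  have "(\<lambda>p. (if snd p \<le> fst p then 1 else 0) *\<^sub>R G p) \<in> borel_measurable (leb01 \<Otimes>\<^sub>M leb01)"
    by measurable
  moreover have "(\<lambda>p. (if snd p \<le> fst p then 1 else 0) *\<^sub>R G p) = case_prod G2"
    by (auto simp: G2_def G_def fun_eq_iff indicator_def)
  ultimately have G2m: "case_prod G2 \<in> borel_measurable (leb01 \<Otimes>\<^sub>M leb01)" by simp
  have G2i: "integrable (leb01 \<Otimes>\<^sub>M leb01) (case_prod G2)"
    by (rule Bochner_Integration.integrable_bound[OF Gi G2m])
      (auto simp: G2_def G_def indicator_def)
  have "int01 (\<lambda>x. b x * prim a x) = int01 (\<lambda>x. int01 (\<lambda>y. G2 x y))"
    unfolding prim_def G2_def by (simp flip: mult_scaleR_right)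
  also have "\<dots> = int01 (\<lambda>y. int01 (\<lambda>x. G2 x y))"
    by (rule P.Fubini_integral[OF G2i, symmetric])
  also have "\<dots> = int01 (\<lambda>y. a y * int01 b - a y * prim b y)"
  proof (intro Bochner_Integration.integral_cong refl)
    fix y
    have m: "integrable leb01 (\<lambda>x. b x * a y - indicator {..y} x *\<^sub>R (b x * a y))"
      by (intro Bochner_Integration.integrable_diff integrable_indicator_leb01)
         (use b in auto)
    have "int01 (\<lambda>x. G2 x y) = int01 (\<lambda>x. b x * a y - indicator {..y} x *\<^sub>R (b x * a y))"
    proof (rule integral_cong_AE)
      have "(\<lambda>x. indicator {y..} x *\<^sub>R (b x * a y)) \<in> borel_measurable leb01"
        by (intro borel_measurable_integrable integrable_indicator_leb01) (use b in auto)
      also have "(\<lambda>x. indicator {y..} x *\<^sub>R (b x * a y)) = (\<lambda>x. G2 x y)"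
        by (auto simp: G2_def indicator_def)
      finally show "(\<lambda>x. G2 x y) \<in> borel_measurable leb01" .
      show "AE x in leb01. G2 x y = b x * a y - indicat_real {..y} x *\<^sub>R (b x * a y)"
        using AE_leb01_not_eq[of y] by eventually_elim (auto simp: G2_def indicator_def)
    qed (use m in auto)
    also have "\<dots> = int01 (\<lambda>x. b x * a y) - int01 (\<lambda>x. (indicator {..y} x *\<^sub>R b x) * a y)"
      by (subst Bochner_Integration.integral_diff[symmetric])
        (use b integrable_indicator_leb01[of "\<lambda>x. b x * a y" "{..y}"] in auto)
    also have "\<dots> = a y * int01 b - a y * prim b y"
      by (simp only: integral_mult_left_zero prim_def) (simp add: mult.commute)
    finally show "int01 (\<lambda>x. G2 x y) = a y * int01 b - a y * prim b y" .
  qed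
  also have "\<dots> = int01 a * int01 b - int01 (\<lambda>y. a y * prim b y)"
    by (subst Bochner_Integration.integral_diff)
      (use a integrable_mult_continuous(1)[OF a continuous_prim[OF b]] in auto)
  finally show ?thesis by simp
qed

section \<open>Calculus of absolutely continuous functions\<close>

lemma ac_I:
  "integrable leb01 u' \<Longrightarrow> (\<And>y. y \<in> {0..1} \<Longrightarrow> u y = u 0 + prim u' y) \<Longrightarrow> ac u u'"
  unfolding ac_def by blast

lemma ac_eq: "ac u u' \<Longrightarrow> y \<in> {0..1} \<Longrightarrow> u y = u 0 + prim u' y"
  unfolding ac_def by blast

lemma ac_integrable: "ac u u' \<Longrightarrow> integrable leb01 u'"
  by (simp add: ac_def)

lemma ac_continuous: "ac u u' \<Longrightarrow> continuous_on {0..1} u"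
  using continuous_on_cong[OF refl, of "{0..1}" u "\<lambda>y. u 0 + prim u' y"] ac_eq[of u u']
    continuous_on_add[OF continuous_on_const continuous_prim[OF ac_integrable[of u u']]] by blast

lemma ac_integral: "ac u u' \<Longrightarrow> int01 u' = u 1 - u 0"
  using ac_eq[of u u' 1] by (simp add: prim_1)

lemma ac_cong:
  assumes "ac u u'" "\<And>y. y \<in> {0..1} \<Longrightarrow> u y = v y" "integrable leb01 v'" "AE y in leb01. u' y = v' y"
  shows "ac v v'"
proof (rule ac_I)
  fix y :: real assume y: "y \<in> {0..1}"
  have "u y = u 0 + prim v' y"
    using ac_eq[OF assms(1) y] prim_cong_AE[OF ac_integrable[OF assms(1)] assms(3,4)] by metis
  then show "v y = v 0 + prim v' y"
    using assms(2)[OF y] assms(2)[of 0] by simp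
qed (rule assms)

lemma ac_prim: "integrable leb01 v \<Longrightarrow> ac (\<lambda>y. c + prim v y) v"
  by (rule ac_I) simp_all

lemma ac_add:
  assumes "ac u u'" "ac v v'"
  shows "ac (\<lambda>y. u y + v y) (\<lambda>y. u' y + v' y)"
proof (rule ac_I)
  fix y :: real assume y: "y \<in> {0..1}"
  show "u y + v y = u 0 + v 0 + prim (\<lambda>y. u' y + v' y) y"
    unfolding prim_add[OF ac_integrable[OF assms(1)] ac_integrable[OF assms(2)]]
      ac_eq[OF assms(1) y] ac_eq[OF assms(2) y] by simp
qed (use assms in \<open>auto dest: ac_integrable\<close>)

lemma ac_cmult:
  assumes "ac u u'"
  shows "ac (\<lambda>y. c * u y) (\<lambda>y. c * u' y)"
proof (rule ac_I)
  fix y :: real assume y: "y \<in> {0..1}"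
  show "c * u y = c * u 0 + prim (\<lambda>y. c * u' y) y"
    unfolding prim_cmult ac_eq[OF assms(1) y] by (simp add: algebra_simps)
qed (use assms in \<open>auto dest: ac_integrable\<close>)

lemma ac_diff:
  assumes "ac u u'" "ac v v'"
  shows "ac (\<lambda>y. u y - v y) (\<lambda>y. u' y - v' y)"
  using ac_add[OF assms(1) ac_cmult[OF assms(2), of "-1"]] by simp

text \<open>After the values at 0 are split off, only the product of two primitives remains, which
  is \<open>integral_by_parts_prim\<close>. Combined with \<open>ac_integral\<close> this gives the
  integrations by parts used below.\<close>

lemma ac_mult:
  assumes u: "ac u u'" and v: "ac v v'"
  shows "ac (\<lambda>y. u y * v y) (\<lambda>y. u' y * v y + u y * v' y)"
proof -
  note iu = ac_integrable[OF u] and iv = ac_integrable[OF v]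
  have i1: "integrable leb01 (\<lambda>y. u' y * v y)"
    by (rule integrable_mult_continuous(1)[OF iu ac_continuous[OF v]])
  have i2: "integrable leb01 (\<lambda>y. u y * v' y)"
    by (rule integrable_mult_continuous(2)[OF iv ac_continuous[OF u]])
  have "u Y * v Y = u 0 * v 0 + prim (\<lambda>y. u' y * v y + u y * v' y) Y" if Y: "Y \<in> {0..1}" for Y
  proof -
    \<comment> \<open>Cutting the derivatives off at Y turns the identity on [0,1] into the one on
      [0,Y]: the total integrals of a and b become the increments of u and v up to Y.\<close>
    define a where "a = (\<lambda>y. indicator {..Y} y *\<^sub>R u' y)"
    define b where "b = (\<lambda>y. indicator {..Y} y *\<^sub>R v' y)"
    have ia: "integrable leb01 a" and ib: "integrable leb01 b"
      unfolding a_def b_def by (intro integrable_indicator_leb01 iu iv; simp)+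
    have pa: "prim a y = prim u' y" and pb: "prim b y = prim v' y" if "y \<le> Y" for y
      unfolding prim_def a_def b_def
      by (intro Bochner_Integration.integral_cong; use that in \<open>auto simp: indicator_def\<close>)+
    have A: "int01 a = prim u' Y" "int01 b = prim v' Y"
      by (simp_all add: a_def b_def prim_def)
    have "prim (\<lambda>y. u' y * v y + u y * v' y) Y =
        int01 (\<lambda>y. (v 0 * a y + a y * prim b y) + (u 0 * b y + b y * prim a y))"
      unfolding prim_def[of "\<lambda>y. u' y * v y + u y * v' y"]
    proof (intro Bochner_Integration.integral_cong refl)
      fix y assume "y \<in> space leb01"
      then have y: "y \<in> {0..1}" by simp
      show "indicator {..Y} y *\<^sub>R (u' y * v y + u y * v' y) =
        (v 0 * a y + a y * prim b y) + (u 0 * b y + b y * prim a y)"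
      proof (cases "y \<le> Y")
        case True
        have "v y = v 0 + prim v' y" "u y = u 0 + prim u' y"
          using ac_eq[OF u y] ac_eq[OF v y] by blast+
        then show ?thesis using True pa pb
          by (simp add: a_def b_def algebra_simps)
      qed (simp add: a_def b_def)
    qed
    also have "\<dots> = (v 0 * int01 a + int01 (\<lambda>y. a y * prim b y))
        + (u 0 * int01 b + int01 (\<lambda>y. b y * prim a y))"
      using ia ib integrable_mult_continuous(1)[OF ia continuous_prim[OF ib]]
        integrable_mult_continuous(1)[OF ib continuous_prim[OF ia]]
      by simp
    also have "\<dots> = v 0 * prim u' Y + u 0 * prim v' Y + prim u' Y * prim v' Y"
      using integral_by_parts_prim[OF ia ib] A by (simp add: algebra_simps)
    finally have *: "prim (\<lambda>y. u' y * v y + u y * v' y) Y =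
      v 0 * prim u' Y + u 0 * prim v' Y + prim u' Y * prim v' Y" .
    have "v Y = v 0 + prim v' Y" "u Y = u 0 + prim u' Y"
      using ac_eq[OF u Y] ac_eq[OF v Y] by blast+
    then show ?thesis using * by (simp add: algebra_simps)
  qed
  then show ?thesis by (intro ac_I Bochner_Integration.integrable_add i1 i2)
qed

text \<open>The derivative exists at every point, one-sided at the ends, but need not be continuous;
  the fundamental theorem for the Henstock-Kurzweil integral covers this. It is needed for 1/|g|,
  whose derivative contains f, known to agree with a continuous function only almost
  everywhere.\<close>

lemma ac_of_deriv:
  assumes "\<And>y. y \<in> {0..1} \<Longrightarrow> (u has_vector_derivative u' y) (at y within {0..1})"
    and "integrable leb01 u'"
  shows "ac u u'"
proof -
  have "u y = u 0 + prim u' y" if y: "y \<in> {0..1}" for y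
  proof -
    have "(u' has_integral (u y - u 0)) {0..y}"
      by (rule fundamental_theorem_of_calculus)
        (use y assms(1) has_vector_derivative_within_subset[of u _ _ "{0..1}" "{0..y}"] in auto)
    then show ?thesis using prim_eq_integral[OF assms(2) y] by (simp add: integral_unique)
  qed
  then show ?thesis by (intro ac_I assms(2))
qed

lemma ac_C1:
  assumes "\<And>y. y \<in> {0..1} \<Longrightarrow> (u has_vector_derivative u' y) (at y within {0..1})"
    and "continuous_on {0..1} u'"
  shows "ac u u'"
  using ac_of_deriv[OF assms(1) integrable_continuous_leb01[OF assms(2)]] .

lemma ac_const: "ac (\<lambda>_. c) (\<lambda>_. 0)"
  by (rule ac_C1) auto

text \<open>The continuous function |u - v| has integral 0, hence vanishes on the closed interval.
  This carries the boundary values in \<open>H1_dirichlet\<close> over to the absolutely continuous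
  representative.\<close>

lemma AE_eq_imp_eq_on:
  fixes u v :: "real \<Rightarrow> complex"
  assumes "continuous_on {0..1} u" "continuous_on {0..1} v" "AE y in leb01. u y = v y" "y \<in> {0..1}"
  shows "u y = v y"
proof (rule ccontr)
  assume ne: "u y \<noteq> v y"
  have ci: "continuous_on {0..1} (\<lambda>x. cmod (u x - v x))"
    using assms by (auto intro!: continuous_intros)
  have "int01 (\<lambda>x. cmod (u x - v x)) = 0"
    by (rule integral_eq_zero_AE) (use assms(3) in auto)
  then show False
    using integralL_eq_0_iff[OF ci] assms(4) ne by auto
qed

subsection \<open>Weak derivatives\<close>

text \<open>The primitive of D is constant on (0,1), by continuity on [0,1], and it starts at 0.
  Intervals away from the end points suit both applications: tests with compact support in (0,1),
  and the circle, where 0 and 1 are one point.\<close>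

lemma AE_zero_if_interval_integrals_zero:
  fixes D :: "real \<Rightarrow> complex"
  assumes D: "integrable leb01 D"
    and z: "\<And>p q. 0 < p \<Longrightarrow> p < q \<Longrightarrow> q < 1 \<Longrightarrow> int01 (\<lambda>y. indicator {p<..<q} y *\<^sub>R D y) = 0"
  shows "AE y in leb01. D y = 0"
proof -
  have diff: "prim D q = prim D p" if "0 < p" "p < q" "q < 1" for p q
  proof -
    have i: "integrable leb01 (\<lambda>x. indicator A x *\<^sub>R D x)" if "A \<in> sets borel" for A
      by (rule integrable_indicator_leb01[OF D that])
    have "prim D q - prim D p = int01 (\<lambda>x. indicator {..q} x *\<^sub>R D x - indicator {..p} x *\<^sub>R D x)"
      unfolding prim_def by (rule Bochner_Integration.integral_diff[symmetric]) (auto intro: i)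
    also have "\<dots> = int01 (\<lambda>y. indicator {p<..<q} y *\<^sub>R D y)"
    proof (rule integral_cong_AE)
      show "AE x in leb01. indicat_real {..q} x *\<^sub>R D x - indicat_real {..p} x *\<^sub>R D x = indicat_real {p<..<q} x *\<^sub>R D x"
        using AE_leb01_not_eq[of q] by eventually_elim (use that in \<open>auto simp: indicator_def\<close>)
    qed (auto intro!: borel_measurable_integrable Bochner_Integration.integrable_diff i)
    finally show ?thesis using z[OF that] by simp
  qed
  have c: "continuous_on {0..1} (prim D)" by (rule continuous_prim[OF D])
  have eq: "prim D y = prim D (1/2)" if "y \<in> {0<..<1}" for y
  proof (rule linorder_cases[of y "1/2"])
    assume "y < 1/2"
    then show ?thesis using that diff[of y "1/2"] by simp
  next
    assume "y > 1/2"
    then show ?thesis using that diff[of "1/2" y] by simp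
  next
    assume "y = 1/2"
    then show ?thesis by (simp only:)
  qed
  have all: "prim D y = prim D (1/2)" if y: "y \<in> {0..1}" for y
  proof -
    have "closed {y \<in> {0..1}. prim D y = prim D (1/2)}"
      using continuous_closed_preimage_constant[OF c] by auto
    moreover have "{0<..<1} \<subseteq> {y \<in> {0..1}. prim D y = prim D (1/2)}"
    proof
      fix x :: real assume "x \<in> {0<..<1}"
      then show "x \<in> {y \<in> {0..1}. prim D y = prim D (1/2)}"
        using eq[of x] by (simp only: mem_Collect_eq) simp
    qed
    ultimately have "closure {0<..<1::real} \<subseteq> {y \<in> {0..1}. prim D y = prim D (1/2)}"
      by (intro closure_minimal)
    moreover have "y \<in> closure {0<..<1::real}" using y by simp
    ultimately show ?thesis by blast
  qed
  have "prim D y = 0" if "y \<in> {0..1}" for y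
    using all[OF that] all[of 0] prim_0[of D] by (metis atLeastAtMost_iff order_refl zero_le_one)
  then show ?thesis by (rule AE_zero_if_prim_zero[OF D])
qed

lemma LIMSEQ_min_one_mult:
  assumes "(0::real) \<le> x"
  shows "(\<lambda>j. min 1 (real j * x)) \<longlonglongrightarrow> (if x = 0 then 0 else 1)"
proof (cases "x = 0")
  case False
  then have x: "x > 0" using assms by simp
  have "\<forall>\<^sub>F j in sequentially. min 1 (real j * x) = 1"
    using eventually_ge_at_top[of "nat \<lceil>1 / x\<rceil>"]
  proof eventually_elim
    case (elim j)
    then have "1 / x \<le> real j" by linarith
    then show ?case using x by (simp add: field_simps min_def)
  qed
  then show ?thesis using False by (simp add: tendsto_eventually)
qed simp

text \<open>min 1 (j h) tends pointwise to the indicator of {h > 0} and is at most 1. The function h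
  is left open: it is a tent for tests on the interval and a distance on the circle for Fourier
  uniqueness.\<close>

lemma interval_integral_zero_if_approx:
  fixes D :: "real \<Rightarrow> complex"
  assumes D: "integrable leb01 D"
    and h: "continuous_on {0..1} h" "\<And>y. y \<in> {0..1} \<Longrightarrow> 0 \<le> h y"
    and p: "\<And>y. y \<in> {0..1} \<Longrightarrow> h y = 0 \<longleftrightarrow> y \<notin> {p<..<q}"
    and z: "\<And>j. int01 (\<lambda>y. min 1 (real j * h y) *\<^sub>R D y) = 0"
  shows "int01 (\<lambda>y. indicator {p<..<q} y *\<^sub>R D y) = 0"
proof -
  have hm: "(\<lambda>y. min 1 (real j * h y)) \<in> borel_measurable leb01" for j
    by (intro continuous_measurable_leb01 continuous_intros h)
  have "(\<lambda>j. int01 (\<lambda>y. min 1 (real j * h y) *\<^sub>R D y))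
     \<longlonglongrightarrow> int01 (\<lambda>y. indicator {p<..<q} y *\<^sub>R D y)"
  proof (rule integral_dominated_convergence[where w="\<lambda>x. norm (D x)"])
    show "(\<lambda>y. indicator {p<..<q} y *\<^sub>R D y) \<in> borel_measurable leb01"
      by (intro borel_measurable_integrable integrable_indicator_leb01 D) simp
    show "(\<lambda>y. min 1 (real j * h y) *\<^sub>R D y) \<in> borel_measurable leb01" for j
      using hm D by (intro borel_measurable_scaleR) auto
    show "integrable leb01 (\<lambda>x. norm (D x))" using D by simp
    show "AE y in leb01. (\<lambda>j. min 1 (real j * h y) *\<^sub>R D y) \<longlonglongrightarrow> indicator {p<..<q} y *\<^sub>R D y"
    proof (intro AE_leb01_mono tendsto_scaleR tendsto_const)
      fix y :: real assume y: "y \<in> {0..1}"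
      show "(\<lambda>j. min 1 (real j * h y)) \<longlonglongrightarrow> indicator {p<..<q} y"
        using LIMSEQ_min_one_mult[OF h(2)[OF y]] p[OF y] by (cases "h y = 0") (auto simp: indicator_def)
    qed
    show "AE y in leb01. norm (min 1 (real j * h y) *\<^sub>R D y) \<le> norm (D y)" for j
    proof (intro AE_leb01_mono)
      fix y :: real assume y: "y \<in> {0..1}"
      have "\<bar>min 1 (real j * h y)\<bar> \<le> 1" using h(2)[OF y] by (simp add: abs_le_iff)
      then show "norm (min 1 (real j * h y) *\<^sub>R D y) \<le> norm (D y)"
        by (simp add: mult_left_le_one_le)
    qed
  qed
  then show ?thesis using z by (simp add: LIMSEQ_const_iff)
qed

lemma integrable_scaleR_continuous:
  fixes u :: "real \<Rightarrow> complex" and v :: "real \<Rightarrow> real"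
  assumes "integrable leb01 u" "continuous_on {0..1} v"
  shows "integrable leb01 (\<lambda>y. v y *\<^sub>R u y)"
  using integrable_mult_continuous(2)[OF assms(1), of "\<lambda>y. of_real (v y)"] assms(2)
  by (simp add: scaleR_conv_of_real continuous_on_of_real)

lemma integral_scaleR_bound:
  fixes u :: "real \<Rightarrow> complex" and v :: "real \<Rightarrow> real"
  assumes "integrable leb01 u" "integrable leb01 (\<lambda>y. v y *\<^sub>R u y)"
    and "\<And>y. y \<in> {0..1} \<Longrightarrow> \<bar>v y\<bar> \<le> B"
  shows "cmod (int01 (\<lambda>y. v y *\<^sub>R u y)) \<le> B * int01 (\<lambda>y. cmod (u y))"
proof -
  have "cmod (int01 (\<lambda>y. v y *\<^sub>R u y)) \<le> int01 (\<lambda>y. B * cmod (u y))"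
    by (rule Bochner_Integration.integral_norm_bound_integral) (use assms in \<open>auto intro: mult_right_mono\<close>)
  then show ?thesis by simp
qed

text \<open>The lemma of du Bois-Reymond. A continuous function supported inside (0,1) is the
  derivative of a test function if its mean is 0, and subtracting a multiple of one fixed bump
  achieves this. The constant is the average of w against that bump.\<close>

lemma interval_tests_annihilator_const:
  fixes w :: "real \<Rightarrow> complex"
  assumes w: "integrable leb01 w"
    and z: "\<And>\<phi>. \<phi> \<in> interval_tests \<Longrightarrow> int01 (\<lambda>y. deriv \<phi> y *\<^sub>R w y) = 0"
  shows "\<exists>c. AE y in leb01. w y = c"
proof -
  define hat where "hat = (\<lambda>p q y::real. max 0 (min (y - p) (q - y)))"
  have hatc: "continuous_on S (hat p q)" for S p q
    unfolding hat_def by (intro continuous_intros)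
  have hat0: "hat p q y = 0 \<longleftrightarrow> y \<notin> {p<..<q}" for p q y
    by (auto simp: hat_def)
  define \<eta>0 where "\<eta>0 = hat (1/4) (3/4)"
  define m0 where "m0 = int01 \<eta>0"
  have \<eta>0c: "continuous_on S \<eta>0" for S unfolding \<eta>0_def by (rule hatc)
  have "m0 \<noteq> 0"
  proof
    assume "m0 = 0"
    then have "\<forall>x\<in>{0..1}. \<eta>0 x = 0"
      using integralL_eq_0_iff[of 0 1 \<eta>0] \<eta>0c by (simp add: m0_def \<eta>0_def hat_def)
    from this[rule_format, of "1/2"] show False
      by (simp add: \<eta>0_def hat0)
  qed
  define c where "c = (1 / m0) *\<^sub>R int01 (\<lambda>y. \<eta>0 y *\<^sub>R w y)"
  have key: "int01 (\<lambda>y. \<eta> y *\<^sub>R (w y - c)) = 0"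
    if \<eta>: "continuous_on UNIV \<eta>" and pq: "0 < p" "q < 1" "\<And>y. y \<notin> {p..q} \<Longrightarrow> \<eta> y = 0" for \<eta> p q
  proof -
    define m where "m = int01 \<eta>"
    define r where "r = m / m0"
    define \<theta> where "\<theta> = (\<lambda>y. \<eta> y - r * \<eta>0 y)"
    have \<theta>c: "continuous_on UNIV \<theta>"
      unfolding \<theta>_def by (intro continuous_intros \<eta> \<eta>0c)
    have \<eta>': "continuous_on {0..1} \<eta>" using \<eta> continuous_on_subset by blast
    have \<theta>i: "int01 \<theta> = 0"
      using integrable_continuous_leb01[OF \<eta>'] integrable_continuous_leb01[OF \<eta>0c] \<open>m0 \<noteq> 0\<close>
      by (simp add: \<theta>_def m_def[symmetric] m0_def[symmetric] r_def)
    obtain F where F: "\<And>x. (F has_vector_derivative \<theta> x) (at x)"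
      using einterval_antiderivative[of "-\<infinity>" "\<infinity>" \<theta>] \<theta>c
      by (auto simp: continuous_on_eq_continuous_at)
    define \<phi> where "\<phi> = (\<lambda>y. F y - F 0)"
    have \<phi>d: "(\<phi> has_vector_derivative \<theta> x) (at x within S)" for x S
      unfolding \<phi>_def using has_vector_derivative_at_within[OF F]
      by (auto intro!: derivative_eq_intros)
    \<comment> \<open>[A,B] contains the supports of \<eta> and of the bump. To its left \<phi> is 0
      by normalization, to its right because \<theta> has mean 0.\<close>
    define A where "A = min p (1/4)"
    define B where "B = max q (3/4)"
    have AB: "0 < A" "B < 1" "A < B" using pq by (auto simp: A_def B_def)
    have \<theta>0: "\<theta> y = 0" if "y \<notin> {A..B}" for y
    proof -
      have "y \<notin> {p..q}" "y \<notin> {1/4<..<3/4}" using that by (auto simp: A_def B_def)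
      then show ?thesis using pq(3) by (simp add: \<theta>_def \<eta>0_def hat0 del: atLeastAtMost_iff greaterThanLessThan_iff)
    qed
    have ftc: "\<phi> y - \<phi> x = integral {x..y} \<theta>" if "x \<le> y" for x y
      using fundamental_theorem_of_calculus[OF that, of \<phi> \<theta>] \<phi>d by (simp add: integral_unique)
    have "\<phi> 1 - \<phi> 0 = 0"
      using ftc[of 0 1] \<theta>i lebesgue_integral_eq_integral[OF integrable_continuous_leb01, of \<theta>]
        continuous_on_subset[OF \<theta>c] by simp
    then have \<phi>1: "\<phi> 1 = 0" "\<phi> 0 = 0" by (auto simp: \<phi>_def)
    have \<phi>0: "\<phi> y = 0" if y: "y \<notin> {A..B}" for y
    proof -
      have i0: "integral {x..y} \<theta> = 0" if "\<And>z. z \<in> {x..y} \<Longrightarrow> z \<notin> {A..B}" for x y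
        using \<theta>0 that by (intro integral_unique has_integral_is_0) blast
      show ?thesis
      proof (cases "y < A")
        case True
        then show ?thesis
          using ftc[of 0 y] i0[of 0 y] ftc[of y 0] i0[of y 0] \<phi>1 AB by (cases "0 \<le> y") fastforce+
      next
        case False
        then have "B < y" using y by auto
        then show ?thesis
          using ftc[of 1 y] i0[of 1 y] ftc[of y 1] i0[of y 1] \<phi>1 AB by (cases "1 \<le> y") fastforce+
      qed
    qed
    have "\<phi> C1_differentiable_on UNIV"
      unfolding C1_differentiable_on_def using \<phi>d \<theta>c by blast
    then have "\<phi> \<in> interval_tests"
      unfolding interval_tests_def using AB \<phi>0 by blast
    moreover have "deriv \<phi> = \<theta>"
      using \<phi>d by (intro ext DERIV_imp_deriv) (simp add: has_real_derivative_iff_has_vector_derivative)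
    ultimately have "int01 (\<lambda>y. \<theta> y *\<^sub>R w y) = 0" using z by metis
    moreover have "int01 (\<lambda>y. \<theta> y *\<^sub>R w y) =
        int01 (\<lambda>y. \<eta> y *\<^sub>R w y) - r *\<^sub>R int01 (\<lambda>y. \<eta>0 y *\<^sub>R w y)"
      using integrable_scaleR_continuous[OF w \<eta>'] integrable_scaleR_continuous[OF w \<eta>0c]
      by (simp add: \<theta>_def scaleR_left_diff_distrib flip: scaleR_scaleR)
    moreover have "int01 (\<lambda>y. \<eta> y *\<^sub>R (w y - c)) = int01 (\<lambda>y. \<eta> y *\<^sub>R w y) - m *\<^sub>R c"
      using integrable_scaleR_continuous[OF w \<eta>'] integrable_continuous_leb01[OF \<eta>']
      by (simp add: scaleR_diff_right m_def)
    ultimately show ?thesis by (simp add: c_def r_def)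
  qed
  have "AE y in leb01. w y - c = 0"
  proof (rule AE_zero_if_interval_integrals_zero)
    show i: "integrable leb01 (\<lambda>y. w y - c)" using w by simp
    fix p q :: real assume pq: "0 < p" "p < q" "q < 1"
    show "int01 (\<lambda>y. indicator {p<..<q} y *\<^sub>R (w y - c)) = 0"
    proof (rule interval_integral_zero_if_approx[OF i, where h="hat p q"])
      show "int01 (\<lambda>y. min 1 (real j * hat p q y) *\<^sub>R (w y - c)) = 0" for j
      proof (rule key[of _ p q])
        show "min 1 (real j * hat p q y) = 0" if "y \<notin> {p..q}" for y
        proof -
          have "hat p q y = 0" using that by (subst hat0) auto
          then show ?thesis by simp
        qed
      qed (use pq in \<open>auto intro!: continuous_intros hatc\<close>)
    qed (use hatc hat0 in \<open>auto simp: hat_def\<close>)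
  qed
  then show ?thesis by (intro exI[of _ c]) auto
qed

text \<open>Subtracting the primitive of v leaves a function that is orthogonal to all derivatives
  of test functions, hence a constant.\<close>

lemma weak_deriv_imp_ac:
  fixes u v :: "real \<Rightarrow> complex"
  assumes uv: "has_weak_deriv interval_tests u v"
  obtains c where "AE y in leb01. u y = c + prim v y"
proof -
  have u: "integrable leb01 u" and v: "integrable leb01 v"
    and t: "\<And>\<phi>. \<phi> \<in> interval_tests \<Longrightarrow>
      int01 (\<lambda>y. deriv \<phi> y *\<^sub>R u y) = - int01 (\<lambda>y. \<phi> y *\<^sub>R v y)"
    using uv unfolding has_weak_deriv_def by auto
  have pi: "integrable leb01 (prim v)" by (rule integrable_continuous_leb01[OF continuous_prim[OF v]])
  have "\<exists>c. AE y in leb01. u y - prim v y = c"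
  proof (rule interval_tests_annihilator_const)
    show "integrable leb01 (\<lambda>y. u y - prim v y)" using u pi by simp
    fix \<phi> assume \<phi>: "\<phi> \<in> interval_tests"
    then obtain \<phi>' where \<phi>': "\<And>x. (\<phi> has_vector_derivative \<phi>' x) (at x)" "continuous_on UNIV \<phi>'"
      unfolding interval_tests_def C1_differentiable_on_def by auto
    have d: "deriv \<phi> = \<phi>'"
      using \<phi>' by (intro ext DERIV_imp_deriv) (simp add: has_real_derivative_iff_has_vector_derivative)
    have c1: "continuous_on {0..1} \<phi>'" using \<phi>'(2) continuous_on_subset by blast
    have a: "ac (\<lambda>y. of_real (\<phi> y)) (\<lambda>y. of_real (\<phi>' y))"
      by (rule ac_C1) (use has_vector_derivative_at_within[OF \<phi>'(1)] c1 in
        \<open>auto intro!: has_vector_derivative_of_real continuous_intros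
          simp: has_real_derivative_iff_has_vector_derivative\<close>)
    have c0: "continuous_on {0..1} \<phi>"
      using \<phi>'(1) by (meson continuous_on_vector_derivative has_vector_derivative_at_within)
    have b: "\<phi> 0 = 0" "\<phi> 1 = 0" using \<phi> by (auto simp: interval_tests_def)
    have "int01 (\<lambda>y. of_real (\<phi>' y) * prim v y + of_real (\<phi> y) * v y) = 0"
      using ac_integral[OF ac_mult[OF a ac_prim[OF v, of 0]]] b by simp
    then have "int01 (\<lambda>y. \<phi>' y *\<^sub>R prim v y) = - int01 (\<lambda>y. \<phi> y *\<^sub>R v y)"
      using integrable_scaleR_continuous[OF pi c1] integrable_scaleR_continuous[OF v c0]
      by (simp add: scaleR_conv_of_real eq_neg_iff_add_eq_0)
    then show "int01 (\<lambda>y. deriv \<phi> y *\<^sub>R (u y - prim v y)) = 0"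
      using t[OF \<phi>] integrable_scaleR_continuous[OF u c1] integrable_scaleR_continuous[OF pi c1]
      by (simp add: d scaleR_diff_right)
  qed
  then obtain c where "AE y in leb01. u y - prim v y = c" by blast
  then have "AE y in leb01. u y = c + prim v y" by eventually_elim (simp add: algebra_simps)
  then show ?thesis by (rule that)
qed

subsection \<open>The space of square integrable functions\<close>

lemma L2_measurable: "u \<in> L2 \<Longrightarrow> u \<in> borel_measurable leb01"
  and L2_sq_integrable: "u \<in> L2 \<Longrightarrow> integrable leb01 (\<lambda>y. (cmod (u y))\<^sup>2)"
  by (auto simp: L2_def)

lemma L2_norm_nonneg [simp]: "0 \<le> L2_norm u"
  by (simp add: L2_norm_def)

lemma L2_norm_sq: "(L2_norm u)\<^sup>2 = int01 (\<lambda>y. (cmod (u y))\<^sup>2)"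
  by (simp add: L2_norm_def)

lemma L2_mult_integrable:
  assumes "u \<in> L2" "v \<in> L2"
  shows "integrable leb01 (\<lambda>y. u y * v y)"
proof (rule Bochner_Integration.integrable_bound)
  show "integrable leb01 (\<lambda>y. (cmod (u y))\<^sup>2 + (cmod (v y))\<^sup>2)"
    using assms by (intro Bochner_Integration.integrable_add L2_sq_integrable)
  show "(\<lambda>y. u y * v y) \<in> borel_measurable leb01"
    using assms by (intro borel_measurable_times L2_measurable)
  show "AE y in leb01. norm (u y * v y) \<le> norm ((cmod (u y))\<^sup>2 + (cmod (v y))\<^sup>2)"
  proof (intro AE_I2)
    fix y
    have "cmod (u y) * cmod (v y) \<le> (cmod (u y))\<^sup>2 + (cmod (v y))\<^sup>2"
      using sum_squares_bound[of "cmod (u y)" "cmod (v y)"]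
        zero_le_power2[of "cmod (u y)"] zero_le_power2[of "cmod (v y)"]
        mult_nonneg_nonneg[OF norm_ge_zero[of "u y"] norm_ge_zero[of "v y"]] by linarith
    then show "norm (u y * v y) \<le> norm ((cmod (u y))\<^sup>2 + (cmod (v y))\<^sup>2)"
      by (simp add: norm_mult)
  qed
qed

lemma L2_I_bounded:
  assumes "u \<in> borel_measurable leb01" "AE y in leb01. cmod (u y) \<le> B"
  shows "u \<in> L2"
proof -
  have "integrable leb01 (\<lambda>y. (cmod (u y))\<^sup>2)"
  proof (rule leb01.integrable_const_bound[where B="B\<^sup>2"])
    show "AE y in leb01. norm ((cmod (u y))\<^sup>2) \<le> B\<^sup>2"
      using assms(2) by eventually_elim (simp add: power_mono)
  qed (use assms in measurable)
  then show ?thesis using assms by (simp add: L2_def)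
qed

lemma L2_continuous: "continuous_on {0..1} u \<Longrightarrow> u \<in> L2"
  using continuous_bounded_01[of u] continuous_measurable_leb01[of u]
  by (metis AE_leb01_mono L2_I_bounded)

lemma L2_integrable: "u \<in> L2 \<Longrightarrow> integrable leb01 u"
  using L2_mult_integrable[of u "\<lambda>_. 1"] L2_continuous[of "\<lambda>_. 1"] by simp

lemma L2_cong_AE:
  assumes "u \<in> L2" "v \<in> borel_measurable leb01" "AE y in leb01. u y = v y"
  shows "v \<in> L2" "L2_norm v = L2_norm u"
proof -
  have m: "(\<lambda>y. (cmod (u y))\<^sup>2) \<in> borel_measurable leb01" "(\<lambda>y. (cmod (v y))\<^sup>2) \<in> borel_measurable leb01"
    using assms L2_measurable[OF assms(1)] by measurable
  have ae: "AE y in leb01. (cmod (u y))\<^sup>2 = (cmod (v y))\<^sup>2"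
    using assms(3) by eventually_elim simp
  show "v \<in> L2"
    using integrable_cong_AE_imp[OF L2_sq_integrable[OF assms(1)] m(2)] ae assms(2)
    by (simp add: L2_def eq_commute)
  show "L2_norm v = L2_norm u"
    unfolding L2_norm_def using integral_cong_AE[OF m ae] by simp
qed

text \<open>The quadratic polynomial x -> int (x|u| + |v|)^2 is nonnegative, which forces the
  inequality between its coefficients. The moduli stay inside the integral because the triangle
  inequality and the comparison with the L^1 norm need this form.\<close>

lemma L2_Cauchy_Schwarz_abs:
  assumes "u \<in> L2" "v \<in> L2"
  shows "int01 (\<lambda>y. cmod (u y) * cmod (v y)) \<le> L2_norm u * L2_norm v"
proof -
  define A where "A = int01 (\<lambda>y. (cmod (u y))\<^sup>2)"
  define B where "B = int01 (\<lambda>y. cmod (u y) * cmod (v y))"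
  define C where "C = int01 (\<lambda>y. (cmod (v y))\<^sup>2)"
  have iB: "integrable leb01 (\<lambda>y. cmod (u y) * cmod (v y))"
    using integrable_norm[OF L2_mult_integrable[OF assms]] by (simp add: norm_mult)
  note i = L2_sq_integrable[OF assms(1)] L2_sq_integrable[OF assms(2)] iB
  have q: "0 \<le> x\<^sup>2 * A + 2 * x * B + C" for x
  proof -
    have "0 \<le> int01 (\<lambda>y. (x * cmod (u y) + cmod (v y))\<^sup>2)"
      by (rule Bochner_Integration.integral_nonneg) simp
    also have "(\<lambda>y. (x * cmod (u y) + cmod (v y))\<^sup>2) =
      (\<lambda>y. x\<^sup>2 * (cmod (u y))\<^sup>2 + (2 * x) * (cmod (u y) * cmod (v y)) + (cmod (v y))\<^sup>2)"
      by (auto simp: power2_eq_square algebra_simps)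
    also have "int01 \<dots> = x\<^sup>2 * A + 2 * x * B + C"
      using i by (simp add: A_def B_def C_def)
    finally show ?thesis .
  qed
  have B0: "0 \<le> B" and A0: "0 \<le> A"
    unfolding A_def B_def by (auto intro!: Bochner_Integration.integral_nonneg)
  have "B\<^sup>2 \<le> A * C"
  proof (cases "A = 0")
    case True
    have "B = 0"
    proof (rule ccontr)
      assume "B \<noteq> 0"
      then have "2 * (- (C + 1) / (2 * B)) * B = - (C + 1)" by (simp add: field_simps)
      then show False using q[of "- (C + 1) / (2 * B)"] True by simp
    qed
    then show ?thesis using True by simp
  next
    case False
    then have "(- B / A)\<^sup>2 * A + 2 * (- B / A) * B + C = C - B\<^sup>2 / A"
      by (simp add: field_simps power2_eq_square)
    then have "B\<^sup>2 / A \<le> C" using q[of "- B / A"] by simp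
    then show ?thesis using False A0 by (simp add: field_simps)
  qed
  then have "sqrt (B\<^sup>2) \<le> sqrt (A * C)" by (rule real_sqrt_le_mono)
  then show ?thesis using B0 by (simp add: L2_norm_def A_def B_def C_def real_sqrt_mult)
qed

lemma L2_Cauchy_Schwarz:
  assumes "u \<in> L2" "v \<in> L2"
  shows "cmod (int01 (\<lambda>y. u y * v y)) \<le> L2_norm u * L2_norm v"
proof -
  have "cmod (int01 (\<lambda>y. u y * v y)) \<le> int01 (\<lambda>y. cmod (u y * v y))"
    by (rule integral_norm_bound)
  then show ?thesis using L2_Cauchy_Schwarz_abs[OF assms] by (simp add: norm_mult)
qed

lemma L2_mono:
  assumes "u \<in> L2" "v \<in> borel_measurable leb01" "AE y in leb01. cmod (v y) \<le> B * cmod (u y)" "0 \<le> B"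
  shows "v \<in> L2" "L2_norm v \<le> B * L2_norm u"
proof -
  have i: "integrable leb01 (\<lambda>y. B\<^sup>2 * (cmod (u y))\<^sup>2)" using assms by (simp add: L2_sq_integrable)
  have ae: "AE y in leb01. (cmod (v y))\<^sup>2 \<le> B\<^sup>2 * (cmod (u y))\<^sup>2"
    using assms(3) by eventually_elim (metis norm_ge_zero power_mono power_mult_distrib)
  have iv: "integrable leb01 (\<lambda>y. (cmod (v y))\<^sup>2)"
    by (rule Bochner_Integration.integrable_bound[OF i])
      (use assms(2) ae in \<open>auto elim!: eventually_mono\<close>)
  then show "v \<in> L2" using assms by (simp add: L2_def)
  have "int01 (\<lambda>y. (cmod (v y))\<^sup>2) \<le> int01 (\<lambda>y. B\<^sup>2 * (cmod (u y))\<^sup>2)"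
    by (rule integral_mono_AE[OF iv i ae])
  then have "sqrt (int01 (\<lambda>y. (cmod (v y))\<^sup>2)) \<le> sqrt (B\<^sup>2 * int01 (\<lambda>y. (cmod (u y))\<^sup>2))"
    by simp
  then show "L2_norm v \<le> B * L2_norm u"
    using assms(4) by (simp add: L2_norm_def real_sqrt_mult)
qed

lemma L2_mult_bounded:
  assumes "u \<in> L2" "m \<in> borel_measurable leb01" "AE y in leb01. cmod (m y) \<le> B" "0 \<le> B"
  shows "(\<lambda>y. m y * u y) \<in> L2" "L2_norm (\<lambda>y. m y * u y) \<le> B * L2_norm u"
proof -
  have ae: "AE y in leb01. cmod (m y * u y) \<le> B * cmod (u y)"
    using assms(3) by eventually_elim (simp add: norm_mult mult_right_mono)
  have m: "(\<lambda>y. m y * u y) \<in> borel_measurable leb01"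
    using assms(2) L2_measurable[OF assms(1)] by measurable
  show "(\<lambda>y. m y * u y) \<in> L2" "L2_norm (\<lambda>y. m y * u y) \<le> B * L2_norm u"
    using L2_mono[OF assms(1) m ae assms(4)] by auto
qed

lemma L2_cmult:
  assumes "u \<in> L2"
  shows "(\<lambda>y. c * u y) \<in> L2" "L2_norm (\<lambda>y. c * u y) = cmod c * L2_norm u"
proof -
  show "(\<lambda>y. c * u y) \<in> L2"
    using L2_mult_bounded(1)[OF assms, of "\<lambda>_. c" "cmod c"] by simp
  show "L2_norm (\<lambda>y. c * u y) = cmod c * L2_norm u"
    by (simp add: L2_norm_def norm_mult power_mult_distrib real_sqrt_mult)
qed

lemma L2_add:
  assumes "u \<in> L2" "v \<in> L2"
  shows "(\<lambda>y. u y + v y) \<in> L2" "L2_norm (\<lambda>y. u y + v y) \<le> L2_norm u + L2_norm v"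
proof -
  have iB: "integrable leb01 (\<lambda>y. cmod (u y) * cmod (v y))"
    using integrable_norm[OF L2_mult_integrable[OF assms]] by (simp add: norm_mult)
  define w where "w = (\<lambda>y. (cmod (u y))\<^sup>2 + 2 * (cmod (u y) * cmod (v y)) + (cmod (v y))\<^sup>2)"
  have iw: "integrable leb01 w"
    unfolding w_def using iB L2_sq_integrable[OF assms(1)] L2_sq_integrable[OF assms(2)] by simp
  have le: "(cmod (u y + v y))\<^sup>2 \<le> w y" for y
  proof -
    have "(cmod (u y + v y))\<^sup>2 \<le> (cmod (u y) + cmod (v y))\<^sup>2"
      by (intro power_mono norm_triangle_ineq) simp
    then show ?thesis by (simp add: w_def power2_eq_square algebra_simps)
  qed
  have m: "(\<lambda>y. u y + v y) \<in> borel_measurable leb01"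
    using assms by (intro borel_measurable_add L2_measurable)
  have i: "integrable leb01 (\<lambda>y. (cmod (u y + v y))\<^sup>2)"
    by (rule Bochner_Integration.integrable_bound[OF iw])
      (use m le in \<open>auto intro!: AE_I2 order_trans[OF le]\<close>)
  then show "(\<lambda>y. u y + v y) \<in> L2" using m by (simp add: L2_def)
  have "(L2_norm (\<lambda>y. u y + v y))\<^sup>2 \<le> int01 w"
    unfolding L2_norm_sq by (intro integral_mono i iw le)
  also have "\<dots> = (L2_norm u)\<^sup>2 + 2 * int01 (\<lambda>y. cmod (u y) * cmod (v y)) + (L2_norm v)\<^sup>2"
    unfolding w_def L2_norm_sq
    using iB L2_sq_integrable[OF assms(1)] L2_sq_integrable[OF assms(2)] by simp
  also have "\<dots> \<le> (L2_norm u + L2_norm v)\<^sup>2"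
    using L2_Cauchy_Schwarz_abs[OF assms] by (simp add: power2_eq_square algebra_simps)
  finally show "L2_norm (\<lambda>y. u y + v y) \<le> L2_norm u + L2_norm v"
    by (rule power2_le_imp_le) simp
qed

lemma L2_diff:
  assumes "u \<in> L2" "v \<in> L2"
  shows "(\<lambda>y. u y - v y) \<in> L2" "L2_norm (\<lambda>y. u y - v y) \<le> L2_norm u + L2_norm v"
  using L2_add[OF assms(1) L2_cmult(1)[OF assms(2), of "-1"]] L2_cmult(2)[OF assms(2), of "-1"]
  by auto

subsection \<open>Fourier series\<close>

definition efun :: "int \<Rightarrow> real \<Rightarrow> complex" where
  "efun n y = cis (2 * pi * of_int n * y)"

lemma continuous_cis_mult [continuous_intros]:
  "continuous_on S f \<Longrightarrow> continuous_on S (\<lambda>y. cis (f y))"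
  by (simp add: cis_conv_exp) (intro continuous_intros)

lemma continuous_efun: "continuous_on S (efun n)"
  unfolding efun_def by (intro continuous_intros)

lemma norm_efun [simp]: "cmod (efun n y) = 1"
  by (simp add: efun_def)

lemma efun_0 [simp]: "efun 0 y = 1"
  by (simp add: efun_def)

lemma efun_add: "efun (m + n) y = efun m y * efun n y"
  by (simp add: efun_def cis_mult algebra_simps)

lemma cnj_efun: "cnj (efun n y) = efun (- n) y"
  by (simp add: efun_def cis_cnj)

lemma efun_at_0 [simp]: "efun n 0 = 1"
  by (simp add: efun_def)

lemma efun_at_1 [simp]: "efun n 1 = 1"
proof -
  have "cis (2 * pi * of_int n) = cis (2 * pi) powi n"
    by (simp add: cis_power_int mult.commute)
  then show ?thesis by (simp add: efun_def)
qed

lemma fourier_coeff_efun: "fourier_coeff u n = int01 (\<lambda>y. u y * efun (- n) y)"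
  by (simp add: fourier_coeff_def efun_def)

lemma integrable_mult_efun:
  "integrable leb01 u \<Longrightarrow> integrable leb01 (\<lambda>y. u y * efun n y)"
  by (rule integrable_mult_continuous(1)[OF _ continuous_efun])

lemma cis_linear_vector_derivative:
  "((\<lambda>y. cis (a * y)) has_vector_derivative (\<i> * of_real a * cis (a * y))) (at y within S)"
proof -
  have "((\<lambda>y. exp (\<i> * of_real a * of_real y)) has_vector_derivative (\<i> * of_real a * exp (\<i> * of_real a * of_real y)))
      (at y within S)"
    by (rule has_vector_derivative_real_field) (auto intro!: derivative_eq_intros)
  then show ?thesis by (simp add: cis_conv_exp mult_ac)
qed

lemma ac_cis: "ac (\<lambda>y. cis (a * y)) (\<lambda>y. \<i> * of_real a * cis (a * y))"
  by (rule ac_C1) (intro cis_linear_vector_derivative continuous_intros)+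

lemma ac_efun: "ac (efun n) (\<lambda>y. 2 * pi * \<i> * of_int n * efun n y)"
  using ac_cis[of "2 * pi * of_int n"] by (simp add: efun_def[abs_def] mult_ac)

lemma integral_efun: "int01 (efun n) = (if n = 0 then 1 else 0)"
proof (cases "n = 0")
  case True
  then show ?thesis by (simp add: efun_def[abs_def] measure_restrict_space)
next
  case False
  then show ?thesis
    using ac_integral[OF ac_efun[of n]] by simp
qed

lemma fourier_coeff_deriv:
  assumes v: "ac v v'" and per: "v 0 = v 1"
  shows "fourier_coeff v' n = 2 * pi * \<i> * of_int n * fourier_coeff v n"
proof -
  have i1: "integrable leb01 (\<lambda>y. v' y * efun (-n) y)"
    by (rule integrable_mult_efun[OF ac_integrable[OF v]])
  have i2: "integrable leb01 (\<lambda>y. v y * efun (-n) y)"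
    by (rule integrable_mult_efun[OF integrable_continuous_leb01[OF ac_continuous[OF v]]])
  have "int01 (\<lambda>y. v' y * efun (-n) y + v y * (2 * pi * \<i> * of_int (-n) * efun (-n) y)) = 0"
    using ac_integral[OF ac_mult[OF v ac_efun[of "-n"]]] per by simp
  also have "(\<lambda>y. v' y * efun (-n) y + v y * (2 * pi * \<i> * of_int (-n) * efun (-n) y)) =
    (\<lambda>y. v' y * efun (-n) y - (2 * pi * \<i> * of_int n) * (v y * efun (-n) y))"
    by (auto simp: algebra_simps)
  finally show ?thesis using i1 i2 by (simp add: fourier_coeff_efun)
qed

lemma fourier_coeff_diff:
  assumes "integrable leb01 u" "integrable leb01 v"
  shows "fourier_coeff (\<lambda>y. u y - v y) n = fourier_coeff u n - fourier_coeff v n"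
  using integrable_mult_efun[OF assms(1), of "-n"] integrable_mult_efun[OF assms(2), of "-n"]
  by (simp add: fourier_coeff_efun left_diff_distrib)

lemma fourier_coeff_const: "fourier_coeff (\<lambda>_. c) n = (if n = 0 then c else 0)"
  by (simp add: fourier_coeff_efun integral_efun)

text \<open>Quantifying over all \<open>D\<close> with vanishing coefficients lets the induction handle products of
  polynomials without expanding them.\<close>

lemma fourier_uniqueness_polynomial:
  fixes p :: "complex \<Rightarrow> real"
  assumes "real_polynomial_function p" "integrable leb01 D" "\<And>n. fourier_coeff D n = 0"
  shows "fourier_coeff (\<lambda>y. of_real (p (efun 1 y)) * D y) n = 0"
  using assms
proof (induction arbitrary: D n rule: real_polynomial_function.induct)
  case (linear f)
  note lin = linear
  interpret bounded_linear f by fact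
  define \<alpha> where "\<alpha> = (of_real (f 1) - \<i> * of_real (f \<i>)) / 2"
  have f: "of_real (f z) = \<alpha> * z + cnj \<alpha> * cnj z" for z
  proof -
    have "z = Re z *\<^sub>R 1 + Im z *\<^sub>R \<i>" by (simp add: complex_eq_iff)
    then have "f z = Re z * f 1 + Im z * f \<i>" by (metis add scaleR real_scaleR_def)
    then show ?thesis by (simp add: \<alpha>_def complex_eq_iff field_simps)
  qed
  have i: "integrable leb01 (\<lambda>y. D y * efun m y)" for m by (rule integrable_mult_efun[OF lin(2)])
  have z: "int01 (\<lambda>y. D y * efun m y) = 0" for m
    using lin(3)[of "-m"] by (simp add: fourier_coeff_efun)
  have "(\<lambda>y. of_real (f (efun 1 y)) * D y * efun (- n) y) =
      (\<lambda>y. \<alpha> * (D y * efun (1 - n) y) + cnj \<alpha> * (D y * efun (-1 - n) y))"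
    using efun_add[of 1 "-n"] efun_add[of "-1" "-n"] by (auto simp: f cnj_efun algebra_simps)
  then show ?case using i z by (simp add: fourier_coeff_efun)
next
  case (const c)
  have "(\<lambda>y. of_real c * D y * efun (- n) y) = (\<lambda>y. of_real c * (D y * efun (- n) y))"
    by (auto simp: mult_ac)
  then show ?case using const(2)[of n] by (simp add: fourier_coeff_efun)
next
  case (add f g)
  have c: "continuous_on {0..1} (\<lambda>y. of_real (h (efun 1 y)) :: complex)"
    if "real_polynomial_function h" for h :: "complex \<Rightarrow> real"
    using continuous_on_compose2[of UNIV h "{0..1}" "efun 1", OF _ continuous_efun] that
    by (intro continuous_on_of_real) (auto simp: continuous_on_eq_continuous_at continuous_real_polymonial_function)
  have i: "integrable leb01 (\<lambda>y. of_real (h (efun 1 y)) * D y * efun (- n) y)"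
    if "real_polynomial_function h" for h :: "complex \<Rightarrow> real"
    by (intro integrable_mult_efun integrable_mult_continuous(2)[OF add(5) c[OF that]])
  have "fourier_coeff (\<lambda>y. of_real (f (efun 1 y) + g (efun 1 y)) * D y) n =
    fourier_coeff (\<lambda>y. of_real (f (efun 1 y)) * D y) n + fourier_coeff (\<lambda>y. of_real (g (efun 1 y)) * D y) n"
    using i[OF add(1)] i[OF add(2)] by (simp add: fourier_coeff_efun distrib_right)
  then show ?case using add.IH add.prems by simp
next
  case (mult f g)
  have c: "continuous_on {0..1} (\<lambda>y. of_real (g (efun 1 y)) :: complex)"
    using continuous_on_compose2[of UNIV g "{0..1}" "efun 1", OF _ continuous_efun] mult(2)
    by (intro continuous_on_of_real) (auto simp: continuous_on_eq_continuous_at continuous_real_polymonial_function)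
  have i: "integrable leb01 (\<lambda>y. of_real (g (efun 1 y)) * D y)"
    by (rule integrable_mult_continuous(2)[OF mult(5) c])
  have "fourier_coeff (\<lambda>y. of_real (f (efun 1 y)) * (of_real (g (efun 1 y)) * D y)) n = 0"
    by (rule mult.IH(1)[OF i mult.IH(2)[OF mult.prems]])
  then show ?case by (simp add: mult.assoc)
qed

text \<open>Stone-Weierstrass on the unit circle: real polynomials in the two coordinates of
  \<open>efun 1 y\<close> approximate h uniformly, and D integrates to 0 against each of
  them.\<close>

lemma integral_circle_function_zero:
  fixes h :: "complex \<Rightarrow> real"
  assumes D: "integrable leb01 D" and z: "\<And>n. fourier_coeff D n = 0"
    and h: "continuous_on UNIV h"
  shows "int01 (\<lambda>y. h (efun 1 y) *\<^sub>R D y) = 0"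
proof (rule ccontr)
  assume ne: "int01 (\<lambda>y. h (efun 1 y) *\<^sub>R D y) \<noteq> 0"
  define N where "N = int01 (\<lambda>y. cmod (D y))"
  define r where "r = cmod (int01 (\<lambda>y. h (efun 1 y) *\<^sub>R D y))"
  have N: "0 \<le> N" unfolding N_def by (rule Bochner_Integration.integral_nonneg) simp
  have r: "0 < r" using ne by (simp add: r_def)
  have S: "compact (sphere (0::complex) 1)" by simp
  \<comment> \<open>Dividing by N + 1 instead of N admits N = 0 and makes the final comparison r N /
    (N + 1) < r strict.\<close>
  have e: "0 < r / (N + 1)" using N r by simp
  obtain p where p: "real_polynomial_function p" "\<And>x. x \<in> sphere 0 1 \<Longrightarrow> \<bar>h x - p x\<bar> < r / (N + 1)"
    using Stone_Weierstrass_real_polynomial_function[OF S continuous_on_subset[OF h subset_UNIV] e] by blast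
  have cp: "continuous_on UNIV p"
    using p(1) by (auto simp: continuous_on_eq_continuous_at continuous_real_polymonial_function)
  have ih: "integrable leb01 (\<lambda>y. h (efun 1 y) *\<^sub>R D y)"
    by (intro integrable_scaleR_continuous[OF D] continuous_on_compose2[OF h continuous_efun]) auto
  have ip: "integrable leb01 (\<lambda>y. p (efun 1 y) *\<^sub>R D y)"
    by (intro integrable_scaleR_continuous[OF D] continuous_on_compose2[OF cp continuous_efun]) auto
  have p0: "int01 (\<lambda>y. p (efun 1 y) *\<^sub>R D y) = 0"
    using fourier_uniqueness_polynomial[OF p(1) D z, of 0]
    by (simp add: fourier_coeff_efun scaleR_conv_of_real)
  have "r = cmod (int01 (\<lambda>y. (h (efun 1 y) - p (efun 1 y)) *\<^sub>R D y))"
    using ih ip p0 by (simp add: scaleR_left_diff_distrib r_def)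
  also have "\<dots> \<le> r / (N + 1) * N"
  proof (rule integral_scaleR_bound[OF D, folded N_def])
    show "integrable leb01 (\<lambda>y. (h (efun 1 y) - p (efun 1 y)) *\<^sub>R D y)"
      using ih ip by (simp add: scaleR_left_diff_distrib)
    show "\<bar>h (efun 1 y) - p (efun 1 y)\<bar> \<le> r / (N + 1)" for y
      using p(2)[of "efun 1 y"] by simp
  qed
  also have "\<dots> < r" using r N by (simp add: field_simps)
  finally show False by simp
qed

text \<open>Equal exponentials force x - y to be an integer, here of modulus below 1. The point y
  has to be interior, since 0 and 1 are the same point of the circle.\<close>

lemma efun_1_eq_iff:
  assumes "x \<in> {0..1}" "y \<in> {0<..<1}"
  shows "efun 1 x = efun 1 y \<longleftrightarrow> x = y"
proof
  assume "efun 1 x = efun 1 y"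
  then have "exp (\<i> * of_real (2 * pi * x)) = exp (\<i> * of_real (2 * pi * y))"
    by (simp add: efun_def cis_conv_exp)
  then obtain n :: int where "\<i> * of_real (2 * pi * x) = \<i> * of_real (2 * pi * y) + of_int (2 * n) * of_real pi * \<i>"
    by (auto simp: exp_eq)
  then have "2 * pi * x = 2 * pi * y + 2 * of_int n * pi"
    by (simp add: complex_eq_iff)
  then have "2 * pi * (x - y - of_int n) = 0" by (simp add: algebra_simps)
  then have n: "x - y = of_int n" by simp
  then have "-1 < real_of_int n" "real_of_int n < 1" using assms by auto
  then have "n = 0" by linarith
  then show "x = y" using n by simp
qed simp

text \<open>The arc between p and q is where the distance to the complementary closed arc C is
  positive, so its indicator is a limit of continuous functions of \<open>efun 1 y\<close>. The
  argument takes place in L^1, because weak derivatives are only required to be integrable.\<close>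

theorem fourier_uniqueness:
  assumes D: "integrable leb01 D" and z: "\<And>n. fourier_coeff D n = 0"
  shows "AE y in leb01. D y = 0"
proof (rule AE_zero_if_interval_integrals_zero[OF D])
  fix p q :: real assume pq: "0 < p" "p < q" "q < 1"
  define C where "C = efun 1 ` ({0..p} \<union> {q..1})"
  have "compact C" unfolding C_def
    by (intro compact_continuous_image continuous_efun compact_Un) auto
  then have C: "closed C" "C \<noteq> {}" using pq by (auto simp: compact_imp_closed C_def)
  have Ci: "efun 1 y \<in> C \<longleftrightarrow> y \<notin> {p<..<q}" if y: "y \<in> {0..1}" for y
  proof
    assume "efun 1 y \<in> C"
    then obtain x where x: "x \<in> {0..p} \<union> {q..1}" "efun 1 y = efun 1 x"
      unfolding C_def by blast
    show "y \<notin> {p<..<q}"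
    proof
      assume "y \<in> {p<..<q}"
      then have "x = y" using efun_1_eq_iff[of x y] x pq by auto
      then show False using x \<open>y \<in> {p<..<q}\<close> by auto
    qed
  qed (use y in \<open>auto simp: C_def\<close>)
  show "int01 (\<lambda>y. indicator {p<..<q} y *\<^sub>R D y) = 0"
  proof (rule interval_integral_zero_if_approx[OF D, where h="\<lambda>y. infdist (efun 1 y) C"])
    show "continuous_on {0..1} (\<lambda>y. infdist (efun 1 y) C)"
      by (intro continuous_intros continuous_efun)
    show "infdist (efun 1 y) C = 0 \<longleftrightarrow> y \<notin> {p<..<q}" if "y \<in> {0..1}" for y
      using Ci[OF that] in_closed_iff_infdist_zero[OF C] by simp
    show "int01 (\<lambda>y. min 1 (real j * infdist (efun 1 y) C) *\<^sub>R D y) = 0" for j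
      by (rule integral_circle_function_zero[OF D z, of "\<lambda>x. min 1 (real j * infdist x C)"])
        (intro continuous_intros)
  qed (simp add: infdist_nonneg)
qed

text \<open>Cosines and sines are periodic tests, so f' has the Fourier coefficients expected of the
  derivative of f. The zeroth one vanishes, which makes the primitive of f' periodic. This primitive
  and f then share all coefficients except the mean, and uniqueness makes their difference
  constant.\<close>

lemma torus_weak_deriv_imp_ac:
  fixes f f' :: "real \<Rightarrow> real"
  assumes w: "has_weak_deriv torus_tests f f'"
  obtains c where "AE y in leb01. of_real (f y) = c + prim (\<lambda>y. of_real (f' y)) y"
proof -
  define F F' where "F = (\<lambda>y. complex_of_real (f y))" and "F' = (\<lambda>y. complex_of_real (f' y))"
  have i: "integrable leb01 f" "integrable leb01 f'" using w by (auto simp: has_weak_deriv_def)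
  then have iF: "integrable leb01 F" "integrable leb01 F'" by (auto simp: F_def F'_def)
  have C1: "(\<lambda>y. cos (2 * pi * of_int n * y)) C1_differentiable_on UNIV"
    "(\<lambda>y. sin (2 * pi * of_int n * y)) C1_differentiable_on UNIV" for n :: int
    unfolding C1_differentiable_on_def has_real_derivative_iff_has_vector_derivative[symmetric]
    by (rule exI[of _ "\<lambda>y. - sin (2 * pi * of_int n * y) * (2 * pi * of_int n)"]
             exI[of _ "\<lambda>y. cos (2 * pi * of_int n * y) * (2 * pi * of_int n)"],
        auto intro!: derivative_eq_intros continuous_intros)+
  have d: "deriv (\<lambda>y. cos (2 * pi * of_int n * y)) = (\<lambda>y. - sin (2 * pi * of_int n * y) * (2 * pi * of_int n))"
    "deriv (\<lambda>y. sin (2 * pi * of_int n * y)) = (\<lambda>y. cos (2 * pi * of_int n * y) * (2 * pi * of_int n))" for n :: int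
    by (intro ext DERIV_imp_deriv; auto intro!: derivative_eq_intros)+
  have per: "cos (2 * pi * of_int n * (y + 1)) = cos (2 * pi * of_int n * y)"
    "sin (2 * pi * of_int n * (y + 1)) = sin (2 * pi * of_int n * y)" for n :: int and y
    using efun_at_1[of n] unfolding efun_def
    by (auto simp: complex_eq_iff distrib_left cos_add sin_add)
  have tests: "(\<lambda>y. cos (2 * pi * of_int n * y)) \<in> torus_tests" "(\<lambda>y. sin (2 * pi * of_int n * y)) \<in> torus_tests" for n :: int
    using C1 per by (auto simp: torus_tests_def)
  have coef: "fourier_coeff F' n = 2 * pi * \<i> * of_int n * fourier_coeff F n" for n
  proof -
    define c s where "c = (\<lambda>y::real. cos (2 * pi * of_int n * y))" and "s = (\<lambda>y::real. sin (2 * pi * of_int n * y))"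
    have cs: "continuous_on {0..1} c" "continuous_on {0..1} s"
      unfolding c_def s_def by (intro continuous_intros)+
    have e: "efun (-n) y = of_real (c y) - \<i> * of_real (s y)" for y
      by (simp add: efun_def c_def s_def complex_eq_iff)
    have ii: "integrable leb01 (\<lambda>y. v y * u y)" if "integrable leb01 u" "continuous_on {0..1} v" for u v :: "real \<Rightarrow> real"
    proof -
      have "integrable leb01 (\<lambda>y. Re (v y *\<^sub>R complex_of_real (u y)))"
        using that by (intro integrable_Re integrable_scaleR_continuous) auto
      then show ?thesis by simp
    qed
    have fc: "fourier_coeff (\<lambda>y. of_real (u y)) n =
       of_real (int01 (\<lambda>y. c y * u y)) - \<i> * of_real (int01 (\<lambda>y. s y * u y))"
      if u: "integrable leb01 u" for u :: "real \<Rightarrow> real"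
    proof -
      have "fourier_coeff (\<lambda>y. of_real (u y)) n =
        int01 (\<lambda>y. complex_of_real (c y * u y) - \<i> * complex_of_real (s y * u y))"
        unfolding fourier_coeff_efun e by (intro Bochner_Integration.integral_cong) (auto simp: algebra_simps)
      also have "\<dots> = int01 (\<lambda>y. complex_of_real (c y * u y)) - int01 (\<lambda>y. \<i> * complex_of_real (s y * u y))"
        by (rule Bochner_Integration.integral_diff)
          (use ii[OF u cs(1)] ii[OF u cs(2)] in \<open>auto simp del: of_real_mult\<close>)
      also have "\<dots> = of_real (int01 (\<lambda>y. c y * u y)) - \<i> * of_real (int01 (\<lambda>y. s y * u y))"
        by (simp only: integral_mult_right_zero integral_complex_of_real)
      finally show ?thesis .
    qed
    have t: "int01 (\<lambda>y. deriv \<phi> y * f y) = - int01 (\<lambda>y. \<phi> y * f' y)" if "\<phi> \<in> torus_tests" for \<phi>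
      using w that by (simp add: has_weak_deriv_def)
    have "int01 (\<lambda>y. (- (2 * pi * of_int n)) * (s y * f y)) = - int01 (\<lambda>y. c y * f' y)"
      using t[OF tests(1)[of n]] unfolding d by (simp add: c_def s_def mult_ac)
    then have "(- (2 * pi * of_int n)) * int01 (\<lambda>y. s y * f y) = - int01 (\<lambda>y. c y * f' y)"
      by (simp only: integral_mult_right_zero)
    then have A: "int01 (\<lambda>y. c y * f' y) = 2 * pi * of_int n * int01 (\<lambda>y. s y * f y)"
      by (metis minus_mult_left neg_equal_iff_equal)
    have "int01 (\<lambda>y. (2 * pi * of_int n) * (c y * f y)) = - int01 (\<lambda>y. s y * f' y)"
      using t[OF tests(2)[of n]] unfolding d by (simp add: c_def s_def mult_ac)
    then have B: "int01 (\<lambda>y. s y * f' y) = - (2 * pi * of_int n * int01 (\<lambda>y. c y * f y))"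
      by (simp only: integral_mult_right_zero)
    show ?thesis
      unfolding F_def F'_def fc[OF i(1)] fc[OF i(2)] A B by (simp add: algebra_simps)
  qed
  define P where "P = prim F'"
  have acP: "ac P F'" using ac_prim[OF iF(2), of 0] by (simp add: P_def)
  have iP: "integrable leb01 P" by (rule integrable_continuous_leb01[OF ac_continuous[OF acP]])
  have "P 0 = P 1"
    using coef[of 0] by (simp add: P_def prim_1 fourier_coeff_efun)
  note cP = fourier_coeff_deriv[OF acP this]
  define c where "c = fourier_coeff F 0 - fourier_coeff P 0"
  have "AE y in leb01. F y - P y - c = 0"
  proof (rule fourier_uniqueness)
    show "integrable leb01 (\<lambda>y. F y - P y - c)" using iF iP by simp
    show "fourier_coeff (\<lambda>y. F y - P y - c) n = 0" for n
    proof (cases "n = 0")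
      case True
      then show ?thesis using iF iP
        by (simp add: fourier_coeff_diff fourier_coeff_const c_def)
    next
      case False
      then have "fourier_coeff F n = fourier_coeff P n"
        using coef[of n] cP[of n] by simp
      then show ?thesis using iF iP False
        by (simp add: fourier_coeff_diff fourier_coeff_const)
    qed
  qed
  then have "AE y in leb01. of_real (f y) = c + prim (\<lambda>y. of_real (f' y)) y"
    by eventually_elim (simp add: F_def F'_def P_def algebra_simps)
  then show ?thesis by (rule that)
qed

section \<open>Bessel's inequality and absolutely convergent Fourier series\<close>

lemma bessel:
  assumes u: "u \<in> L2" and F: "finite F"
  shows "(\<Sum>n\<in>F. (cmod (fourier_coeff u n))\<^sup>2) \<le> (L2_norm u)\<^sup>2"
proof -
  define c where "c = fourier_coeff u"
  define S where "S = (\<Sum>n\<in>F. (cmod (c n))\<^sup>2)"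
  have SS: "(\<Sum>n\<in>F. cnj (c n) * c n) = of_real S"
    unfolding S_def of_real_sum by (intro sum.cong refl) (metis complex_norm_square mult.commute)
  \<comment> \<open>T is the conjugate of a partial Fourier sum, since the pairing is bilinear. Both
    the pairing of u with T and the squared norm of T equal S, so Cauchy-Schwarz bounds S by the
    norm of u times sqrt S.\<close>
  define T where "T = (\<lambda>y. \<Sum>n\<in>F. cnj (c n) * efun (-n) y)"
  have Tc: "continuous_on {0..1} T"
    unfolding T_def by (intro continuous_intros continuous_efun)
  have T: "T \<in> L2" by (rule L2_continuous[OF Tc])
  have "int01 (\<lambda>y. u y * T y) = int01 (\<lambda>y. \<Sum>n\<in>F. cnj (c n) * (u y * efun (-n) y))"
    by (simp add: T_def sum_distrib_left mult_ac)
  also have "\<dots> = (\<Sum>n\<in>F. cnj (c n) * c n)"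
    using integrable_mult_efun[OF L2_integrable[OF u]] by (simp add: c_def fourier_coeff_efun)
  also have "\<dots> = of_real S"
    by (rule SS)
  finally have A: "int01 (\<lambda>y. u y * T y) = of_real S" .
  have i: "integrable leb01 (efun m)" for m
    by (rule integrable_continuous_leb01[OF continuous_efun])
  have "complex_of_real ((L2_norm T)\<^sup>2) = int01 (\<lambda>y. T y * cnj (T y))"
    unfolding L2_norm_sq integral_complex_of_real[symmetric] by (simp only: complex_norm_square)
  also have "\<dots> = int01 (\<lambda>y. \<Sum>n\<in>F. \<Sum>m\<in>F. cnj (c n) * c m * efun (m - n) y)"
  proof -
    have "efun (m - n) y = efun (-n) y * efun m y" for m n y
      using efun_add[of "-n" m y] by (simp add: add.commute)
    then show ?thesis
      unfolding T_def cnj_sum sum_product by (simp add: cnj_efun mult_ac)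
  qed
  also have "\<dots> = (\<Sum>n\<in>F. \<Sum>m\<in>F. cnj (c n) * c m * (if m - n = 0 then 1 else 0))"
    using i by (simp add: integral_efun)
  also have "\<dots> = (\<Sum>n\<in>F. cnj (c n) * c n)"
    using F by (intro sum.cong refl) (simp add: if_distrib sum.delta cong: if_cong)
  also have "\<dots> = of_real S"
    by (rule SS)
  finally have B: "(L2_norm T)\<^sup>2 = S" using of_real_eq_iff by blast
  have S0: "0 \<le> S" unfolding S_def by (rule sum_nonneg) simp
  have "S \<le> L2_norm u * L2_norm T"
    using L2_Cauchy_Schwarz[OF u T] S0 by (simp add: A)
  moreover have "L2_norm T = sqrt S" using B by (metis L2_norm_nonneg real_sqrt_unique)
  ultimately have "sqrt S * sqrt S \<le> L2_norm u * sqrt S" using S0 by simp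
  then have "sqrt S \<le> L2_norm u"
  proof (cases "S = 0")
    case False
    then have "0 < sqrt S" using S0 by simp
    then show ?thesis by (rule mult_right_le_imp_le[OF \<open>sqrt S * sqrt S \<le> L2_norm u * sqrt S\<close>])
  qed simp
  then have "(sqrt S)\<^sup>2 \<le> (L2_norm u)\<^sup>2" using S0 by (intro power_mono) auto
  then show ?thesis using S0 by (simp add: S_def c_def)
qed

text \<open>n -> |n| is injective on the nonnegative and on the negative integers. Each half
  contributes at most one full series, hence the factor 2.\<close>

lemma sum_int_le_suminf:
  fixes f :: "nat \<Rightarrow> real" and F :: "int set"
  assumes f: "summable f" "\<And>m. 0 \<le> f m" and F: "finite F"
  shows "(\<Sum>n\<in>F. f (nat \<bar>n\<bar>)) \<le> 2 * suminf f"
proof -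
  have half: "(\<Sum>n\<in>G. f (nat \<bar>n\<bar>)) \<le> suminf f" if G: "finite G" "inj_on (\<lambda>n. nat \<bar>n\<bar>) G" for G :: "int set"
  proof -
    have "(\<Sum>n\<in>G. f (nat \<bar>n\<bar>)) = sum f ((\<lambda>n. nat \<bar>n\<bar>) ` G)"
      using sum.reindex[OF G(2), of f] by (simp add: comp_def)
    also have "\<dots> \<le> suminf f"
      by (rule sum_le_suminf[OF f(1)]) (use G f(2) in auto)
    finally show ?thesis .
  qed
  define P where "P = {n\<in>F. 0 \<le> n}"
  define N where "N = {n\<in>F. n < 0}"
  have "(\<Sum>n\<in>F. f (nat \<bar>n\<bar>)) = (\<Sum>n\<in>P. f (nat \<bar>n\<bar>)) + (\<Sum>n\<in>N. f (nat \<bar>n\<bar>))"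
  proof -
    have "F = P \<union> N" "P \<inter> N = {}" "finite P" "finite N" using F by (auto simp: P_def N_def)
    then show ?thesis using sum.union_disjoint[of P N "\<lambda>n. f (nat \<bar>n\<bar>)"] by simp
  qed
  also have "\<dots> \<le> suminf f + suminf f"
    by (intro add_mono half) (use F in \<open>auto simp: P_def N_def inj_on_def\<close>)
  finally show ?thesis by simp
qed

text \<open>For n different from 0, |v_n| <= |v'_n| / |n| <= 1/n^2 + |v'_n|^2 by the
  arithmetic-geometric mean inequality, and the last terms are summable by Bessel. The integers are
  enumerated by \<open>int_decode\<close> so that results on series over the natural numbers
  apply.\<close>

lemma summable_fourier_coeff:
  assumes v: "ac v v'" "v' \<in> L2" "v 0 = v 1"
  shows "summable (\<lambda>j. cmod (fourier_coeff v (int_decode j)))"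
proof -
  \<comment> \<open>q 0 = 0, as division by 0 yields 0; the zeroth coefficient is counted
    separately.\<close>
  define q where "q = (\<lambda>m. 1 / (real m)\<^sup>2)"
  have q: "summable q" "\<And>m. 0 \<le> q m"
    using inverse_power_summable[of 2, where 'a=real] by (auto simp: q_def field_simps power2_eq_square)
  define M where "M = cmod (fourier_coeff v 0) + 2 * suminf q + (L2_norm v')\<^sup>2"
  have le: "cmod (fourier_coeff v n) \<le> (if n = 0 then cmod (fourier_coeff v 0) else 0) + q (nat \<bar>n\<bar>) + (cmod (fourier_coeff v' n))\<^sup>2" for n
  proof (cases "n = 0")
    case True
    then show ?thesis using q(2)[of 0] by (simp add: q_def)
  next
    case False
    have eq: "cmod (fourier_coeff v' n) = 2 * pi * \<bar>of_int n\<bar> * cmod (fourier_coeff v n)"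
      using fourier_coeff_deriv[OF v(1,3), of n] by (simp add: norm_mult)
    define a where "a = cmod (fourier_coeff v' n)"
    define r where "r = \<bar>real_of_int n\<bar>"
    have r: "r \<ge> 1" using False by (simp add: r_def)
    have a: "0 \<le> a" by (simp add: a_def)
    have "1 \<le> 2 * pi" using pi_gt3 by simp
    then have "1 * r \<le> 2 * pi * r" using r by (intro mult_right_mono) auto
    then have "cmod (fourier_coeff v n) * r \<le> a"
      unfolding a_def eq r_def[symmetric]
      using mult_right_mono[of r "2 * pi * r" "cmod (fourier_coeff v n)"] by (simp add: mult_ac)
    then have "cmod (fourier_coeff v n) \<le> a * (1 / r)" using r by (simp add: field_simps)
    also have "\<dots> \<le> (1 / r)\<^sup>2 + a\<^sup>2"
    proof -
      have "2 * (a * (1/r)) \<le> a\<^sup>2 + (1/r)\<^sup>2"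
        using sum_squares_bound[of a "1/r"] by simp
      moreover have "0 \<le> a * (1/r)" using a r by simp
      ultimately show ?thesis by linarith
    qed
    also have "(1 / r)\<^sup>2 = q (nat \<bar>n\<bar>)" by (simp add: q_def r_def power_one_over)
    finally show ?thesis using False by (simp add: a_def)
  qed
  show ?thesis
  proof (rule summableI_nonneg_bounded)
    fix N
    define F where "F = int_decode ` {..<N}"
    have F: "finite F" by (simp add: F_def)
    have "(\<Sum>j<N. cmod (fourier_coeff v (int_decode j))) = (\<Sum>n\<in>F. cmod (fourier_coeff v n))"
      unfolding F_def by (subst sum.reindex) (auto simp: inj_int_decode)
    also have "\<dots> \<le> (\<Sum>n\<in>F. (if n = 0 then cmod (fourier_coeff v 0) else 0) + q (nat \<bar>n\<bar>) + (cmod (fourier_coeff v' n))\<^sup>2)"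
      by (intro sum_mono le)
    also have "\<dots> = (\<Sum>n\<in>F. (if n = 0 then cmod (fourier_coeff v 0) else 0)) + (\<Sum>n\<in>F. q (nat \<bar>n\<bar>)) + (\<Sum>n\<in>F. (cmod (fourier_coeff v' n))\<^sup>2)"
      by (simp add: sum.distrib)
    also have "\<dots> \<le> M"
      unfolding M_def
      by (intro add_mono sum_int_le_suminf[OF q F] bessel[OF v(2) F]) (simp add: sum.delta[OF F])
    finally show "(\<Sum>j<N. cmod (fourier_coeff v (int_decode j))) \<le> M" .
  qed simp
qed

text \<open>Parseval's identity in the case where v is regular enough to have an absolutely
  convergent Fourier series S. Term-by-term integration gives the pairing with S, and S = v almost
  everywhere because their coefficients agree.\<close>

lemma fourier_pairing:
  assumes u: "u \<in> L2" and v: "ac v v'" "v' \<in> L2" "v 0 = v 1"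
  shows "(\<lambda>j. fourier_coeff u (- int_decode j) * fourier_coeff v (int_decode j)) sums
    int01 (\<lambda>y. u y * v y)"
proof -
  define c where "c = (\<lambda>j. fourier_coeff v (int_decode j))"
  have c: "summable (\<lambda>j. cmod (c j))" using summable_fourier_coeff[OF v] by (simp add: c_def)
  define S where "S = (\<lambda>y. \<Sum>j. c j * efun (int_decode j) y)"
  \<comment> \<open>Stated for arbitrary w because it serves three purposes: w = 1 gives
    integrability of S, w = \<open>efun (-n)\<close> its coefficients, and w = u the claim.\<close>
  have sm: "integrable leb01 (\<lambda>y. w y * S y)"
     "(\<lambda>j. c j * fourier_coeff w (- int_decode j)) sums int01 (\<lambda>y. w y * S y)"
    if w: "integrable leb01 w" for w
  proof -
    define t where "t = (\<lambda>j y. c j * (w y * efun (int_decode j) y))"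
    have t: "integrable leb01 (t j)" for j
      unfolding t_def using integrable_mult_efun[OF w] by simp
    have 1: "AE y in leb01. summable (\<lambda>j. norm (t j y))"
      using c by (intro AE_I2) (simp add: t_def norm_mult mult.commute[of _ "cmod (w _)"] summable_mult)
    have 2: "summable (\<lambda>j. int01 (\<lambda>y. norm (t j y)))"
      using summable_mult2[OF c, of "int01 (\<lambda>y. cmod (w y))"] by (simp add: t_def norm_mult)
    have eq: "(\<lambda>y. \<Sum>j. t j y) = (\<lambda>y. w y * S y)"
    proof
      fix y
      have "summable (\<lambda>j. c j * efun (int_decode j) y)"
        by (rule summable_norm_cancel) (use c in \<open>simp add: norm_mult\<close>)
      then show "(\<Sum>j. t j y) = w y * S y"
        by (simp add: t_def S_def suminf_mult[symmetric] mult_ac)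
    qed
    show "integrable leb01 (\<lambda>y. w y * S y)"
      using integrable_suminf[OF t 1 2] by (simp add: eq)
    have "int01 (t j) = c j * fourier_coeff w (- int_decode j)" for j
      by (simp add: t_def fourier_coeff_efun)
    then show "(\<lambda>j. c j * fourier_coeff w (- int_decode j)) sums int01 (\<lambda>y. w y * S y)"
      using sums_integral[OF t 1 2] by (simp add: eq)
  qed
  have iS: "integrable leb01 S" using sm(1)[of "\<lambda>_. 1"] by simp
  have iv: "integrable leb01 v" by (rule integrable_continuous_leb01[OF ac_continuous[OF v(1)]])
  have "AE y in leb01. v y - S y = 0"
  proof (rule fourier_uniqueness)
    show "integrable leb01 (\<lambda>y. v y - S y)" using iv iS by simp
    fix n
    have fe: "fourier_coeff (efun (-n)) (- m) = (if m = n then 1 else 0)" for m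
    proof -
      have "(\<lambda>y. efun (-n) y * efun (- (- m)) y) = efun (m - n)"
        using efun_add[of "-n" m] by (auto simp: fun_eq_iff)
      then show ?thesis by (simp add: fourier_coeff_efun integral_efun)
    qed
    have "(\<lambda>j. c j * fourier_coeff (efun (-n)) (- int_decode j)) sums fourier_coeff S n"
      using sm(2)[of "efun (-n)"] integrable_continuous_leb01[OF continuous_efun]
      by (simp add: fourier_coeff_efun[of S] mult.commute)
    moreover have "(\<lambda>j. c j * fourier_coeff (efun (-n)) (- int_decode j)) sums fourier_coeff v n"
    proof -
      have "(\<lambda>j. if j = int_encode n then fourier_coeff v n else 0) sums fourier_coeff v n"
        by (rule sums_single)
      also have "(\<lambda>j. if j = int_encode n then fourier_coeff v n else 0) =
          (\<lambda>j. c j * fourier_coeff (efun (-n)) (- int_decode j))"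
        by (auto simp: fe c_def fun_eq_iff)
      finally show ?thesis .
    qed
    ultimately have "fourier_coeff S n = fourier_coeff v n" by (rule sums_unique2)
    then show "fourier_coeff (\<lambda>y. v y - S y) n = 0"
      by (simp add: fourier_coeff_diff[OF iv iS])
  qed
  then have ae: "AE y in leb01. v y = S y" by eventually_elim simp
  have iu: "integrable leb01 u" by (rule L2_integrable[OF u])
  have "int01 (\<lambda>y. u y * S y) = int01 (\<lambda>y. u y * v y)"
  proof (rule integral_cong_AE)
    show "(\<lambda>y. u y * S y) \<in> borel_measurable leb01" using sm(1)[OF iu] by simp
    show "(\<lambda>y. u y * v y) \<in> borel_measurable leb01"
      using integrable_mult_continuous(1)[OF iu ac_continuous[OF v(1)]] by simp
    show "AE y in leb01. u y * S y = u y * v y" using ae by eventually_elim simp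
  qed
  then show ?thesis using sm(2)[OF iu] by (simp add: c_def mult.commute)
qed

section \<open>Sobolev norms on the torus and oscillating factors\<close>

lemma Hs_torus_sum_le:
  assumes "u \<in> Hs_torus s" "finite F"
  shows "(\<Sum>n\<in>F. (1 + (of_int n)\<^sup>2) powr s * (cmod (fourier_coeff u n))\<^sup>2) \<le> (Hs_torus_norm s u)\<^sup>2"
proof -
  have "(\<Sum>n\<in>F. (1 + (of_int n)\<^sup>2) powr s * (cmod (fourier_coeff u n))\<^sup>2)
    \<le> (\<Sum>\<^sub>\<infinity>n. (1 + (of_int n)\<^sup>2) powr s * (cmod (fourier_coeff u n))\<^sup>2)"
    by (rule finite_sum_le_infsum) (use assms in \<open>auto simp: Hs_torus_def\<close>)
  moreover have "0 \<le> (\<Sum>\<^sub>\<infinity>n. (1 + (real_of_int n)\<^sup>2) powr s * (cmod (fourier_coeff u n))\<^sup>2)"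
    by (rule infsum_nonneg) simp
  ultimately show ?thesis by (simp add: Hs_torus_norm_def)
qed

lemma Hs_torus_norm_nonneg [simp]: "0 \<le> Hs_torus_norm s u"
  unfolding Hs_torus_norm_def by (intro real_sqrt_ge_zero infsum_nonneg) simp

text \<open>Peetre's inequality transfers the frequency shift \<open>\<xi>\<close> to the weight of \<open>H\<^sup>s\<close>.\<close>

lemma peetre:
  fixes \<xi> s :: real and n :: int
  assumes s: "0 \<le> s" "s \<le> 1"
  shows "(1 + \<xi>\<^sup>2) powr s \<le> 80 * (1 + (of_int n)\<^sup>2) powr s * (1 + (2 * pi * of_int n + \<xi>)\<^sup>2)"
proof -
  define m where "m = 2 * pi * real_of_int n"
  have "\<xi>\<^sup>2 \<le> 2 * m\<^sup>2 + 2 * (m + \<xi>)\<^sup>2"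
    using zero_le_power2[of "2 * m + \<xi>"] by (simp add: power2_eq_square algebra_simps)
  then have 1: "1 + \<xi>\<^sup>2 \<le> 2 * (1 + m\<^sup>2) * (1 + (m + \<xi>)\<^sup>2)"
    by (simp add: algebra_simps) (smt (verit) mult_nonneg_nonneg zero_le_power2)
  have "pi < 3.15" using pi_approx by simp
  then have "pi\<^sup>2 \<le> 10" using power_mono[of pi "3.15" 2] pi_ge_zero by (simp add: power2_eq_square)
  then have "pi\<^sup>2 * (real_of_int n)\<^sup>2 \<le> 10 * (real_of_int n)\<^sup>2" by (intro mult_right_mono) auto
  then have 2: "1 + m\<^sup>2 \<le> 40 * (1 + (of_int n)\<^sup>2)"
    by (simp add: m_def power_mult_distrib)
  have "1 + \<xi>\<^sup>2 \<le> 2 * (40 * (1 + (of_int n)\<^sup>2)) * (1 + (m + \<xi>)\<^sup>2)"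
    using 1 2 by (meson mult_left_mono mult_right_mono order_trans zero_le_numeral add_nonneg_nonneg zero_le_one zero_le_power2)
  also have "\<dots> = 80 * ((1 + (of_int n)\<^sup>2) * (1 + (m + \<xi>)\<^sup>2))" by (simp only: mult.assoc)
  finally have "(1 + \<xi>\<^sup>2) powr s \<le> (80 * ((1 + (of_int n)\<^sup>2) * (1 + (m + \<xi>)\<^sup>2))) powr s"
    using s by (intro powr_mono2) auto
  also have "\<dots> = 80 powr s * ((1 + (of_int n)\<^sup>2) powr s * (1 + (m + \<xi>)\<^sup>2) powr s)"
    by (simp add: powr_mult)
  also have "\<dots> \<le> 80 * ((1 + (of_int n)\<^sup>2) powr s * (1 + (m + \<xi>)\<^sup>2))"
  proof (intro mult_mono)
    show "80 powr s \<le> (80::real)" using powr_mono[of s 1 80] s by simp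
    show "(1 + (m + \<xi>)\<^sup>2) powr s \<le> 1 + (m + \<xi>)\<^sup>2" using powr_mono[of s 1 "1 + (m + \<xi>)\<^sup>2"] s by simp
  qed auto
  finally show ?thesis by (simp add: m_def mult_ac)
qed

text \<open>H^s is paired with H^(-s): the oscillating factor shifts the frequencies of h by \<xi>,
  and Peetre's inequality bounds the negative weight by (1 + \<xi>^2)^(-s) at the price of one
  derivative of h. As h vanishes at both ends, the modulated function is periodic for every real
  \<xi>, not just for multiples of 2 pi.\<close>

lemma oscillatory_pairing_bound:
  assumes s: "0 \<le> s" "s \<le> 1" and u: "u \<in> Hs_torus s"
    and h: "ac h h'" "h' \<in> L2" "h 0 = 0" "h 1 = 0"
  shows "cmod (int01 (\<lambda>y. u y * (cis (- \<xi> * y) * h y))) \<le>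
    Hs_torus_norm s u * (9 * (1 + \<xi>\<^sup>2) powr (- s / 2) * (L2_norm h + L2_norm h'))"
proof -
  have uL: "u \<in> L2" using u by (simp add: Hs_torus_def)
  define v where "v = (\<lambda>y. cis (- \<xi> * y) * h y)"
  define w where "w = (\<lambda>y. cis (- \<xi> * y) * h' y)"
  define v' where "v' = (\<lambda>y. \<i> * of_real (- \<xi>) * cis (- \<xi> * y) * h y + w y)"
  have v: "ac v v'"
    unfolding v_def v'_def w_def by (rule ac_mult[OF ac_cis h(1)])
  have hL: "h \<in> L2" by (rule L2_continuous[OF ac_continuous[OF h(1)]])
  have cm: "(\<lambda>y. cis (- \<xi> * y)) \<in> borel_measurable leb01"
    by (intro continuous_measurable_leb01 continuous_intros)
  have vL: "v \<in> L2" "L2_norm v \<le> L2_norm h"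
    unfolding v_def using L2_mult_bounded[OF hL cm, of 1] by simp_all
  have wL: "w \<in> L2" "L2_norm w \<le> L2_norm h'"
    unfolding w_def using L2_mult_bounded[OF h(2) cm, of 1] by simp_all
  have v'e: "v' = (\<lambda>y. w y - \<i> * of_real \<xi> * v y)"
    by (auto simp: v'_def v_def)
  have v'L: "v' \<in> L2" unfolding v'e by (intro L2_diff L2_cmult wL vL)
  have v01: "v 0 = v 1" using h by (simp add: v_def)
  \<comment> \<open>w is the modulated derivative of h, so its coefficients are those of v times i
    (2 pi n + \<xi>), the shifted frequency that appears in \<open>peetre\<close>.\<close>
  have wc: "fourier_coeff w n = \<i> * of_real (2 * pi * of_int n + \<xi>) * fourier_coeff v n" for n
  proof -
    have "fourier_coeff v' n = fourier_coeff w n - \<i> * of_real \<xi> * fourier_coeff v n"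
      unfolding v'e using integrable_mult_efun[OF L2_integrable[OF vL(1)], of "-n"]
        integrable_mult_efun[OF L2_integrable[OF wL(1)], of "-n"]
      by (simp add: fourier_coeff_efun left_diff_distrib mult.assoc)
    then show ?thesis using fourier_coeff_deriv[OF v v01, of n] by (simp add: algebra_simps)
  qed
  define B where "B = 80 * (1 + \<xi>\<^sup>2) powr (- s) * ((L2_norm h)\<^sup>2 + (L2_norm h')\<^sup>2)"
  have vB: "(\<Sum>n\<in>F. (1 + (of_int n)\<^sup>2) powr (- s) * (cmod (fourier_coeff v n))\<^sup>2) \<le> B"
    if F: "finite F" for F :: "int set"
  proof -
    have "(\<Sum>n\<in>F. (1 + (of_int n)\<^sup>2) powr (- s) * (cmod (fourier_coeff v n))\<^sup>2)
      \<le> (\<Sum>n\<in>F. 80 * (1 + \<xi>\<^sup>2) powr (- s) * ((cmod (fourier_coeff v n))\<^sup>2 + (cmod (fourier_coeff w n))\<^sup>2))"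
    proof (rule sum_mono)
      fix n
      define p where "p = (1 + \<xi>\<^sup>2) powr s"
      define q where "q = (1 + (real_of_int n)\<^sup>2) powr s"
      have pq: "p > 0" "q > 0" using add_pos_nonneg[OF zero_less_one zero_le_power2, of \<xi>]
           add_pos_nonneg[OF zero_less_one zero_le_power2, of "real_of_int n"]
         by (simp_all add: p_def q_def)
      have "p \<le> 80 * q * (1 + (2 * pi * of_int n + \<xi>)\<^sup>2)"
        unfolding p_def q_def by (rule peetre[OF s])
      then have "1 / q \<le> 80 * (1 / p) * (1 + (2 * pi * of_int n + \<xi>)\<^sup>2)"
        using pq by (simp add: field_simps)
      then have "1 / q * (cmod (fourier_coeff v n))\<^sup>2 \<le>
        80 * (1 / p) * (1 + (2 * pi * of_int n + \<xi>)\<^sup>2) * (cmod (fourier_coeff v n))\<^sup>2"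
        by (rule mult_right_mono) simp
      also have "\<dots> = 80 * (1 / p) * ((cmod (fourier_coeff v n))\<^sup>2 + (cmod (fourier_coeff w n))\<^sup>2)"
        unfolding wc norm_mult power_mult_distrib norm_of_real norm_ii power2_abs
        by (simp only: distrib_right mult_1 power_one distrib_left mult.assoc)
      finally show "(1 + (of_int n)\<^sup>2) powr (- s) * (cmod (fourier_coeff v n))\<^sup>2 \<le>
        80 * (1 + \<xi>\<^sup>2) powr (- s) * ((cmod (fourier_coeff v n))\<^sup>2 + (cmod (fourier_coeff w n))\<^sup>2)"
        by (simp add: powr_minus_divide p_def q_def)
    qed
    also have "\<dots> = 80 * (1 + \<xi>\<^sup>2) powr (- s) * ((\<Sum>n\<in>F. (cmod (fourier_coeff v n))\<^sup>2) + (\<Sum>n\<in>F. (cmod (fourier_coeff w n))\<^sup>2))"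
      by (simp only: sum_distrib_left[symmetric] sum.distrib)
    also have "\<dots> \<le> B"
      unfolding B_def
      using order_trans[OF bessel[OF vL(1) F] power_mono[OF vL(2)]]
        order_trans[OF bessel[OF wL(1) F] power_mono[OF wL(2)]]
      by (intro mult_left_mono add_mono) auto
    finally show ?thesis .
  qed
  have partial: "cmod (\<Sum>j<N. fourier_coeff u (- int_decode j) * fourier_coeff v (int_decode j))
      \<le> Hs_torus_norm s u * sqrt B" for N
  proof -
    define F where "F = int_decode ` {..<N}"
    have F: "finite F" by (simp add: F_def)
    \<comment> \<open>The weights in a and b cancel in the product. The index -n in a comes from the
      bilinear pairing and is removed by reindexing.\<close>
    define a where "a = (\<lambda>n::int. (1 + (of_int n)\<^sup>2) powr (s/2) * cmod (fourier_coeff u (-n)))"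
    define b where "b = (\<lambda>n::int. (1 + (of_int n)\<^sup>2) powr (-s/2) * cmod (fourier_coeff v n))"
    have ab: "a n * b n = cmod (fourier_coeff u (-n) * fourier_coeff v n)" for n
    proof -
      have "(1 + (real_of_int n)\<^sup>2) powr (s/2) * (1 + (real_of_int n)\<^sup>2) powr (-s/2) = 1"
        using add_pos_nonneg[OF zero_less_one zero_le_power2, of "real_of_int n"]
        by (simp flip: powr_add)
      then show ?thesis by (simp add: a_def b_def norm_mult mult_ac)
    qed
    have sq: "((1 + (real_of_int n)\<^sup>2) powr (r/2))\<^sup>2 = (1 + (real_of_int n)\<^sup>2) powr r" for n r
      by (simp add: power2_eq_square flip: powr_add)
    have "(\<Sum>n\<in>F. (a n)\<^sup>2) = (\<Sum>n\<in>F. (1 + (of_int n)\<^sup>2) powr s * (cmod (fourier_coeff u (-n)))\<^sup>2)"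
      by (simp add: a_def power_mult_distrib sq)
    also have "\<dots> = (\<Sum>n\<in>uminus ` F. (1 + (of_int n)\<^sup>2) powr s * (cmod (fourier_coeff u n))\<^sup>2)"
      by (subst sum.reindex) (auto simp: inj_on_def)
    also have "\<dots> \<le> (Hs_torus_norm s u)\<^sup>2"
      by (rule Hs_torus_sum_le[OF u]) (use F in simp)
    finally have A: "L2_set a F \<le> Hs_torus_norm s u"
      unfolding L2_set_def by (rule real_le_lsqrt[rotated -1]) (auto intro: sum_nonneg)
    have "(\<Sum>n\<in>F. (b n)\<^sup>2) = (\<Sum>n\<in>F. (1 + (of_int n)\<^sup>2) powr (-s) * (cmod (fourier_coeff v n))\<^sup>2)"
      by (simp only: b_def power_mult_distrib sq)
    also have "\<dots> \<le> B" by (rule vB[OF F])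
    finally have Bb: "L2_set b F \<le> sqrt B" unfolding L2_set_def by simp
    have "cmod (\<Sum>j<N. fourier_coeff u (- int_decode j) * fourier_coeff v (int_decode j))
       = cmod (\<Sum>n\<in>F. fourier_coeff u (- n) * fourier_coeff v n)"
      unfolding F_def by (subst sum.reindex) (auto simp: inj_int_decode)
    also have "\<dots> \<le> (\<Sum>n\<in>F. \<bar>a n\<bar> * \<bar>b n\<bar>)"
      by (rule order_trans[OF norm_sum]) (simp add: ab abs_mult[symmetric])
    also have "\<dots> \<le> L2_set a F * L2_set b F" by (rule L2_set_mult_ineq)
    also have "\<dots> \<le> Hs_torus_norm s u * sqrt B"
      by (intro mult_mono A Bb) auto
    finally show ?thesis .
  qed
  have "(\<lambda>N. cmod (\<Sum>j<N. fourier_coeff u (- int_decode j) * fourier_coeff v (int_decode j)))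
    \<longlonglongrightarrow> cmod (int01 (\<lambda>y. u y * v y))"
    using fourier_pairing[OF uL v v'L v01] unfolding sums_def by (rule tendsto_norm)
  then have "cmod (int01 (\<lambda>y. u y * v y)) \<le> Hs_torus_norm s u * sqrt B"
    by (rule LIMSEQ_le_const2) (use partial in blast)
  \<comment> \<open>9 is chosen because 9^2 = 81 exceeds 80, the constant of
    \<open>peetre\<close>.\<close>
  also have "sqrt B \<le> 9 * (1 + \<xi>\<^sup>2) powr (- s / 2) * (L2_norm h + L2_norm h')"
  proof (rule real_le_lsqrt)
    show "B \<le> (9 * (1 + \<xi>\<^sup>2) powr (- s / 2) * (L2_norm h + L2_norm h'))\<^sup>2"
    proof -
      have e: "((1 + \<xi>\<^sup>2) powr (- s / 2))\<^sup>2 = (1 + \<xi>\<^sup>2) powr (- s)"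
        by (simp add: power2_eq_square flip: powr_add)
      have "(L2_norm h)\<^sup>2 + (L2_norm h')\<^sup>2 \<le> (L2_norm h + L2_norm h')\<^sup>2"
        by (simp add: power2_eq_square algebra_simps)
      then have "80 * (1 + \<xi>\<^sup>2) powr (- s) * ((L2_norm h)\<^sup>2 + (L2_norm h')\<^sup>2) \<le>
        81 * (1 + \<xi>\<^sup>2) powr (- s) * (L2_norm h + L2_norm h')\<^sup>2"
        by (intro mult_mono) auto
      then show ?thesis unfolding power_mult_distrib e B_def by simp
    qed
  qed simp
  finally show ?thesis unfolding v_def by (simp add: mult_left_mono)
qed

subsection \<open>Oscillatory integrals and the dual elliptic problem\<close>

lemma L1_le_L2:
  assumes "u \<in> L2" shows "int01 (\<lambda>y. cmod (u y)) \<le> L2_norm u"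
proof -
  have "L2_norm (\<lambda>_. 1) = 1" by (simp add: L2_norm_def measure_restrict_space)
  then show ?thesis
    using L2_Cauchy_Schwarz_abs[OF assms L2_continuous[of "\<lambda>_. 1"]] by simp
qed

text \<open>|u y| is at most |u x| plus the L^1 norm of u'; averaging over x in an interval of
  length 1 gives the Sobolev embedding with constant 1. It controls the boundary values left by
  integration by parts.\<close>

lemma ac_sup_bound:
  assumes u: "ac u u'" "u' \<in> L2" and y: "y \<in> {0..1}"
  shows "cmod (u y) \<le> L2_norm u + L2_norm u'"
proof -
  have iu': "integrable leb01 u'" by (rule ac_integrable[OF u(1)])
  have d: "cmod (u y) \<le> cmod (u x) + L2_norm u'" if x: "x \<in> {0..1}" for x
  proof -
    have i: "integrable leb01 (\<lambda>t. (indicator {..y} t - indicator {..x} t) *\<^sub>R u' t)"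
      using integrable_indicator_leb01[OF iu', of "{..y}"] integrable_indicator_leb01[OF iu', of "{..x}"]
      by (simp add: scaleR_left_diff_distrib)
    have "u y - u x = prim u' y - prim u' x"
      using ac_eq[OF u(1) y] ac_eq[OF u(1) x] by (metis add_diff_cancel_left)
    also have "\<dots> = int01 (\<lambda>t. (indicator {..y} t - indicator {..x} t) *\<^sub>R u' t)"
      unfolding prim_def
      using integrable_indicator_leb01[OF iu', of "{..y}"] integrable_indicator_leb01[OF iu', of "{..x}"]
      by (simp add: scaleR_left_diff_distrib)
    also have "cmod \<dots> \<le> 1 * int01 (\<lambda>t. cmod (u' t))"
      by (rule integral_scaleR_bound[OF iu' i]) (auto simp: indicator_def)
    also have "\<dots> \<le> L2_norm u'" using L1_le_L2[OF u(2)] by simp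
    finally show ?thesis using norm_triangle_sub[of "u y" "u x"] by linarith
  qed
  have iu: "integrable leb01 (\<lambda>x. cmod (u x))"
    using integrable_continuous_leb01[OF ac_continuous[OF u(1)]] by simp
  have 1: "int01 (\<lambda>x. c) = c" for c :: real by (simp add: measure_restrict_space)
  have "cmod (u y) = int01 (\<lambda>x. cmod (u y))" by (simp only: 1)
  also have "\<dots> \<le> int01 (\<lambda>x. cmod (u x) + L2_norm u')"
    by (rule integral_mono) (use iu d in auto)
  also have "\<dots> = int01 (\<lambda>x. cmod (u x)) + L2_norm u'"
    using iu 1 by simp
  also have "\<dots> \<le> L2_norm u + L2_norm u'"
    using L1_le_L2[OF L2_continuous[OF ac_continuous[OF u(1)]]] by simp
  finally show ?thesis .
qed

lemma oscillatory_by_parts: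
  assumes p: "ac p p'" and \<xi>: "\<xi> \<noteq> 0"
  shows "\<bar>\<xi>\<bar> * cmod (int01 (\<lambda>y. cis (- \<xi> * y) * p y)) \<le>
     cmod (p 0) + cmod (p 1) + cmod (int01 (\<lambda>y. cis (- \<xi> * y) * p' y))"
proof -
  have cc: "continuous_on {0..1} (\<lambda>y. cis (- \<xi> * y))" by (intro continuous_intros)
  have i1: "integrable leb01 (\<lambda>y. cis (- \<xi> * y) * p y)"
    by (rule integrable_continuous_leb01) (intro continuous_intros ac_continuous[OF p])
  have i2: "integrable leb01 (\<lambda>y. cis (- \<xi> * y) * p' y)"
    by (rule integrable_mult_continuous(2)[OF ac_integrable[OF p] cc])
  have "int01 (\<lambda>y. (- \<i> * of_real \<xi>) * (cis (- \<xi> * y) * p y) + cis (- \<xi> * y) * p' y)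
     = cis (- \<xi>) * p 1 - p 0"
    using ac_integral[OF ac_mult[OF ac_cis[of "-\<xi>"] p]] by (simp add: mult.assoc)
  then have e: "(\<i> * of_real \<xi>) * int01 (\<lambda>y. cis (- \<xi> * y) * p y) =
     int01 (\<lambda>y. cis (- \<xi> * y) * p' y) - cis (- \<xi>) * p 1 + p 0"
    using i1 i2 by (simp add: algebra_simps)
  have "\<bar>\<xi>\<bar> * cmod (int01 (\<lambda>y. cis (- \<xi> * y) * p y)) =
      cmod ((\<i> * of_real \<xi>) * int01 (\<lambda>y. cis (- \<xi> * y) * p y))"
    by (simp add: norm_mult)
  also have "\<dots> \<le> cmod (int01 (\<lambda>y. cis (- \<xi> * y) * p' y)) + cmod (cis (- \<xi>) * p 1) + cmod (p 0)"
    unfolding e by (meson norm_triangle_ineq norm_triangle_ineq4 order_trans add_right_mono)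
  finally show ?thesis by (simp add: norm_mult)
qed

text \<open>The first integration by parts leaves \<open>u' h\<close>, which gains \<open>\<xi>\<^sup>-\<^sup>s\<close> because \<open>h\<close> vanishes at the
  boundary, and \<open>u h'\<close>, where a second integration by parts costs only boundary values.\<close>

lemma oscillatory_double_by_parts:
  assumes s: "0 \<le> s" "s \<le> 1" and \<xi>: "\<xi> \<noteq> 0"
    and u: "ac u u'" "u' \<in> Hs_torus s"
    and h: "ac h h1" "ac h1 h2" "h2 \<in> L2" "h 0 = 0" "h 1 = 0"
  shows "\<bar>\<xi>\<bar> * cmod (int01 (\<lambda>y. cis (- \<xi> * y) * (u y * h y))) \<le>
    9 * Hs_torus_norm s u' * \<bar>\<xi>\<bar> powr (- s) * (L2_norm h + L2_norm h1) +
    3 * (L2_norm u + L2_norm u') * (L2_norm h1 + L2_norm h2) / \<bar>\<xi>\<bar>"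
proof -
  have u'L: "u' \<in> L2" using u by (simp add: Hs_torus_def)
  have uL: "u \<in> L2" and hL: "h \<in> L2" and h1L: "h1 \<in> L2"
    by (rule L2_continuous[OF ac_continuous[OF u(1)]] L2_continuous[OF ac_continuous[OF h(1)]]
      L2_continuous[OF ac_continuous[OF h(2)]])+
  have cc: "continuous_on {0..1} (\<lambda>y. cis (- \<xi> * y))" by (intro continuous_intros)
  define N where "N = L2_norm u + L2_norm u'"
  define H where "H = L2_norm h1 + L2_norm h2"
  have i1: "integrable leb01 (\<lambda>y. u' y * h y)" by (rule L2_mult_integrable[OF u'L hL])
  have i2: "integrable leb01 (\<lambda>y. u y * h1 y)" by (rule L2_mult_integrable[OF uL h1L])
  have i3: "integrable leb01 (\<lambda>y. u' y * h1 y)" by (rule L2_mult_integrable[OF u'L h1L])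
  have i4: "integrable leb01 (\<lambda>y. u y * h2 y)" by (rule L2_mult_integrable[OF uL h(3)])
  note ic = integrable_mult_continuous(2)[OF _ cc]
  have first: "\<bar>\<xi>\<bar> * cmod (int01 (\<lambda>y. cis (- \<xi> * y) * (u y * h y))) \<le>
     cmod (int01 (\<lambda>y. u' y * (cis (- \<xi> * y) * h y))) +
     cmod (int01 (\<lambda>y. cis (- \<xi> * y) * (u y * h1 y)))"
  proof -
    have "int01 (\<lambda>y. cis (- \<xi> * y) * (u' y * h y + u y * h1 y)) =
       int01 (\<lambda>y. cis (- \<xi> * y) * (u' y * h y)) +
       int01 (\<lambda>y. cis (- \<xi> * y) * (u y * h1 y))"
      using ic[OF i1] ic[OF i2] by (simp add: distrib_left)
    moreover have "(\<lambda>y. cis (- \<xi> * y) * (u' y * h y)) = (\<lambda>y. u' y * (cis (- \<xi> * y) * h y))"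
      by (auto simp: mult_ac)
    ultimately show ?thesis
      using oscillatory_by_parts[OF ac_mult[OF u(1) h(1)] \<xi>] h(4,5)
        norm_triangle_ineq[of "int01 (\<lambda>y. u' y * (cis (- \<xi> * y) * h y))"
          "int01 (\<lambda>y. cis (- \<xi> * y) * (u y * h1 y))"] by simp
  qed
  have second: "cmod (int01 (\<lambda>y. u' y * (cis (- \<xi> * y) * h y))) \<le>
     9 * Hs_torus_norm s u' * \<bar>\<xi>\<bar> powr (- s) * (L2_norm h + L2_norm h1)"
  proof -
    have "(1 + \<xi>\<^sup>2) powr (- s / 2) \<le> (\<xi>\<^sup>2) powr (- s / 2)"
      by (rule powr_mono2') (use s \<xi> in auto)
    also have "\<dots> = \<bar>\<xi>\<bar> powr (- s)"
    proof -
      have "\<xi>\<^sup>2 = \<bar>\<xi>\<bar> powr 2" using \<xi> by simp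
      then show ?thesis by (simp only: powr_powr) simp
    qed
    finally have "9 * (1 + \<xi>\<^sup>2) powr (- s / 2) * (L2_norm h + L2_norm h1) \<le> 9 * \<bar>\<xi>\<bar> powr (- s) * (L2_norm h + L2_norm h1)"
      by (intro mult_right_mono mult_left_mono) auto
    then have "Hs_torus_norm s u' * (9 * (1 + \<xi>\<^sup>2) powr (- s / 2) * (L2_norm h + L2_norm h1)) \<le>
      Hs_torus_norm s u' * (9 * \<bar>\<xi>\<bar> powr (- s) * (L2_norm h + L2_norm h1))"
      by (rule mult_left_mono) simp
    then show ?thesis
      using oscillatory_pairing_bound[OF s u(2) h(1) h1L h(4,5), of \<xi>] by (simp add: mult_ac)
  qed
  \<comment> \<open>The boundary values at 0 and at 1 and the remaining integral are each at most N
    * H, whence the factor 3.\<close>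
  have third: "\<bar>\<xi>\<bar> * cmod (int01 (\<lambda>y. cis (- \<xi> * y) * (u y * h1 y))) \<le> 3 * N * H"
  proof -
    have b: "cmod (u y * h1 y) \<le> N * H" if "y \<in> {0..1}" for y
      unfolding norm_mult N_def H_def
      by (intro mult_mono ac_sup_bound[OF u(1) u'L that] ac_sup_bound[OF h(2,3) that]) auto
    have e: "cmod (int01 (\<lambda>y. cis (- \<xi> * y) * (v y * w y))) \<le> L2_norm v * L2_norm w"
      if "v \<in> L2" "w \<in> L2" for v w
    proof -
      have c: "(\<lambda>y. cis (- \<xi> * y)) \<in> borel_measurable leb01"
        by (rule continuous_measurable_leb01[OF cc])
      have "cmod (int01 (\<lambda>y. (cis (- \<xi> * y) * v y) * w y)) \<le> L2_norm (\<lambda>y. cis (- \<xi> * y) * v y) * L2_norm w"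
        by (rule L2_Cauchy_Schwarz) (use L2_mult_bounded(1)[OF that(1) c, of 1] that in auto)
      also have "\<dots> \<le> L2_norm v * L2_norm w"
        using L2_mult_bounded(2)[OF that(1) c, of 1] by (intro mult_right_mono) auto
      finally show ?thesis by (simp add: mult.assoc)
    qed
    have "cmod (int01 (\<lambda>y. cis (- \<xi> * y) * (u' y * h1 y + u y * h2 y))) \<le>
       L2_norm u' * L2_norm h1 + L2_norm u * L2_norm h2"
    proof -
      have eq: "int01 (\<lambda>y. cis (- \<xi> * y) * (u' y * h1 y + u y * h2 y)) =
         int01 (\<lambda>y. cis (- \<xi> * y) * (u' y * h1 y)) +
         int01 (\<lambda>y. cis (- \<xi> * y) * (u y * h2 y))"
        using ic[OF i3] ic[OF i4] by (simp add: distrib_left)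
      show ?thesis
        unfolding eq
        using e[OF u'L h1L] e[OF uL h(3)]
        norm_triangle_ineq[of "int01 (\<lambda>y. cis (- \<xi> * y) * (u' y * h1 y))"
          "int01 (\<lambda>y. cis (- \<xi> * y) * (u y * h2 y))"] by linarith
    qed
    also have "\<dots> \<le> N * H"
      unfolding N_def H_def by (simp add: algebra_simps)
    finally show ?thesis
      using oscillatory_by_parts[OF ac_mult[OF u(1) h(2)] \<xi>] b[of 0] b[of 1] by simp
  qed
  have "cmod (int01 (\<lambda>y. cis (- \<xi> * y) * (u y * h1 y))) \<le> 3 * N * H / \<bar>\<xi>\<bar>"
    using third \<xi> by (simp add: field_simps)
  then show ?thesis using first second unfolding N_def H_def by linarith
qed

section \<open>The dual boundary value problem\<close>

lemma ac_cnj: "ac u u' \<Longrightarrow> ac (\<lambda>y. cnj (u y)) (\<lambda>y. cnj (u' y))"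
proof (rule ac_I)
  assume u: "ac u u'"
  then show "integrable leb01 (\<lambda>y. cnj (u' y))" by (simp add: ac_integrable)
  fix y :: real assume y: "y \<in> {0..1}"
  have "prim (\<lambda>y. cnj (u' y)) y = cnj (prim u' y)"
    unfolding prim_def
    using integral_bounded_linear[OF bounded_linear_cnj integrable_indicator_leb01[OF ac_integrable[OF u], of "{..y}"]]
    by simp
  then show "cnj (u y) = cnj (u 0) + prim (\<lambda>y. cnj (u' y)) y"
    using ac_eq[OF u y] by (metis complex_cnj_add)
qed

text \<open>In the variables \<open>\<psi> \<plusminus> q\<close> the dual system decouples into two scalar equations.\<close>

lemma dual_problem_solution:
  fixes r :: "real \<Rightarrow> real" and R :: "real \<Rightarrow> complex"
  assumes r: "continuous_on {0..1} r" "\<And>y. y \<in> {0..1} \<Longrightarrow> 0 < r y"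
    and R: "continuous_on {0..1} R" and \<kappa>: "\<kappa> \<noteq> 0"
  obtains \<psi> q where "ac \<psi> (\<lambda>y. of_real (\<kappa> * r y) * q y)"
    "ac q (\<lambda>y. of_real (\<kappa> * r y) * (\<psi> y + R y))" "\<psi> 0 = 0" "\<psi> 1 = 0"
proof -
  \<comment> \<open>In the increasing variable G the decoupled equations have constant coefficients,
    and \<open>e 1\<close>, \<open>e (-1)\<close> below are their homogeneous solutions.\<close>
  define G where "G = (\<lambda>y. integral {0..y} r)"
  have Gd: "(G has_real_derivative r y) (at y within {0..1})" if "y \<in> {0..1}" for y
    unfolding G_def has_real_derivative_iff_has_vector_derivative
    by (rule integral_has_vector_derivative[OF r(1) that])
  have "integral {0..1} r \<noteq> 0"
  proof
    assume "integral {0..1} r = 0"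
    then have "\<forall>x\<in>{0..1}. r x = 0"
      using integral_eq_0_iff[OF r(1)] r(2) by (simp add: less_imp_le)
    then show False using r(2)[of 0] by auto
  qed
  moreover have "integral {0..1} r \<ge> 0" by (rule integral_nonneg) (use r in \<open>auto intro: less_imp_le integrable_continuous_interval\<close>)
  ultimately have G1: "G 1 > 0" "G 0 = 0" by (auto simp: G_def)
  have Gc: "continuous_on {0..1} G" by (rule DERIV_continuous_on[OF Gd])
  define e where "e = (\<lambda>c y. complex_of_real (exp (c * \<kappa> * G y)))"
  have rc: "continuous_on {0..1} (\<lambda>y. complex_of_real (r y))" using r(1) by (rule continuous_on_of_real)
  have ec: "continuous_on {0..1} (e c)" for c
    unfolding e_def by (intro continuous_intros Gc)
  have eac: "ac (e c) (\<lambda>y. of_real (c * \<kappa> * r y) * e c y)" for c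
  proof (rule ac_C1)
    fix y :: real assume y: "y \<in> {0..1}"
    have "((\<lambda>y. exp (c * \<kappa> * G y)) has_real_derivative (c * \<kappa> * r y * exp (c * \<kappa> * G y))) (at y within {0..1})"
      by (auto intro!: derivative_eq_intros Gd[OF y])
    then show "(e c has_vector_derivative of_real (c * \<kappa> * r y) * e c y) (at y within {0..1})"
      using has_vector_derivative_of_real[where 'a=complex and f="\<lambda>y. exp (c * \<kappa> * G y)" and D="c * \<kappa> * r y * exp (c * \<kappa> * G y)"]
      by (simp add: e_def mult.assoc)
  qed (intro continuous_intros ec rc r)
  \<comment> \<open>Variation of constants: \<open>Z c z\<close> below solves Z' = c \<kappa> r (Z +
    R) with initial value z.\<close>
  define J where "J = (\<lambda>c. prim (\<lambda>y. of_real \<kappa> * e (-c) y * of_real (r y) * R y))"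
  have iJ: "integrable leb01 (\<lambda>y. of_real \<kappa> * e (-c) y * of_real (r y) * R y)" for c
    by (intro integrable_continuous_leb01 continuous_intros ec rc R)
  define Z where "Z = (\<lambda>c z y. e c y * (z + of_real c * J c y))"
  have ee: "e c y * e (-c) y = 1" for c y by (simp add: e_def flip: of_real_mult exp_add)
  have Zac: "ac (Z c z) (\<lambda>y. of_real (c * \<kappa> * r y) * (Z c z y + R y))" for c z
  proof -
    have "ac (\<lambda>y. z + of_real c * J c y) (\<lambda>y. 0 + of_real c * (of_real \<kappa> * e (-c) y * of_real (r y) * R y))"
      unfolding J_def using ac_add[OF ac_const ac_cmult[OF ac_prim[OF iJ, of 0]]] by simp
    note a = ac_mult[OF eac[of c] this]
    have eq: "of_real (c * \<kappa> * r y) * e c y * (z + of_real c * J c y) + e c y * (0 + of_real c * (of_real \<kappa> * e (-c) y * of_real (r y) * R y))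
       = of_real (c * \<kappa> * r y) * (Z c z y + R y)" for y
    proof -
      have "e c y * (0 + of_real c * (of_real \<kappa> * e (-c) y * of_real (r y) * R y)) =
        (e c y * e (-c) y) * (of_real (c * \<kappa> * r y) * R y)" by (simp add: mult_ac)
      then show ?thesis by (simp add: ee Z_def algebra_simps)
    qed
    show ?thesis using a unfolding eq by (simp add: Z_def[abs_def])
  qed
  \<comment> \<open>Initial values \<alpha> and -\<alpha> make a + b vanish at 0, and this \<alpha>
    makes it vanish at 1 as well. The denominator is nonzero because \<kappa> and G 1 are.\<close>
  define \<alpha> where "\<alpha> = - (e 1 1 * J 1 1 - e (-1) 1 * J (-1) 1) / (e 1 1 - e (-1) 1)"
  define a where "a = Z 1 \<alpha>"
  define b where "b = Z (-1) (-\<alpha>)"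
  have aac: "ac a (\<lambda>y. of_real (\<kappa> * r y) * (a y + R y))"
    using Zac[of 1 \<alpha>] by (simp add: a_def)
  have bac: "ac b (\<lambda>y. - of_real (\<kappa> * r y) * (b y + R y))"
    using Zac[of "-1" "-\<alpha>"] by (simp add: b_def)
  have ne: "e 1 1 - e (-1) 1 \<noteq> 0"
    using G1 \<kappa> by (auto simp: e_def simp flip: of_real_diff)
  have ab0: "a 0 + b 0 = 0"
    by (simp add: a_def b_def Z_def J_def) (simp add: e_def G1)
  have ab1: "a 1 + b 1 = 0"
  proof -
    have "a 1 + b 1 = \<alpha> * (e 1 1 - e (-1) 1) + (e 1 1 * J 1 1 - e (-1) 1 * J (-1) 1)"
      by (simp add: a_def b_def Z_def algebra_simps)
    then show ?thesis using ne by (simp add: \<alpha>_def)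
  qed
  show ?thesis
  proof (rule that)
    have "ac (\<lambda>y. 1/2 * (a y + b y)) (\<lambda>y. 1/2 * (of_real (\<kappa> * r y) * (a y + R y) + - of_real (\<kappa> * r y) * (b y + R y)))"
      by (intro ac_cmult ac_add aac bac)
    also have "(\<lambda>y. 1/2 * (of_real (\<kappa> * r y) * (a y + R y) + - of_real (\<kappa> * r y) * (b y + R y))) =
      (\<lambda>y. of_real (\<kappa> * r y) * (1/2 * (a y - b y)))"
      by (auto simp: algebra_simps)
    finally show "ac (\<lambda>y. 1/2 * (a y + b y)) (\<lambda>y. of_real (\<kappa> * r y) * (1/2 * (a y - b y)))" .
    have "ac (\<lambda>y. 1/2 * (a y - b y)) (\<lambda>y. 1/2 * (of_real (\<kappa> * r y) * (a y + R y) - - of_real (\<kappa> * r y) * (b y + R y)))"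
      by (intro ac_cmult ac_diff aac bac)
    also have "(\<lambda>y. 1/2 * (of_real (\<kappa> * r y) * (a y + R y) - - of_real (\<kappa> * r y) * (b y + R y))) =
      (\<lambda>y. of_real (\<kappa> * r y) * (1/2 * (a y + b y) + R y))"
      by (auto simp: field_simps)
    finally show "ac (\<lambda>y. 1/2 * (a y - b y)) (\<lambda>y. of_real (\<kappa> * r y) * (1/2 * (a y + b y) + R y))" .
  qed (use ab0 ab1 in auto)
qed

text \<open>The product of q with the conjugate of \<psi> vanishes at both ends. The real part of
  the integral of its derivative, divided by \<kappa>, is the integral of r (|\<psi>|^2 + |q|^2 + Re
  (R cnj \<psi>)), which is therefore 0. Young's inequality absorbs the last term, so the bounds do
  not depend on \<kappa>.\<close>

lemma dual_problem_energy:
  fixes r :: "real \<Rightarrow> real" and R :: "real \<Rightarrow> complex"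
  assumes r: "continuous_on {0..1} r" "\<And>y. y \<in> {0..1} \<Longrightarrow> m \<le> r y" "\<And>y. y \<in> {0..1} \<Longrightarrow> r y \<le> M" "0 < m"
    and R: "continuous_on {0..1} R" and \<kappa>: "\<kappa> \<noteq> 0"
    and \<psi>: "ac \<psi> (\<lambda>y. of_real (\<kappa> * r y) * q y)" and q: "ac q (\<lambda>y. of_real (\<kappa> * r y) * (\<psi> y + R y))"
    and b: "\<psi> 0 = 0" "\<psi> 1 = 0"
  shows "L2_norm \<psi> \<le> M / m * L2_norm R" "L2_norm q \<le> M / m * L2_norm R"
proof -
  have c: "continuous_on {0..1} \<psi>" "continuous_on {0..1} q" using ac_continuous[OF \<psi>] ac_continuous[OF q] .
  have rc: "continuous_on {0..1} (\<lambda>y. complex_of_real (r y))" using r(1) by (rule continuous_on_of_real)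
  have mM: "m \<le> M" using r(2)[of 0] r(3)[of 0] by simp
  define p where "p = (\<lambda>y. r y * ((cmod (\<psi> y))\<^sup>2 + (cmod (q y))\<^sup>2 + Re (R y * cnj (\<psi> y))))"
  have pc: "continuous_on {0..1} p"
    unfolding p_def by (intro continuous_intros r c R)
  have cn: "continuous_on {0..1} (\<lambda>y. (cmod (\<psi> y))\<^sup>2)" "continuous_on {0..1} (\<lambda>y. (cmod (q y))\<^sup>2)"
    "continuous_on {0..1} (\<lambda>y. (cmod (R y))\<^sup>2)"
    by (intro continuous_intros c R)+
  note i = integrable_continuous_leb01[OF cn(1)] integrable_continuous_leb01[OF cn(2)] integrable_continuous_leb01[OF cn(3)]
  have "int01 (\<lambda>y. of_real (\<kappa> * r y) * (\<psi> y + R y) * cnj (\<psi> y) + q y * cnj (of_real (\<kappa> * r y) * q y)) = 0"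
    using ac_integral[OF ac_mult[OF q ac_cnj[OF \<psi>]]] b by simp
  moreover have "integrable leb01 (\<lambda>y. of_real (\<kappa> * r y) * (\<psi> y + R y) * cnj (\<psi> y) + q y * cnj (of_real (\<kappa> * r y) * q y))"
    by (intro integrable_continuous_leb01 continuous_intros c R rc r)
  ultimately have "int01 (\<lambda>y. Re (of_real (\<kappa> * r y) * (\<psi> y + R y) * cnj (\<psi> y) + q y * cnj (of_real (\<kappa> * r y) * q y))) = 0"
    by (subst integral_Re) auto
  moreover have "Re (of_real (\<kappa> * r y) * (\<psi> y + R y) * cnj (\<psi> y) + q y * cnj (of_real (\<kappa> * r y) * q y)) = \<kappa> * p y" for y
    unfolding p_def cmod_power2 by (simp add: power2_eq_square algebra_simps)
  ultimately have p0: "int01 p = 0" using \<kappa> by simp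
  \<comment> \<open>A lower bound for p after Young's inequality, with r replaced by m in the good
    terms and by M in the bad one. It no longer contains r and integrates to squared norms.\<close>
  define d where "d = (\<lambda>y. (m/2) * (cmod (\<psi> y))\<^sup>2 + m * (cmod (q y))\<^sup>2 - (M/2) * (cmod (R y))\<^sup>2)"
  have dc: "continuous_on {0..1} d" unfolding d_def by (intro continuous_intros c R)
  have le: "d y \<le> p y" if y: "y \<in> {0..1}" for y
  proof -
    have "- Re (R y * cnj (\<psi> y)) \<le> cmod (R y) * cmod (\<psi> y)"
      using abs_Re_le_cmod[of "R y * cnj (\<psi> y)"] by (simp add: norm_mult)
    also have "\<dots> \<le> ((cmod (R y))\<^sup>2 + (cmod (\<psi> y))\<^sup>2) / 2"
      using sum_squares_bound[of "cmod (R y)" "cmod (\<psi> y)"] by simp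
    finally have 1: "(cmod (\<psi> y))\<^sup>2 / 2 + (cmod (q y))\<^sup>2 - (cmod (R y))\<^sup>2 / 2 \<le>
       (cmod (\<psi> y))\<^sup>2 + (cmod (q y))\<^sup>2 + Re (R y * cnj (\<psi> y))" by (simp add: field_simps)
    have r0: "0 \<le> r y" using r(2)[OF y] r(4) by simp
    have "d y \<le> r y / 2 * (cmod (\<psi> y))\<^sup>2 + r y * (cmod (q y))\<^sup>2 - r y / 2 * (cmod (R y))\<^sup>2"
      unfolding d_def using r(2,3)[OF y] by (intro diff_mono add_mono mult_right_mono) auto
    also have "\<dots> = r y * ((cmod (\<psi> y))\<^sup>2 / 2 + (cmod (q y))\<^sup>2 - (cmod (R y))\<^sup>2 / 2)"
      by (simp add: algebra_simps)
    also have "\<dots> \<le> p y" unfolding p_def by (rule mult_left_mono[OF 1 r0])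
    finally show ?thesis .
  qed
  have "int01 d \<le> int01 p"
    by (rule integral_mono) (use le integrable_continuous_leb01[OF dc] integrable_continuous_leb01[OF pc] in auto)
  moreover have "int01 d = (m/2) * (L2_norm \<psi>)\<^sup>2 + m * (L2_norm q)\<^sup>2 - (M/2) * (L2_norm R)\<^sup>2"
    unfolding d_def L2_norm_sq using i by simp
  ultimately have E: "m * (L2_norm \<psi>)\<^sup>2 + 2 * m * (L2_norm q)\<^sup>2 \<le> M * (L2_norm R)\<^sup>2"
    using p0 by simp
  \<comment> \<open>The energy estimate yields the factor sqrt (M/m). Since M/m is at least 1, it
    may be enlarged to M/m, which avoids roots.\<close>
  have fin: "x \<le> M / m * L2_norm R" if "m * x\<^sup>2 \<le> M * (L2_norm R)\<^sup>2" for x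
  proof (rule power2_le_imp_le)
    have "x\<^sup>2 \<le> M / m * (L2_norm R)\<^sup>2" using that r(4) by (simp add: field_simps)
    also have "\<dots> \<le> (M / m)\<^sup>2 * (L2_norm R)\<^sup>2"
      using mM r(4) by (intro mult_right_mono) (auto simp: power2_eq_square divide_simps)
    finally show "x\<^sup>2 \<le> (M / m * L2_norm R)\<^sup>2" by (simp only: power_mult_distrib)
    show "0 \<le> M / m * L2_norm R" using mM r(4) by simp
  qed
  have n: "0 \<le> m * (L2_norm \<psi>)\<^sup>2" "0 \<le> m * (L2_norm q)\<^sup>2" using r(4) by auto
  show "L2_norm \<psi> \<le> M / m * L2_norm R" by (rule fin) (use E n in linarith)
  show "L2_norm q \<le> M / m * L2_norm R" by (rule fin) (use E n in linarith)
qed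

subsection \<open>The elliptic estimate\<close>

text \<open>This is the equation (g \<partial>_y / k)^2 P - P = F as a first-order system, with
  \<kappa> r = k/g. In this form no derivative falls on the coefficient. The equations hold almost
  everywhere only, as F is determined up to null sets.\<close>

definition elliptic_pair ::
    "(real \<Rightarrow> real) \<Rightarrow> real \<Rightarrow> (real \<Rightarrow> complex) \<Rightarrow> (real \<Rightarrow> complex) \<Rightarrow> (real \<Rightarrow> complex) \<Rightarrow> bool"
  where
  "elliptic_pair r \<kappa> P Q F \<longleftrightarrow> P 0 = 0 \<and> P 1 = 0 \<and>
     (\<exists>P'. ac P P' \<and> (AE y in leb01. P' y = of_real (\<kappa> * r y) * Q y)) \<and>
     (\<exists>Q'. ac Q Q' \<and> (AE y in leb01. Q' y = of_real (\<kappa> * r y) * (P y + F y)))"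

lemma elliptic_pair_cong_AE:
  assumes "elliptic_pair r \<kappa> P Q F" "AE y in leb01. F y = G y"
  shows "elliptic_pair r \<kappa> P Q G"
proof -
  obtain Q' where Q': "ac Q Q'" "AE y in leb01. Q' y = of_real (\<kappa> * r y) * (P y + F y)"
    using assms(1) by (auto simp: elliptic_pair_def)
  have "AE y in leb01. Q' y = of_real (\<kappa> * r y) * (P y + G y)"
    using Q'(2) assms(2) by eventually_elim simp
  then show ?thesis using assms(1) Q'(1) by (auto simp: elliptic_pair_def)
qed

text \<open>r stands for 1/|g|, and \<open>r1\<close>, \<open>r2\<close> for its first two
  derivatives; they are complex-valued because \<open>ac\<close> relates complex functions. A single
  M serves for all upper bounds.\<close>

locale shear_weight =
  fixes r :: "real \<Rightarrow> real" and r1 r2 :: "real \<Rightarrow> complex" and m M :: real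
  assumes m_pos: "0 < m"
    and lower: "\<And>y. y \<in> {0..1} \<Longrightarrow> m \<le> r y"
    and upper: "\<And>y. y \<in> {0..1} \<Longrightarrow> r y \<le> M"
    and ac_r: "ac (\<lambda>y. of_real (r y)) r1"
    and ac_r1: "ac r1 r2"
    and r1_bound: "\<And>y. y \<in> {0..1} \<Longrightarrow> cmod (r1 y) \<le> M"
    and r2_bound: "AE y in leb01. cmod (r2 y) \<le> M"
begin

lemma M_pos: "0 < M"
  using m_pos lower[of 0] upper[of 0] by simp

lemma r_pos: "y \<in> {0..1} \<Longrightarrow> 0 < r y"
  using m_pos lower[of y] by simp

lemma cr_continuous: "continuous_on {0..1} (\<lambda>y. complex_of_real (r y))"
  by (rule ac_continuous[OF ac_r])

lemma r_continuous: "continuous_on {0..1} r"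
  using continuous_on_Re[OF cr_continuous] by simp

lemma cr_bound: "y \<in> {0..1} \<Longrightarrow> cmod (of_real (r y)) \<le> M"
  using r_pos[of y] upper[of y] by simp

lemma L2_mult_r:
  assumes "u \<in> L2"
  shows "(\<lambda>y. of_real (r y) * u y) \<in> L2" "L2_norm (\<lambda>y. of_real (r y) * u y) \<le> M * L2_norm u"
    "(\<lambda>y. r1 y * u y) \<in> L2" "L2_norm (\<lambda>y. r1 y * u y) \<le> M * L2_norm u"
    "(\<lambda>y. r2 y * u y) \<in> L2" "L2_norm (\<lambda>y. r2 y * u y) \<le> M * L2_norm u"
proof -
  note M = less_imp_le[OF M_pos]
  show "(\<lambda>y. of_real (r y) * u y) \<in> L2" "L2_norm (\<lambda>y. of_real (r y) * u y) \<le> M * L2_norm u"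
    by (rule L2_mult_bounded[OF assms continuous_measurable_leb01[OF cr_continuous] AE_leb01_mono[OF cr_bound] M]; simp)+
  show "(\<lambda>y. r1 y * u y) \<in> L2" "L2_norm (\<lambda>y. r1 y * u y) \<le> M * L2_norm u"
    by (rule L2_mult_bounded[OF assms continuous_measurable_leb01[OF ac_continuous[OF ac_r1]] AE_leb01_mono[OF r1_bound] M]; simp)+
  show "(\<lambda>y. r2 y * u y) \<in> L2" "L2_norm (\<lambda>y. r2 y * u y) \<le> M * L2_norm u"
    by (rule L2_mult_bounded[OF assms borel_measurable_integrable[OF ac_integrable[OF ac_r1]] r2_bound M])+
qed

text \<open>The dual problem has right-hand side \<open>cnj P\<close>; integrating the derivative of \<open>P q - Q \<psi>\<close> then
  expresses the weighted \<open>L\<^sup>2\<close> norm of \<open>P\<close> through \<open>F\<close> and \<open>\<psi>\<close>.\<close>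

lemma elliptic_duality:
  assumes \<kappa>: "\<kappa> \<noteq> 0" and F: "F \<in> L2"
    and pair: "elliptic_pair r \<kappa> P Q F"
  obtains \<psi> q where "ac \<psi> (\<lambda>y. of_real (\<kappa> * r y) * q y)"
    "ac q (\<lambda>y. of_real (\<kappa> * r y) * (\<psi> y + cnj (P y)))" "\<psi> 0 = 0" "\<psi> 1 = 0"
    "L2_norm \<psi> \<le> M / m * L2_norm P" "L2_norm q \<le> M / m * L2_norm P"
    "m * (L2_norm P)\<^sup>2 \<le> cmod (int01 (\<lambda>y. F y * (of_real (r y) * \<psi> y)))"
proof -
  obtain P' Q' where P: "ac P P'" "AE y in leb01. P' y = of_real (\<kappa> * r y) * Q y" "P 0 = 0" "P 1 = 0"
    and Q: "ac Q Q'" "AE y in leb01. Q' y = of_real (\<kappa> * r y) * (P y + F y)"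
    using pair by (auto simp: elliptic_pair_def)
  have Pc: "continuous_on {0..1} P" by (rule ac_continuous[OF P(1)])
  have Rc: "continuous_on {0..1} (\<lambda>y. cnj (P y))" by (intro continuous_intros Pc)
  obtain \<psi> q where \<psi>: "ac \<psi> (\<lambda>y. of_real (\<kappa> * r y) * q y)"
    and q: "ac q (\<lambda>y. of_real (\<kappa> * r y) * (\<psi> y + cnj (P y)))" and b: "\<psi> 0 = 0" "\<psi> 1 = 0"
    using dual_problem_solution[OF r_continuous r_pos Rc \<kappa>] by blast
  have nR: "L2_norm (\<lambda>y. cnj (P y)) = L2_norm P" by (simp add: L2_norm_def)
  note en = dual_problem_energy[OF r_continuous lower upper m_pos Rc \<kappa> \<psi> q b, unfolded nR]
  have \<psi>L: "\<psi> \<in> L2" by (rule L2_continuous[OF ac_continuous[OF \<psi>]])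
  have iP: "integrable leb01 (\<lambda>y. complex_of_real (r y * (cmod (P y))\<^sup>2))"
    by (intro integrable_continuous_leb01 continuous_intros r_continuous Pc continuous_on_of_real)
  have iF: "integrable leb01 (\<lambda>y. F y * (of_real (r y) * \<psi> y))"
    by (rule L2_mult_integrable[OF F L2_mult_r(1)[OF \<psi>L]])
  define X where "X = (\<lambda>y. (P' y * q y + P y * (of_real (\<kappa> * r y) * (\<psi> y + cnj (P y)))) -
     (Q' y * \<psi> y + Q y * (of_real (\<kappa> * r y) * q y)))"
  have acX: "ac (\<lambda>y. P y * q y - Q y * \<psi> y) X"
    unfolding X_def by (intro ac_diff ac_mult P Q \<psi> q)
  have "int01 X = 0" using ac_integral[OF acX] P b by simp
  moreover have "int01 X = int01 (\<lambda>y. of_real \<kappa> * (complex_of_real (r y * (cmod (P y))\<^sup>2) - F y * (of_real (r y) * \<psi> y)))"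
  proof (rule integral_cong_AE)
    show "X \<in> borel_measurable leb01" using ac_integrable[OF acX] by simp
    show "(\<lambda>y. of_real \<kappa> * (complex_of_real (r y * (cmod (P y))\<^sup>2) - F y * (of_real (r y) * \<psi> y))) \<in> borel_measurable leb01"
      using iP iF by (intro borel_measurable_integrable) simp
    show "AE y in leb01. X y = of_real \<kappa> * (complex_of_real (r y * (cmod (P y))\<^sup>2) - F y * (of_real (r y) * \<psi> y))"
      using P(2) Q(2)
    proof eventually_elim
      case (elim y)
      show ?case unfolding X_def elim of_real_mult complex_norm_square by (simp add: algebra_simps)
    qed
  qed
  ultimately have "int01 (\<lambda>y. complex_of_real (r y * (cmod (P y))\<^sup>2) - F y * (of_real (r y) * \<psi> y)) = 0"
    using \<kappa> by (simp del: of_real_mult)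
  then have eq: "int01 (\<lambda>y. F y * (of_real (r y) * \<psi> y)) = of_real (int01 (\<lambda>y. r y * (cmod (P y))\<^sup>2))"
    using iP iF by (simp del: of_real_mult of_real_power)
  have "m * (L2_norm P)\<^sup>2 = int01 (\<lambda>y. m * (cmod (P y))\<^sup>2)"
    by (simp add: L2_norm_sq)
  also have "\<dots> \<le> int01 (\<lambda>y. r y * (cmod (P y))\<^sup>2)"
  proof (rule integral_mono)
    show "integrable leb01 (\<lambda>y. m * (cmod (P y))\<^sup>2)" "integrable leb01 (\<lambda>y. r y * (cmod (P y))\<^sup>2)"
      by (intro integrable_continuous_leb01 continuous_intros r_continuous Pc)+
  qed (use lower in \<open>auto intro: mult_right_mono\<close>)
  also have "\<dots> \<le> cmod (int01 (\<lambda>y. F y * (of_real (r y) * \<psi> y)))"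
    unfolding eq norm_of_real by simp
  finally show ?thesis using that[OF \<psi> q b en] by blast
qed

text \<open>Cauchy-Schwarz in the duality identity, without using oscillation. The bound holds at
  every time and puts the velocity in L^2 also for t < 1. One factor M/m comes from the dual energy
  estimate, the other from r in the pairing and m on the left.\<close>

lemma elliptic_bound:
  assumes \<kappa>: "\<kappa> \<noteq> 0" and F: "F \<in> L2"
    and pair: "elliptic_pair r \<kappa> P Q F"
  shows "L2_norm P \<le> (M / m)\<^sup>2 * L2_norm F"
proof -
  obtain \<psi> q where \<psi>: "ac \<psi> (\<lambda>y. of_real (\<kappa> * r y) * q y)"
    and "ac q (\<lambda>y. of_real (\<kappa> * r y) * (\<psi> y + cnj (P y)))" "\<psi> 0 = 0" "\<psi> 1 = 0"
    and \<psi>P: "L2_norm \<psi> \<le> M / m * L2_norm P" and "L2_norm q \<le> M / m * L2_norm P"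
    and d: "m * (L2_norm P)\<^sup>2 \<le> cmod (int01 (\<lambda>y. F y * (of_real (r y) * \<psi> y)))"
    by (rule elliptic_duality[OF assms])
  have \<psi>L: "\<psi> \<in> L2" by (rule L2_continuous[OF ac_continuous[OF \<psi>]])
  note d
  also have "cmod (int01 (\<lambda>y. F y * (of_real (r y) * \<psi> y))) \<le> L2_norm F * L2_norm (\<lambda>y. of_real (r y) * \<psi> y)"
    by (rule L2_Cauchy_Schwarz[OF F L2_mult_r(1)[OF \<psi>L]])
  also have "\<dots> \<le> L2_norm F * (M * (M / m * L2_norm P))"
    using L2_mult_r(2)[OF \<psi>L] mult_left_mono[OF \<psi>P, of M] M_pos by (intro mult_left_mono) auto
  finally have "L2_norm P * L2_norm P \<le> (M / m)\<^sup>2 * L2_norm F * L2_norm P"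
    using m_pos by (simp add: field_simps power2_eq_square)
  then show ?thesis
    using m_pos M_pos L2_norm_nonneg[of P]
    by (cases "L2_norm P = 0") (auto simp: mult_le_cancel_right)
qed

text \<open>r \<psi> is the function that meets F in the duality identity. Its derivatives are
  sorted by powers of \<kappa>, at most one per derivative. R enters the second one
  undifferentiated, which matters because R will be the conjugate of the oscillating P, whose
  derivative would cost a factor t.\<close>

lemma weighted_dual_ac:
  fixes R :: "real \<Rightarrow> complex"
  assumes \<psi>: "ac \<psi> (\<lambda>y. of_real (\<kappa> * r y) * q y)" and q: "ac q (\<lambda>y. of_real (\<kappa> * r y) * (\<psi> y + R y))"
  defines "c \<equiv> complex_of_real \<kappa>" and "\<rho> \<equiv> \<lambda>y. complex_of_real (r y)"
  shows "ac (\<lambda>y. \<rho> y * \<psi> y) (\<lambda>y. r1 y * \<psi> y + c * (\<rho> y * (\<rho> y * q y)))" (is "ac ?h ?h1")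
    "ac (\<lambda>y. r1 y * \<psi> y + c * (\<rho> y * (\<rho> y * q y)))
      (\<lambda>y. r2 y * \<psi> y + c * (3 * (r1 y * (\<rho> y * q y))) + c\<^sup>2 * (\<rho> y * (\<rho> y * (\<rho> y * (\<psi> y + R y)))))"
      (is "ac _ ?h2")
proof -
  have \<rho>: "ac \<rho> r1" using ac_r by (simp add: \<rho>_def)
  have "ac ?h (\<lambda>y. r1 y * \<psi> y + \<rho> y * (of_real (\<kappa> * r y) * q y))"
    by (rule ac_mult[OF \<rho> \<psi>])
  also have "(\<lambda>y. r1 y * \<psi> y + \<rho> y * (of_real (\<kappa> * r y) * q y)) = ?h1"
    by (auto simp: c_def \<rho>_def)
  finally show "ac ?h ?h1" .
  have "ac ?h1 (\<lambda>y. (r2 y * \<psi> y + r1 y * (of_real (\<kappa> * r y) * q y)) +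
    c * (r1 y * (\<rho> y * q y) + \<rho> y * (r1 y * q y + \<rho> y * (of_real (\<kappa> * r y) * (\<psi> y + R y)))))"
    by (intro ac_add ac_cmult ac_mult ac_r1 \<rho> \<psi> q)
  also have "(\<lambda>y. (r2 y * \<psi> y + r1 y * (of_real (\<kappa> * r y) * q y)) +
    c * (r1 y * (\<rho> y * q y) + \<rho> y * (r1 y * q y + \<rho> y * (of_real (\<kappa> * r y) * (\<psi> y + R y))))) = ?h2"
    by (auto simp: c_def \<rho>_def power2_eq_square algebra_simps)
  finally show "ac ?h1 ?h2" .
qed

text \<open>The first two derivatives of h cost |\<kappa>| and \<kappa>^2, and each integration by
  parts gains 1/(|\<kappa>| t), so only powers of t remain and C is uniform over |\<kappa>| >= k0.
  The relation between \<xi> and \<kappa> is one of absolute values because \<kappa> will be k times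
  the sign of g, whereas \<xi> = k t.\<close>

lemma elliptic_decay:
  assumes k0: "0 < k0" and s: "0 \<le> s" "s \<le> 1"
  obtains C where "0 \<le> C" "\<And>\<kappa> \<xi> t P Q u u'.
    \<lbrakk>k0 \<le> \<bar>\<kappa>\<bar>; 1 \<le> t; \<bar>\<xi>\<bar> = \<bar>\<kappa>\<bar> * t; ac u u'; u' \<in> Hs_torus s;
     elliptic_pair r \<kappa> P Q (\<lambda>y. cis (- \<xi> * y) * u y)\<rbrakk>
    \<Longrightarrow> L2_norm P \<le> C * t powr (- (1 + s)) * (Hs_torus_norm s u' + (L2_norm u + L2_norm u'))"
proof -
  define d where "d = M / m"
  have d0: "0 < d" using m_pos M_pos by (simp add: d_def)
  \<comment> \<open>Terms of lower order in \<kappa> are raised to top order by powers of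
    |\<kappa>|/k0 >= 1. In C1 the 2 counts r \<psi> and r1 \<psi>. In C2 the 2 counts r1 \<psi> and
    r2 \<psi>, the 4 adds r^2 q in h1 and 3 r1 r q in h2, and d + 1 bounds \<psi> + cnj P.\<close>
  define C1 where "C1 = 2 * M * d / k0 + M\<^sup>2 * d"
  define C2 where "C2 = 2 * M * d / k0\<^sup>2 + 4 * M\<^sup>2 * d / k0 + M ^ 3 * (d + 1)"
  have C12: "0 \<le> C1" "0 \<le> C2" using k0 d0 M_pos by (simp_all add: C1_def C2_def)
  define C where "C = (9 * C1 * k0 powr (- s) + 3 * C2) / m"
  have C0: "0 \<le> C" using C12 m_pos by (simp add: C_def)
  show ?thesis
  proof (rule that[OF C0])
    fix \<kappa> \<xi> t :: real and P Q u u' :: "real \<Rightarrow> complex"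
    assume \<kappa>: "k0 \<le> \<bar>\<kappa>\<bar>" and t: "1 \<le> t" and \<xi>: "\<bar>\<xi>\<bar> = \<bar>\<kappa>\<bar> * t" and u: "ac u u'" "u' \<in> Hs_torus s"
     and pair: "elliptic_pair r \<kappa> P Q (\<lambda>y. cis (- \<xi> * y) * u y)"
    have \<kappa>0: "\<kappa> \<noteq> 0" "0 < \<bar>\<kappa>\<bar>" using \<kappa> k0 by auto
    have \<xi>0: "\<xi> \<noteq> 0" using \<xi> \<kappa>0 t by auto
    have FL: "(\<lambda>y. cis (- \<xi> * y) * u y) \<in> L2"
      by (rule L2_continuous) (intro continuous_intros ac_continuous[OF u(1)])
    obtain \<psi> q where \<psi>: "ac \<psi> (\<lambda>y. of_real (\<kappa> * r y) * q y)"
      and q: "ac q (\<lambda>y. of_real (\<kappa> * r y) * (\<psi> y + cnj (P y)))" and b: "\<psi> 0 = 0" "\<psi> 1 = 0"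
      and \<psi>P: "L2_norm \<psi> \<le> d * L2_norm P" and qP: "L2_norm q \<le> d * L2_norm P"
      and du: "m * (L2_norm P)\<^sup>2 \<le> cmod (int01 (\<lambda>y. (cis (- \<xi> * y) * u y) * (of_real (r y) * \<psi> y)))"
      unfolding d_def by (rule elliptic_duality[OF \<kappa>0(1) FL pair])
    define p where "p = L2_norm P"
    define K where "K = \<bar>\<kappa>\<bar>"
    define h where "h = (\<lambda>y. of_real (r y) * \<psi> y)"
    define h1 where "h1 = (\<lambda>y. r1 y * \<psi> y + of_real \<kappa> * (of_real (r y) * (of_real (r y) * q y)))"
    define h2 where "h2 = (\<lambda>y. r2 y * \<psi> y + of_real \<kappa> * (3 * (r1 y * (of_real (r y) * q y))) +
       (of_real \<kappa>)\<^sup>2 * (of_real (r y) * (of_real (r y) * (of_real (r y) * (\<psi> y + cnj (P y))))))"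
    have hac: "ac h h1" "ac h1 h2"
      unfolding h_def h1_def h2_def using weighted_dual_ac[OF \<psi> q] by auto
    have Pc: "continuous_on {0..1} P" using pair ac_continuous by (auto simp: elliptic_pair_def)
    have \<psi>L: "\<psi> \<in> L2" and qL: "q \<in> L2" and cPL: "(\<lambda>y. cnj (P y)) \<in> L2"
      using L2_continuous ac_continuous[OF \<psi>] ac_continuous[OF q] continuous_on_cnj[OF Pc] by blast+
    have p0: "0 \<le> p" by (simp add: p_def)
    note M0 = less_imp_le[OF M_pos]
    have K0: "k0 \<le> K" "0 < K" using \<kappa> \<kappa>0 by (auto simp: K_def)
    have h: "L2_norm h \<le> M * (d * p)"
      using L2_mult_r(2)[OF \<psi>L] mult_left_mono[OF \<psi>P M0] unfolding h_def p_def by linarith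
    note rq = L2_mult_r(1)[OF qL]
    note rrq = L2_mult_r(1)[OF rq]
    have nrq: "L2_norm (\<lambda>y. of_real (r y) * q y) \<le> M * (d * p)"
      using L2_mult_r(2)[OF qL] mult_left_mono[OF qP M0] unfolding p_def by linarith
    have nrrq: "L2_norm (\<lambda>y. of_real (r y) * (of_real (r y) * q y)) \<le> M * (M * (d * p))"
      using L2_mult_r(2)[OF rq] mult_left_mono[OF nrq M0] by linarith
    have nr1rq: "L2_norm (\<lambda>y. r1 y * (of_real (r y) * q y)) \<le> M * (M * (d * p))"
      using L2_mult_r(4)[OF rq] mult_left_mono[OF nrq M0] by linarith
    have nr1\<psi>: "L2_norm (\<lambda>y. r1 y * \<psi> y) \<le> M * (d * p)"
      using L2_mult_r(4)[OF \<psi>L] mult_left_mono[OF \<psi>P M0] unfolding p_def by linarith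
    have nr2\<psi>: "L2_norm (\<lambda>y. r2 y * \<psi> y) \<le> M * (d * p)"
      using L2_mult_r(6)[OF \<psi>L] mult_left_mono[OF \<psi>P M0] unfolding p_def by linarith
    have h1: "L2_norm h1 \<le> M * (d * p) + K * (M * (M * (d * p)))"
    proof -
      have "L2_norm h1 \<le> L2_norm (\<lambda>y. r1 y * \<psi> y) + L2_norm (\<lambda>y. of_real \<kappa> * (of_real (r y) * (of_real (r y) * q y)))"
        unfolding h1_def by (rule L2_add[OF L2_mult_r(3)[OF \<psi>L] L2_cmult(1)[OF rrq]])
      also have "\<dots> \<le> M * (d * p) + K * (M * (M * (d * p)))"
        unfolding L2_cmult(2)[OF rrq] using nr1\<psi> nrrq K0
        by (intro add_mono mult_mono) (auto simp: K_def)
      finally show ?thesis .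
    qed
    define z where "z = (\<lambda>y. \<psi> y + cnj (P y))"
    have zL: "z \<in> L2" "L2_norm z \<le> (d + 1) * p"
    proof -
      show "z \<in> L2" unfolding z_def by (rule L2_add[OF \<psi>L cPL])
      have "L2_norm z \<le> L2_norm \<psi> + L2_norm (\<lambda>y. cnj (P y))" unfolding z_def by (rule L2_add[OF \<psi>L cPL])
      moreover have "L2_norm (\<lambda>y. cnj (P y)) = p" by (simp add: L2_norm_def p_def)
      ultimately show "L2_norm z \<le> (d + 1) * p" using \<psi>P unfolding p_def[symmetric] by (simp add: algebra_simps)
    qed
    note rz = L2_mult_r(1)[OF zL(1)]
    note rrz = L2_mult_r(1)[OF rz]
    note rrrz = L2_mult_r(1)[OF rrz]
    have nz1: "L2_norm (\<lambda>y. of_real (r y) * z y) \<le> M * ((d + 1) * p)"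
      using L2_mult_r(2)[OF zL(1)] mult_left_mono[OF zL(2) M0] by linarith
    have nz2: "L2_norm (\<lambda>y. of_real (r y) * (of_real (r y) * z y)) \<le> M * (M * ((d + 1) * p))"
      using L2_mult_r(2)[OF rz] mult_left_mono[OF nz1 M0] by linarith
    have nz3: "L2_norm (\<lambda>y. of_real (r y) * (of_real (r y) * (of_real (r y) * z y))) \<le> M * (M * (M * ((d + 1) * p)))"
      using L2_mult_r(2)[OF rrz] mult_left_mono[OF nz2 M0] by linarith
    note r1rq = L2_mult_r(3)[OF rq]
    note r1rq3 = L2_cmult(1)[OF r1rq, of 3]
    have h2e: "h2 = (\<lambda>y. (r2 y * \<psi> y + of_real \<kappa> * (3 * (r1 y * (of_real (r y) * q y)))) +
       (of_real \<kappa>)\<^sup>2 * (of_real (r y) * (of_real (r y) * (of_real (r y) * z y))))"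
      by (simp add: h2_def z_def)
    note A1 = L2_add[OF L2_mult_r(5)[OF \<psi>L] L2_cmult(1)[OF r1rq3, of "of_real \<kappa>"]]
    note A2 = L2_add[OF A1(1) L2_cmult(1)[OF rrrz, of "(of_real \<kappa>)\<^sup>2"]]
    have h2L: "h2 \<in> L2" unfolding h2e by (rule A2(1))
    have h2: "L2_norm h2 \<le> M * (d * p) + K * (3 * (M * (M * (d * p)))) + K\<^sup>2 * (M * (M * (M * ((d + 1) * p))))"
    proof -
      have "L2_norm h2 \<le> (L2_norm (\<lambda>y. r2 y * \<psi> y) + K * (3 * L2_norm (\<lambda>y. r1 y * (of_real (r y) * q y)))) +
         K\<^sup>2 * L2_norm (\<lambda>y. of_real (r y) * (of_real (r y) * (of_real (r y) * z y)))"
        using A1(2) A2(2) unfolding h2e L2_cmult(2)[OF r1rq3] L2_cmult(2)[OF r1rq] L2_cmult(2)[OF rrrz]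
        by (simp add: K_def norm_power)
      also have "\<dots> \<le> M * (d * p) + K * (3 * (M * (M * (d * p)))) + K\<^sup>2 * (M * (M * (M * ((d + 1) * p))))"
        using nr2\<psi> nr1rq nz3 K0 by (intro add_mono mult_left_mono) auto
      finally show ?thesis .
    qed
    have kk: "1 \<le> K / k0" using K0 k0 by simp
    have sum1: "L2_norm h + L2_norm h1 \<le> C1 * K * p"
    proof -
      have "M * d * p * 1 \<le> M * d * p * (K / k0)"
        using kk M_pos d0 p0 by (intro mult_left_mono) auto
      then have "M * d * p \<le> M * d * p * (K / k0)" by simp
      moreover have "C1 * K * p = 2 * (M * d * p * (K / k0)) + K * (M * (M * (d * p)))"
        by (simp add: C1_def field_simps power2_eq_square)
      ultimately show ?thesis using h h1 by (simp add: mult.assoc)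
    qed
    have sum2: "L2_norm h1 + L2_norm h2 \<le> C2 * K\<^sup>2 * p"
    proof -
      have "M * d * p * 1 \<le> M * d * p * (K / k0)\<^sup>2"
        using kk M_pos d0 p0 by (intro mult_left_mono one_le_power) auto
      then have 1: "M * d * p \<le> M * d * p * (K / k0)\<^sup>2" by simp
      have "K * (M * (M * (d * p))) * 1 \<le> K * (M * (M * (d * p))) * (K / k0)"
        using kk M_pos d0 p0 K0 by (intro mult_left_mono) auto
      then have 2: "K * (M * (M * (d * p))) \<le> K * (M * (M * (d * p))) * (K / k0)" by simp
      have "C2 * K\<^sup>2 * p = 2 * (M * d * p * (K / k0)\<^sup>2) + 4 * (K * (M * (M * (d * p))) * (K / k0)) +
          K\<^sup>2 * (M * (M * (M * ((d + 1) * p))))"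
        using k0 by (simp add: C2_def field_simps power2_eq_square power3_eq_cube)
      then show ?thesis using h1 h2 1 2 by (simp add: mult.assoc)
    qed
    have hb: "h 0 = 0" "h 1 = 0" using b by (simp_all add: h_def)
    define I where "I = cmod (int01 (\<lambda>y. cis (- \<xi> * y) * (u y * h y)))"
    define a where "a = Hs_torus_norm s u'"
    define n where "n = L2_norm u + L2_norm u'"
    have an: "0 \<le> a" "0 \<le> n" by (simp_all add: a_def n_def)
    have ib: "\<bar>\<xi>\<bar> * I \<le> 9 * a * \<bar>\<xi>\<bar> powr (- s) * (L2_norm h + L2_norm h1) + 3 * n * (L2_norm h1 + L2_norm h2) / \<bar>\<xi>\<bar>"
      unfolding I_def a_def n_def
      by (rule oscillatory_double_by_parts[OF s \<xi>0 u hac h2L hb])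
    have \<xi>K: "\<bar>\<xi>\<bar> = K * t" using \<xi> by (simp add: K_def)
    have Kt: "0 < K * t" using K0 t by simp
    have ps: "(K * t) powr (- s) \<le> k0 powr (- s) * t powr (- s)"
    proof -
      have "(K * t) powr (- s) = K powr (- s) * t powr (- s)" using K0 t by (simp add: powr_mult)
      also have "\<dots> \<le> k0 powr (- s) * t powr (- s)"
        using powr_mono2'[of "-s" k0 K] s K0 k0 by (intro mult_right_mono) auto
      finally show ?thesis .
    qed
    have "K * t * I \<le> 9 * a * (K * t) powr (- s) * (C1 * K * p) + 3 * n * (C2 * K\<^sup>2 * p) / (K * t)"
    proof -
      have "9 * a * (K * t) powr (- s) * (L2_norm h + L2_norm h1) \<le> 9 * a * (K * t) powr (- s) * (C1 * K * p)"
        using sum1 an by (intro mult_left_mono) auto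
      moreover have "3 * n * (L2_norm h1 + L2_norm h2) / (K * t) \<le> 3 * n * (C2 * K\<^sup>2 * p) / (K * t)"
        using sum2 an Kt by (intro divide_right_mono mult_left_mono) auto
      ultimately show ?thesis using ib unfolding \<xi>K by linarith
    qed
    also have "\<dots> = K * t * ((9 * C1 * a * (K * t) powr (- s) / t + 3 * C2 * n / t\<^sup>2) * p)"
      using K0 t by (simp add: field_simps power2_eq_square)
    finally have I1: "I \<le> (9 * C1 * a * (K * t) powr (- s) / t + 3 * C2 * n / t\<^sup>2) * p"
      using Kt mult_le_cancel_left_pos by blast
    define T where "T = t powr (- (1 + s))"
    have T1: "(K * t) powr (- s) / t \<le> k0 powr (- s) * T"
    proof -
      have "t powr (- s) / t = T" using t by (simp add: T_def powr_diff powr_minus_divide powr_add)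
      moreover have "k0 powr (- s) * t powr (- s) / t = k0 powr (- s) * (t powr (- s) / t)" by simp
      ultimately show ?thesis using divide_right_mono[OF ps, of t] t by simp
    qed
    \<comment> \<open>The part coming from the second integration by parts decays like t^(-2); s <=
      1 and t >= 1 make this at most T.\<close>
    have T2: "1 / t\<^sup>2 \<le> T"
    proof -
      have "1 / t\<^sup>2 = t powr (- 2)" using t by (simp add: powr_minus_divide)
      also have "\<dots> \<le> T" unfolding T_def using s t by (intro powr_mono) auto
      finally show ?thesis .
    qed
    have T0: "0 \<le> T" by (simp add: T_def)
    have "m * p\<^sup>2 \<le> I"
      using du unfolding p_def I_def h_def by (simp add: mult.assoc)
    also note I1
    also have "(9 * C1 * a * (K * t) powr (- s) / t + 3 * C2 * n / t\<^sup>2) * p \<le> (m * C * T * (a + n)) * p"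
    proof (rule mult_right_mono[OF _ p0])
      have "9 * C1 * a * ((K * t) powr (- s) / t) \<le> 9 * C1 * a * (k0 powr (- s) * T)"
        using T1 C12 an by (intro mult_left_mono) auto
      moreover have "3 * C2 * n * (1 / t\<^sup>2) \<le> 3 * C2 * n * T"
        using T2 C12 an by (intro mult_left_mono) auto
      moreover have "m * C * T * (a + n) = 9 * C1 * k0 powr (- s) * T * a + 9 * C1 * k0 powr (- s) * T * n + 3 * C2 * T * a + 3 * C2 * T * n"
        using m_pos by (simp add: C_def field_simps)
      moreover have "0 \<le> 9 * C1 * k0 powr (- s) * T * n" "0 \<le> 3 * C2 * T * a"
        using C12 T0 an by auto
      ultimately show "9 * C1 * a * (K * t) powr (- s) / t + 3 * C2 * n / t\<^sup>2 \<le> m * C * T * (a + n)"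
        by (simp add: mult_ac)
    qed
    \<comment> \<open>The dual function is itself bounded by p, so both sides carry a factor p,
      which cancels.\<close>
    finally have "p * (m * p) \<le> p * (m * (C * T * (a + n)))"
      by (simp add: power2_eq_square mult_ac)
    then have "p \<le> C * T * (a + n)"
      using p0 m_pos C0 T0 an by (cases "p = 0") (auto simp: mult_le_cancel_left_pos)
    then show "L2_norm P \<le> C * t powr (- (1 + s)) * (Hs_torus_norm s u' + (L2_norm u + L2_norm u'))"
      by (simp add: p_def T_def a_def n_def)
  qed
qed

end

subsection \<open>The shear profile and the elliptic equation of a mode\<close>

lemma H1_weak_deriv: "u \<in> H1 \<Longrightarrow> has_weak_deriv interval_tests u (wderiv u)"
  unfolding H1_def wderiv_def using someI_ex[of "has_weak_deriv interval_tests u"] by auto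

lemma H1_ac_representative:
  assumes "u \<in> H1"
  obtains v where "ac v (wderiv u)" "AE y in leb01. u y = v y"
proof -
  note w = H1_weak_deriv[OF assms]
  then have "integrable leb01 (wderiv u)" by (simp add: has_weak_deriv_def)
  then show ?thesis using weak_deriv_imp_ac[OF w] that ac_prim by metis
qed

text \<open>Differentiating \<open>g = U' \<circ> U\<^sup>-\<^sup>1\<close> directly, as a quotient of difference quotients, avoids the
  derivative of \<open>U\<^sup>-\<^sup>1\<close>.\<close>

lemma profile_derivative:
  fixes U U' U'' f g :: "real \<Rightarrow> real"
  assumes mono: "strict_mono_on {a..b} U \<or> strict_antimono_on {a..b} U"
    and im: "U ` {a..b} = {0..1}"
    and U: "\<And>z. z \<in> {a..b} \<Longrightarrow> (U has_real_derivative U' z) (at z within {a..b})"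
    and U': "\<And>z. z \<in> {a..b} \<Longrightarrow> (U' has_real_derivative U'' z) (at z within {a..b})"
    and f: "\<And>y. y \<in> {0..1} \<Longrightarrow> f y = U'' (inv_into {a..b} U y)"
    and g: "\<And>y. y \<in> {0..1} \<Longrightarrow> g y = U' (inv_into {a..b} U y)"
    and y: "y \<in> {0..1}" and nz: "g y \<noteq> 0"
  shows "(g has_real_derivative f y / g y) (at y within {0..1})"
proof -
  define V where "V = inv_into {a..b} U"
  have inj: "inj_on U {a..b}"
    using mono
  proof
    assume "strict_mono_on {a..b} U"
    then show ?thesis by (rule strict_mono_on_imp_inj_on)
  next
    assume m: "strict_antimono_on {a..b} U"
    show ?thesis
    proof (rule inj_onI)
      fix x z assume xz: "x \<in> {a..b}" "z \<in> {a..b}" "U x = U z"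
      then show "x = z"
        using m by (metis (full_types) linorder_neqE monotone_onD order_less_irrefl)
    qed
  qed
  have Uc: "continuous_on {a..b} U" by (rule DERIV_continuous_on[OF U])
  have Vc: "continuous_on {0..1} V"
    using continuous_on_inv[OF Uc compact_Icc, of V] inv_into_f_f[OF inj] by (simp add: im V_def)
  have Vin: "V z \<in> {a..b}" "U (V z) = z" if "z \<in> {0..1}" for z
    unfolding V_def using that im by (auto intro: inv_into_into f_inv_into_f) (metis atLeastAtMost_iff inv_into_into)+
  have Vne: "V z \<noteq> V y" if "z \<in> {0..1}" "z \<noteq> y" for z
    using Vin(2)[OF that(1)] Vin(2)[OF y] that(2) by metis
  \<comment> \<open>V z tends to V y without taking the value V y, so the difference quotients of U
    and U' at V y may be composed with V, also at the end points.\<close>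
  have lim: "filterlim V (at (V y) within {a..b}) (at y within {0..1})"
    unfolding filterlim_at
  proof
    show "\<forall>\<^sub>F z in at y within {0..1}. V z \<in> {a..b} \<and> V z \<noteq> V y"
      unfolding eventually_at_filter using Vin Vne by (intro always_eventually) auto
    show "(V \<longlongrightarrow> V y) (at y within {0..1})" using Vc y by (simp add: continuous_on_def)
  qed
  have q1: "((\<lambda>z. (U (V z) - U (V y)) / (V z - V y)) \<longlongrightarrow> U' (V y)) (at y within {0..1})"
    using filterlim_compose[OF _ lim] U[OF Vin(1)[OF y]] unfolding has_field_derivative_iff by blast
  have q2: "((\<lambda>z. (U' (V z) - U' (V y)) / (V z - V y)) \<longlongrightarrow> U'' (V y)) (at y within {0..1})"
    using filterlim_compose[OF _ lim] U'[OF Vin(1)[OF y]] unfolding has_field_derivative_iff by blast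
  have gV: "g z = U' (V z)" "f z = U'' (V z)" if "z \<in> {0..1}" for z
    using f[OF that] g[OF that] by (simp_all add: V_def)
  have "((\<lambda>z. ((U' (V z) - U' (V y)) / (V z - V y)) / ((U (V z) - U (V y)) / (V z - V y))) \<longlongrightarrow> f y / g y) (at y within {0..1})"
    using tendsto_divide[OF q2 q1] nz gV[OF y] by simp
  moreover have "\<forall>\<^sub>F z in at y within {0..1}. ((U' (V z) - U' (V y)) / (V z - V y)) / ((U (V z) - U (V y)) / (V z - V y)) =
     (g z - g y) / (z - y)"
    unfolding eventually_at_filter
  proof (intro always_eventually allI impI)
    fix z assume z: "z \<noteq> y" "z \<in> {0..1}"
    have "V z - V y \<noteq> 0" using Vne z by simp
    then show "((U' (V z) - U' (V y)) / (V z - V y)) / ((U (V z) - U (V y)) / (V z - V y)) =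
        (g z - g y) / (z - y)"
      using Vin(2)[OF z(2)] Vin(2)[OF y] gV(1)[OF z(2)] gV(1)[OF y] by simp
  qed
  ultimately show ?thesis
    unfolding has_field_derivative_iff using tendsto_cong by force
qed

section \<open>The weight 1/|g| of the shear profile\<close>

lemma Linf_bound: "f \<in> Linf \<Longrightarrow> \<exists>B>0. AE y in leb01. \<bar>f y\<bar> \<le> B"
proof -
  assume "f \<in> Linf"
  then obtain B where "AE y in leb01. \<bar>f y\<bar> \<le> B" by (auto simp: Linf_def)
  then have "AE y in leb01. \<bar>f y\<bar> \<le> max B 1" by eventually_elim simp
  then show ?thesis by (intro exI[of _ "max B 1"]) simp
qed

lemma Linf_integrable:
  assumes "f \<in> Linf" shows "integrable leb01 (\<lambda>y. complex_of_real (f y))"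
proof -
  obtain B where B: "AE y in leb01. \<bar>f y\<bar> \<le> B" using Linf_bound[OF assms] by blast
  have [measurable]: "f \<in> borel_measurable leb01" using assms by (simp add: Linf_def)
  have m: "(\<lambda>y. complex_of_real (f y)) \<in> borel_measurable leb01"
    by measurable
  show ?thesis
    by (rule leb01.integrable_const_bound[OF _ m]) (use B in auto)
qed

text \<open>From g' = f/g follows (1/|g|)' = -f/|g|^3, so the weight has one derivative more than f.
  Before the second differentiation f is replaced by its absolutely continuous representative F,
  whose derivative f' is bounded by hypothesis.\<close>

lemma profile_shear_weight:
  fixes f g :: "real \<Rightarrow> real"
  assumes f: "f \<in> W2inf_torus" and c: "c > 0" "\<And>y. y \<in> {0..1} \<Longrightarrow> (g y)\<^sup>2 > c"
    and d: "\<And>y. y \<in> {0..1} \<Longrightarrow> (g has_real_derivative f y / g y) (at y within {0..1})"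
  obtains \<sigma> r r1 r2 m M where "\<sigma> = 1 \<or> \<sigma> = -1" "\<And>y. y \<in> {0..1} \<Longrightarrow> 1 / g y = \<sigma> * r y"
    "shear_weight r r1 r2 m M"
proof -
  have nz: "g y \<noteq> 0" if "y \<in> {0..1}" for y using c(2)[OF that] c(1) by auto
  have gc: "continuous_on {0..1} g" by (rule DERIV_continuous_on[OF d])
  \<comment> \<open>g is continuous without zeros, so it keeps the sign of g 0. The factor \<sigma>
    makes the weight positive; the sign is later moved into the frequency.\<close>
  define \<sigma> where "\<sigma> = sgn (g 0)"
  have \<sigma>: "\<sigma> = 1 \<or> \<sigma> = -1" using nz[of 0] by (auto simp: \<sigma>_def sgn_if)
  have pos: "\<sigma> * g y > 0" if y: "y \<in> {0..1}" for y
  proof (rule ccontr)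
    assume "\<not> \<sigma> * g y > 0"
    moreover have "\<sigma> * g 0 > 0" using nz[of 0] by (auto simp: \<sigma>_def sgn_if)
    moreover have "continuous_on {0..y} (\<lambda>y. \<sigma> * g y)"
      using y by (intro continuous_intros continuous_on_subset[OF gc]) auto
    ultimately obtain x where "0 \<le> x" "x \<le> y" "\<sigma> * g x = 0"
      using IVT2'[of "\<lambda>y. \<sigma> * g y" y 0 0] y by auto
    then show False using nz[of x] \<sigma> y by auto
  qed
  define r where "r = (\<lambda>y. \<sigma> / g y)"
  have rg: "r y = 1 / \<bar>g y\<bar>" if "y \<in> {0..1}" for y
    using pos[OF that] \<sigma> by (auto simp: r_def abs_if)
  obtain G where G: "G > 0" "\<And>y. y \<in> {0..1} \<Longrightarrow> \<bar>g y\<bar> \<le> G"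
    using continuous_bounded_01[OF gc] by auto
  obtain f' where f': "f \<in> Linf" "f' \<in> Linf" "has_weak_deriv torus_tests f f'"
    using f by (auto simp: W2inf_torus_def)
  obtain c0 where c0: "AE y in leb01. of_real (f y) = c0 + prim (\<lambda>y. of_real (f' y)) y"
    using torus_weak_deriv_imp_ac[OF f'(3)] by blast
  define F where "F = (\<lambda>y. c0 + prim (\<lambda>y. of_real (f' y)) y)"
  have Fac: "ac F (\<lambda>y. of_real (f' y))"
    unfolding F_def by (rule ac_prim[OF Linf_integrable[OF f'(2)]])
  have Fae: "AE y in leb01. of_real (f y) = F y" using c0 by (simp add: F_def)
  define \<rho> where "\<rho> = (\<lambda>y. complex_of_real (r y))"
  have rc: "continuous_on {0..1} r" unfolding r_def by (intro continuous_intros gc) (use nz in auto)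
  have \<rho>c: "continuous_on {0..1} \<rho>" unfolding \<rho>_def by (intro continuous_intros rc)
  define r1 where "r1 = (\<lambda>y. - 1 * (F y * (\<rho> y * (\<rho> y * \<rho> y))))"
  have r1c: "continuous_on {0..1} r1" unfolding r1_def by (intro continuous_intros ac_continuous[OF Fac] \<rho>c)
  have r\<rho>: "ac \<rho> r1"
  proof (rule ac_cong)
    show "ac \<rho> (\<lambda>y. complex_of_real (f y) * (- 1 * (\<rho> y * (\<rho> y * \<rho> y))))"
    proof (rule ac_of_deriv)
      show "integrable leb01 (\<lambda>y. complex_of_real (f y) * (- 1 * (\<rho> y * (\<rho> y * \<rho> y))))"
        by (rule integrable_mult_continuous(1)[OF Linf_integrable[OF f'(1)]]) (intro continuous_intros \<rho>c)
      fix y :: real assume y: "y \<in> {0..1}"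
      have "(r has_real_derivative f y * (- 1 * (r y * (r y * r y)))) (at y within {0..1})"
        unfolding r_def using \<sigma> nz[OF y]
        by (auto intro!: derivative_eq_intros d[OF y] simp: field_simps)
      then have "((\<lambda>y. complex_of_real (r y)) has_vector_derivative of_real (f y * (- 1 * (r y * (r y * r y))))) (at y within {0..1})"
        by (rule has_vector_derivative_of_real)
      then show "(\<rho> has_vector_derivative complex_of_real (f y) * (- 1 * (\<rho> y * (\<rho> y * \<rho> y)))) (at y within {0..1})"
        by (simp add: \<rho>_def)
    qed
    show "integrable leb01 r1" by (rule integrable_continuous_leb01[OF r1c])
    show "AE y in leb01. complex_of_real (f y) * (- 1 * (\<rho> y * (\<rho> y * \<rho> y))) = r1 y"
      using Fae by eventually_elim (simp add: r1_def)
  qed simp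
  define r2 where "r2 = (\<lambda>y. - 1 * (of_real (f' y) * (\<rho> y * (\<rho> y * \<rho> y)) +
     F y * (r1 y * (\<rho> y * \<rho> y) + \<rho> y * (r1 y * \<rho> y + \<rho> y * r1 y))))"
  have r12: "ac r1 r2"
    unfolding r1_def r2_def by (intro ac_cmult ac_mult Fac r\<rho>[unfolded r1_def])
  obtain B where B: "AE y in leb01. \<bar>f' y\<bar> \<le> B" "B > 0" using Linf_bound[OF f'(2)] by blast
  obtain B1 where B1: "\<And>y. y \<in> {0..1} \<Longrightarrow> cmod (r1 y) \<le> B1" "B1 > 0"
    using continuous_bounded_01[OF r1c] by blast
  obtain B3 where B3: "\<And>y. y \<in> {0..1} \<Longrightarrow> cmod (\<rho> y * (\<rho> y * \<rho> y)) \<le> B3" "B3 > 0"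
    by (rule continuous_bounded_01[of "\<lambda>y. \<rho> y * (\<rho> y * \<rho> y)"]) (intro continuous_intros \<rho>c, blast)
  define z where "z = (\<lambda>y. F y * (r1 y * (\<rho> y * \<rho> y) + \<rho> y * (r1 y * \<rho> y + \<rho> y * r1 y)))"
  have zc: "continuous_on {0..1} z"
    unfolding z_def by (intro continuous_intros ac_continuous[OF Fac] \<rho>c r1c)
  obtain B4 where B4: "\<And>y. y \<in> {0..1} \<Longrightarrow> cmod (z y) \<le> B4" "B4 > 0"
    using continuous_bounded_01[OF zc] by blast
  define M where "M = 1 / sqrt c + B1 + (B * B3 + B4)"
  have M: "1 / sqrt c \<le> M" "B1 \<le> M" "B * B3 + B4 \<le> M"
    using c(1) B B1 B3 B4 by (auto simp: M_def add_nonneg_nonneg)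
  show ?thesis
  proof (rule that[OF \<sigma>])
    show "1 / g y = \<sigma> * r y" if "y \<in> {0..1}" for y using \<sigma> by (auto simp: r_def)
    show "shear_weight r r1 r2 (1 / G) M"
    proof
      show "0 < 1 / G" using G by simp
      show "1 / G \<le> r y" if "y \<in> {0..1}" for y
        using G(2)[OF that] nz[OF that] G(1) by (simp add: rg[OF that] frac_le)
      show "r y \<le> M" if y: "y \<in> {0..1}" for y
      proof -
        have "sqrt c \<le> \<bar>g y\<bar>" using c(2)[OF y] by (simp add: real_le_lsqrt less_imp_le flip: real_sqrt_abs)
        then have "r y \<le> 1 / sqrt c" using c(1) by (simp add: rg[OF y] frac_le)
        then show ?thesis using M by simp
      qed
      show "ac (\<lambda>y. complex_of_real (r y)) r1" using r\<rho> by (simp add: \<rho>_def)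
      show "ac r1 r2" by (rule r12)
      show "cmod (r1 y) \<le> M" if "y \<in> {0..1}" for y using B1(1)[OF that] M by simp
      show "AE y in leb01. cmod (r2 y) \<le> M"
        using B(1) AE_space
      proof eventually_elim
        case (elim y)
        then have y: "y \<in> {0..1}" by simp
        have "cmod (r2 y) = cmod (of_real (f' y) * (\<rho> y * (\<rho> y * \<rho> y)) + z y)"
          unfolding r2_def z_def norm_mult[of "-1"] by simp
        also have "\<dots> \<le> cmod (of_real (f' y) * (\<rho> y * (\<rho> y * \<rho> y))) + cmod (z y)"
          by (rule norm_triangle_ineq)
        also have "\<dots> \<le> B * B3 + B4"
          unfolding norm_mult[of "of_real (f' y)"] using elim(1) B(2) B3(1)[OF y] B4(1)[OF y]
          by (intro add_mono mult_mono) auto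
        finally show ?case using M by simp
      qed
    qed
  qed
qed

text \<open>Multiplying by \<open>e\<^sup>-\<^sup>i\<^sup>k\<^sup>t\<^sup>y\<close> turns \<open>\<partial>\<^sub>y - ikt\<close> into \<open>\<partial>\<^sub>y\<close>; \<open>Q\<close> is the conjugated \<open>shear_deriv g t k \<Phi>\<close>.\<close>

lemma mode_elliptic_reduction:
  fixes g :: "real \<Rightarrow> real"
  assumes g: "\<And>y. y \<in> {0..1} \<Longrightarrow> 1 / g y = \<sigma> * r y" "\<And>y. y \<in> {0..1} \<Longrightarrow> g y \<noteq> 0"
    and k: "k \<noteq> 0"
    and \<Phi>: "\<Phi> \<in> H1_dirichlet" and \<Psi>: "shear_deriv g t k \<Phi> \<in> H1"
    and eq: "AE y in leb01. - \<Phi> y + shear_deriv g t k (shear_deriv g t k \<Phi>) y = w y"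
  obtains P Q where "elliptic_pair r (\<sigma> * k) P Q (\<lambda>y. cis (- (k * t) * y) * w y)"
     "L2_norm P = L2_norm \<Phi>" "\<Phi> \<in> L2"
proof -
  define \<xi> where "\<xi> = k * t"
  define E where "E = (\<lambda>y. cis (- \<xi> * y))"
  define G where "G = (\<lambda>y. \<sigma> * k * r y)"
  have E: "ac E (\<lambda>y. \<i> * of_real (- \<xi>) * E y)" unfolding E_def by (rule ac_cis)
  \<comment> \<open>G y * g y = k clears all denominators: multiplied by G, the shear derivative
    becomes \<partial>_y - i \<xi>.\<close>
  have G: "complex_of_real (G y) * (of_real (g y) * (z / of_real k - \<i> * of_real t * v)) = z - \<i> * of_real \<xi> * v"
    if y: "y \<in> {0..1}" for y z v
  proof -
    have "G y * g y = k" using g(1)[OF y] g(2)[OF y] unfolding G_def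
      by (metis (no_types, lifting) divide_self_if mult.assoc mult.commute mult_cancel_left1 times_divide_eq_left)
    then have "complex_of_real (G y) * of_real (g y) = of_real k" by (metis of_real_mult)
    then have "complex_of_real (G y) * (of_real (g y) * (z / of_real k - \<i> * of_real t * v)) = of_real k * (z / of_real k - \<i> * of_real t * v)"
      by (simp flip: mult.assoc)
    then show ?thesis using k by (simp add: \<xi>_def algebra_simps)
  qed
  have \<Phi>H: "\<Phi> \<in> H1" and \<Phi>L: "\<Phi> \<in> L2" using \<Phi> by (auto simp: H1_dirichlet_def H1_def)
  obtain p where p: "ac p (wderiv \<Phi>)" "AE y in leb01. \<Phi> y = p y"
    using H1_ac_representative[OF \<Phi>H] by blast
  define \<Psi>0 where "\<Psi>0 = shear_deriv g t k \<Phi>"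
  obtain q where q: "ac q (wderiv \<Psi>0)" "AE y in leb01. \<Psi>0 y = q y"
    using H1_ac_representative[OF \<Psi>] unfolding \<Psi>0_def by blast
  obtain v where v: "continuous_on {0..1} v" "AE y in leb01. \<Phi> y = v y" "v 0 = 0" "v 1 = 0"
    using \<Phi> by (auto simp: H1_dirichlet_def)
  have "AE y in leb01. p y = v y" using p(2) v(2) by eventually_elim simp
  \<comment> \<open>The absolutely continuous and the continuous representative of \<Phi> agree on
    the closed interval, so P inherits the boundary values 0.\<close>
  then have pv: "p y = v y" if "y \<in> {0..1}" for y
    by (rule AE_eq_imp_eq_on[OF ac_continuous[OF p(1)] v(1) _ that])
  define P where "P = (\<lambda>y. E y * p y)"
  define P' where "P' = (\<lambda>y. \<i> * of_real (- \<xi>) * E y * p y + E y * wderiv \<Phi> y)"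
  define Q where "Q = (\<lambda>y. E y * q y)"
  define Q' where "Q' = (\<lambda>y. \<i> * of_real (- \<xi>) * E y * q y + E y * wderiv \<Psi>0 y)"
  have acP: "ac P P'" unfolding P_def P'_def by (rule ac_mult[OF E p(1)])
  have acQ: "ac Q Q'" unfolding Q_def Q'_def by (rule ac_mult[OF E q(1)])
  have aeP: "AE y in leb01. P' y = of_real (\<sigma> * k * r y) * Q y"
      using p(2) q(2) AE_space
    proof eventually_elim
      case (elim y)
      then have y: "y \<in> {0..1}" by simp
      have "of_real (G y) * q y = wderiv \<Phi> y - \<i> * of_real \<xi> * p y"
        using G[OF y, of "wderiv \<Phi> y" "\<Phi> y"] elim unfolding \<Psi>0_def shear_deriv_def by metis
      then have "of_real (G y) * Q y = E y * (wderiv \<Phi> y - \<i> * of_real \<xi> * p y)"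
        unfolding Q_def by (metis mult.left_commute)
      then show ?case unfolding G_def[symmetric] P'_def by (simp add: algebra_simps G_def)
    qed
  have aeQ: "AE y in leb01. Q' y = of_real (\<sigma> * k * r y) * (P y + cis (- (k * t) * y) * w y)"
      using p(2) q(2) eq AE_space
    proof eventually_elim
      case (elim y)
      then have y: "y \<in> {0..1}" by simp
      have "shear_deriv g t k \<Psi>0 y = w y + p y"
        using elim unfolding \<Psi>0_def by (simp add: algebra_simps)
      then have "of_real (G y) * (w y + p y) = wderiv \<Psi>0 y - \<i> * of_real \<xi> * q y"
        using G[OF y, of "wderiv \<Psi>0 y" "\<Psi>0 y"] elim(2) unfolding shear_deriv_def by metis
      then have "of_real (G y) * (E y * (w y + p y)) = E y * (wderiv \<Psi>0 y - \<i> * of_real \<xi> * q y)"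
        by (metis mult.left_commute)
      then show ?case
        unfolding Q'_def P_def G_def E_def \<xi>_def by (simp add: algebra_simps)
    qed
  have "P 0 = 0" "P 1 = 0" using pv[of 0] pv[of 1] v by (simp_all add: P_def)
  then have "elliptic_pair r (\<sigma> * k) P Q (\<lambda>y. cis (- (k * t) * y) * w y)"
    unfolding elliptic_pair_def using acP aeP acQ aeQ by blast
  moreover have "L2_norm P = L2_norm p" by (simp add: P_def E_def L2_norm_def norm_mult)
  moreover have "L2_norm p = L2_norm \<Phi>"
    by (rule L2_cong_AE(2)[OF \<Phi>L continuous_measurable_leb01[OF ac_continuous[OF p(1)]] p(2)])
  ultimately show ?thesis using that \<Phi>L by simp
qed

subsection \<open>Limits in time\<close>

lemma fourier_coeff_le_L2:
  assumes "u \<in> L2" shows "cmod (fourier_coeff u n) \<le> L2_norm u"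
proof -
  have "cmod (fourier_coeff u n) \<le> int01 (\<lambda>y. cmod (u y * efun (- n) y))"
    unfolding fourier_coeff_efun by (rule integral_norm_bound)
  then show ?thesis using L1_le_L2[OF assms] by (simp add: norm_mult)
qed

lemma fourier_coeff_cong_AE:
  assumes "u \<in> L2" "v \<in> L2" "AE y in leb01. u y = v y"
  shows "fourier_coeff u n = fourier_coeff v n"
  unfolding fourier_coeff_efun
  using integrable_mult_efun[OF L2_integrable[OF assms(1)]] integrable_mult_efun[OF L2_integrable[OF assms(2)]]
  by (intro integral_cong_AE borel_measurable_integrable) (use assms(3) in auto)

text \<open>Without periodicity, integration by parts leaves the jump v 1 - v 0. Both the jump and
  the coefficient of v' are at most the L^2 norm of v', and 2/(2 pi) < 1 absorbs the two
  contributions.\<close>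

lemma fourier_coeff_ac_le:
  assumes v: "ac v v'" "v' \<in> L2" and n: "n \<noteq> 0"
  shows "cmod (fourier_coeff v n) \<le> L2_norm v' / \<bar>of_int n\<bar>"
proof -
  have i1: "integrable leb01 (\<lambda>y. v' y * efun (-n) y)"
    by (rule integrable_mult_efun[OF ac_integrable[OF v(1)]])
  have i2: "integrable leb01 (\<lambda>y. v y * efun (-n) y)"
    by (rule integrable_mult_efun[OF integrable_continuous_leb01[OF ac_continuous[OF v(1)]]])
  have "int01 (\<lambda>y. v' y * efun (-n) y + v y * (2 * pi * \<i> * of_int (-n) * efun (-n) y)) = v 1 - v 0"
    using ac_integral[OF ac_mult[OF v(1) ac_efun[of "-n"]]] by simp
  also have "(\<lambda>y. v' y * efun (-n) y + v y * (2 * pi * \<i> * of_int (-n) * efun (-n) y)) =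
    (\<lambda>y. v' y * efun (-n) y - (2 * pi * \<i> * of_int n) * (v y * efun (-n) y))"
    by (auto simp: algebra_simps)
  finally have "fourier_coeff v' n - (2 * pi * \<i> * of_int n) * fourier_coeff v n = v 1 - v 0"
    using i1 i2 by (simp add: fourier_coeff_efun)
  then have e: "(2 * pi * \<i> * of_int n) * fourier_coeff v n = fourier_coeff v' n - (v 1 - v 0)"
    by (simp add: algebra_simps)
  have "cmod (v 1 - v 0) \<le> L2_norm v'"
  proof -
    have "cmod (v 1 - v 0) \<le> int01 (\<lambda>y. cmod (v' y))"
      unfolding ac_integral[OF v(1), symmetric] by (rule integral_norm_bound)
    then show ?thesis using L1_le_L2[OF v(2)] by simp
  qed
  then have "cmod ((2 * pi * \<i> * of_int n) * fourier_coeff v n) \<le> 2 * L2_norm v'"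
    unfolding e using norm_triangle_ineq4[of "fourier_coeff v' n" "v 1 - v 0"] fourier_coeff_le_L2[OF v(2), of n]
    by linarith
  then have "pi * (\<bar>of_int n\<bar> * cmod (fourier_coeff v n)) \<le> L2_norm v'"
    by (simp add: norm_mult)
  moreover have "1 * (\<bar>of_int n\<bar> * cmod (fourier_coeff v n)) \<le> pi * (\<bar>of_int n\<bar> * cmod (fourier_coeff v n))"
    using pi_gt3 by (intro mult_right_mono) auto
  ultimately have "\<bar>of_int n\<bar> * cmod (fourier_coeff v n) \<le> L2_norm v'" by linarith
  then show ?thesis using n by (simp add: field_simps)
qed

text \<open>On the torus an H^1 function of the interval may jump where the end points are glued, so
  its coefficients decay only like 1/|n|. The weighted squares are of order |n|^(2s-2), summable
  because s < 1/2. The bound is on finite sums, the form that passes to limits of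
  coefficients.\<close>

lemma H1_subset_Hs_torus:
  assumes s: "0 \<le> s" "s < 1/2"
  obtains C where "0 \<le> C" "\<And>u (F :: int set). \<lbrakk>u \<in> H1; wderiv u \<in> L2; finite F\<rbrakk> \<Longrightarrow>
    (\<Sum>n\<in>F. (1 + (of_int n)\<^sup>2) powr s * (cmod (fourier_coeff u n))\<^sup>2) \<le> C * (H1_norm u)\<^sup>2"
proof -
  \<comment> \<open>q 0 = 0, since 0 powr x is 0; the term n = 0 is bounded by the L^2 norm
    instead.\<close>
  define q where "q = (\<lambda>m. real m powr (2 * s - 2))"
  have q: "summable q" "\<And>m. 0 \<le> q m"
    using s by (auto simp: q_def summable_real_powr_iff)
  define C where "C = 1 + 4 * suminf q"
  have C0: "0 \<le> suminf q" by (rule suminf_nonneg[OF q])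
  show ?thesis
  proof (rule that)
    show "0 \<le> C" using C0 by (simp add: C_def)
    fix u and F :: "int set" assume u: "u \<in> H1" "wderiv u \<in> L2" and F: "finite F"
    obtain v where v: "ac v (wderiv u)" "AE y in leb01. u y = v y"
      using H1_ac_representative[OF u(1)] by blast
    have uL: "u \<in> L2" using u by (simp add: H1_def)
    have vL: "v \<in> L2" by (rule L2_continuous[OF ac_continuous[OF v(1)]])
    have fc: "fourier_coeff u n = fourier_coeff v n" for n by (rule fourier_coeff_cong_AE[OF uL vL v(2)])
    have le: "(1 + (of_int n)\<^sup>2) powr s * (cmod (fourier_coeff u n))\<^sup>2 \<le>
      (if n = 0 then (L2_norm u)\<^sup>2 else 0) + 2 * (L2_norm (wderiv u))\<^sup>2 * q (nat \<bar>n\<bar>)" for n :: int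
    proof (cases "n = 0")
      case True
      then show ?thesis using fourier_coeff_le_L2[OF uL, of 0] by (simp add: q_def power_mono)
    next
      case False
      define x where "x = \<bar>real_of_int n\<bar>"
      have x: "1 \<le> x" using False by (simp add: x_def)
      have "(1 + (of_int n)\<^sup>2) powr s \<le> (2 * x\<^sup>2) powr s"
        using x s one_le_power[OF x, of 2] by (intro powr_mono2) (auto simp: x_def)
      also have "\<dots> = 2 powr s * x powr (2 * s)"
      proof -
        have "x\<^sup>2 = x powr 2" using x by simp
        then have "(x\<^sup>2) powr s = x powr (2 * s)" by (simp only: powr_powr)
        then show ?thesis by (simp add: powr_mult)
      qed
      also have "\<dots> \<le> 2 * x powr (2 * s)"
        using powr_mono[of s 1 2] s by (intro mult_right_mono) auto
      finally have 1: "(1 + (of_int n)\<^sup>2) powr s \<le> 2 * x powr (2 * s)" .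
      have "(cmod (fourier_coeff u n))\<^sup>2 \<le> (L2_norm (wderiv u) / x)\<^sup>2"
        unfolding fc using fourier_coeff_ac_le[OF v(1) u(2) False] by (intro power_mono) (auto simp: x_def)
      then have "(1 + (of_int n)\<^sup>2) powr s * (cmod (fourier_coeff u n))\<^sup>2 \<le> 2 * x powr (2 * s) * (L2_norm (wderiv u) / x)\<^sup>2"
        using 1 by (intro mult_mono) auto
      also have "\<dots> = 2 * (L2_norm (wderiv u))\<^sup>2 * (x powr (2 * s) / x\<^sup>2)"
        by (simp add: power_divide)
      also have "x powr (2 * s) / x\<^sup>2 = q (nat \<bar>n\<bar>)"
        using x by (simp add: q_def powr_diff) (simp add: x_def)
      finally show ?thesis using False by simp
    qed
    have "(\<Sum>n\<in>F. (1 + (of_int n)\<^sup>2) powr s * (cmod (fourier_coeff u n))\<^sup>2) \<le>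
      (\<Sum>n\<in>F. (if n = 0 then (L2_norm u)\<^sup>2 else 0) + 2 * (L2_norm (wderiv u))\<^sup>2 * q (nat \<bar>n\<bar>))"
      by (intro sum_mono le)
    also have "\<dots> = (\<Sum>n\<in>F. (if n = 0 then (L2_norm u)\<^sup>2 else 0)) + 2 * (L2_norm (wderiv u))\<^sup>2 * (\<Sum>n\<in>F. q (nat \<bar>n\<bar>))"
      by (simp add: sum.distrib sum_distrib_left)
    also have "\<dots> \<le> (L2_norm u)\<^sup>2 + 2 * (L2_norm (wderiv u))\<^sup>2 * (2 * suminf q)"
      by (intro add_mono mult_left_mono sum_int_le_suminf[OF q F]) (simp_all add: sum.delta[OF F])
    also have "\<dots> \<le> C * ((L2_norm u)\<^sup>2 + (L2_norm (wderiv u))\<^sup>2)"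
      using C0 by (simp add: C_def algebra_simps)
    finally show "(\<Sum>n\<in>F. (1 + (of_int n)\<^sup>2) powr s * (cmod (fourier_coeff u n))\<^sup>2) \<le> C * (H1_norm u)\<^sup>2"
      by (simp add: H1_norm_def)
  qed
qed

section \<open>Completeness of L^2\<close>

lemma L2_norm_ennreal:
  assumes "u \<in> L2"
  shows "(\<integral>\<^sup>+y. ennreal ((cmod (u y))\<^sup>2) \<partial>leb01) = ennreal ((L2_norm u)\<^sup>2)"
  unfolding L2_norm_sq by (rule nn_integral_eq_integral[OF L2_sq_integrable[OF assms]]) simp

text \<open>Fatou's lemma for the squared moduli. Applied to differences, it hands a rate of
  convergence over to the limit.\<close>

lemma L2_fatou:
  assumes u: "\<And>j. u j \<in> L2" "\<And>j. L2_norm (u j) \<le> B" and v: "v \<in> borel_measurable leb01"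
    and lim: "AE y in leb01. (\<lambda>j. u j y) \<longlonglongrightarrow> v y"
  shows "v \<in> L2" "L2_norm v \<le> B"
proof -
  have B: "0 \<le> B" using u(2)[of 0] L2_norm_nonneg[of "u 0"] by linarith
  note [measurable] = L2_measurable[OF u(1)] v
  have "(\<integral>\<^sup>+y. ennreal ((cmod (v y))\<^sup>2) \<partial>leb01) = (\<integral>\<^sup>+y. liminf (\<lambda>j. ennreal ((cmod (u j y))\<^sup>2)) \<partial>leb01)"
  proof (rule nn_integral_cong_AE)
    show "AE y in leb01. ennreal ((cmod (v y))\<^sup>2) = liminf (\<lambda>j. ennreal ((cmod (u j y))\<^sup>2))"
      using lim
    proof eventually_elim
      case (elim y)
      have "(\<lambda>j. ennreal ((cmod (u j y))\<^sup>2)) \<longlonglongrightarrow> ennreal ((cmod (v y))\<^sup>2)"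
        by (intro tendsto_intros tendsto_ennrealI elim)
      then show ?case using lim_imp_Liminf[OF sequentially_bot] by metis
    qed
  qed
  also have "\<dots> \<le> liminf (\<lambda>j. \<integral>\<^sup>+y. ennreal ((cmod (u j y))\<^sup>2) \<partial>leb01)"
    by (rule nn_integral_liminf) measurable
  also have "\<dots> \<le> liminf (\<lambda>j::nat. ennreal (B\<^sup>2))"
    unfolding L2_norm_ennreal[OF u(1)]
    by (intro Liminf_mono always_eventually allI ennreal_leI power_mono u(2)) simp
  also have "\<dots> = ennreal (B\<^sup>2)" by (simp add: Liminf_const)
  finally have le: "(\<integral>\<^sup>+y. ennreal ((cmod (v y))\<^sup>2) \<partial>leb01) \<le> ennreal (B\<^sup>2)" .
  have "integrable leb01 (\<lambda>y. (cmod (v y))\<^sup>2)"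
  proof (rule integrableI_bounded)
    show "(\<lambda>y. (cmod (v y))\<^sup>2) \<in> borel_measurable leb01" by measurable
    show "(\<integral>\<^sup>+y. ennreal (norm ((cmod (v y))\<^sup>2)) \<partial>leb01) < \<infinity>"
      using le by (simp add: order_le_less_trans[OF _ ennreal_less_top])
  qed
  then show vL: "v \<in> L2" using v by (simp add: L2_def)
  have "(L2_norm v)\<^sup>2 \<le> B\<^sup>2"
    using le unfolding L2_norm_ennreal[OF vL] by (simp add: ennreal_le_iff)
  then show "L2_norm v \<le> B" using B by (rule power2_le_imp_le)
qed

text \<open>The core of the Riesz-Fischer theorem: the increments have summable L^1 norms, so the
  telescoping series converges absolutely almost everywhere. Fatou's lemma for u i - u (j + i) with
  i fixed keeps the rate. Geometric decay can be arranged later by the choice of times.\<close>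

lemma L2_fast_Cauchy_converges:
  assumes u: "\<And>j. u j \<in> L2" and B: "0 \<le> B"
    and d: "\<And>i j. i \<le> j \<Longrightarrow> L2_norm (\<lambda>y. u j y - u i y) \<le> B * (1/2) ^ i"
  obtains v where "v \<in> L2" "\<And>i. L2_norm (\<lambda>y. u i y - v y) \<le> B * (1/2) ^ i"
proof -
  define w where "w = (\<lambda>j y. u (Suc j) y - u j y)"
  have w: "w j \<in> L2" for j unfolding w_def by (rule L2_diff[OF u u])
  note [measurable] = L2_measurable[OF u] L2_measurable[OF w]
  have "(\<integral>\<^sup>+y. (\<Sum>j. ennreal (cmod (w j y))) \<partial>leb01) = (\<Sum>j. \<integral>\<^sup>+y. ennreal (cmod (w j y)) \<partial>leb01)"
    by (rule nn_integral_suminf) measurable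
  also have "\<dots> \<le> (\<Sum>j. ennreal (B * (1/2) ^ j))"
  proof (intro suminf_le summableI)
    fix j
    have "(\<integral>\<^sup>+y. ennreal (cmod (w j y)) \<partial>leb01) = ennreal (int01 (\<lambda>y. cmod (w j y)))"
      by (rule nn_integral_eq_integral) (use L2_integrable[OF w] in auto)
    also have "\<dots> \<le> ennreal (B * (1/2) ^ j)"
      using L1_le_L2[OF w[of j]] d[of j "Suc j"] by (intro ennreal_leI) (simp add: w_def)
    finally show "(\<integral>\<^sup>+y. ennreal (cmod (w j y)) \<partial>leb01) \<le> ennreal (B * (1/2) ^ j)" .
  qed
  also have "\<dots> = ennreal (\<Sum>j. B * (1/2) ^ j)"
    by (rule suminf_ennreal2) (use B in \<open>auto intro: summable_mult summable_geometric\<close>)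
  also have "\<dots> < \<infinity>" by simp
  finally have "AE y in leb01. (\<Sum>j. ennreal (cmod (w j y))) \<noteq> \<infinity>"
    by (intro nn_integral_PInf_AE) auto
  then have conv: "AE y in leb01. convergent (\<lambda>j. u j y)"
  proof eventually_elim
    case (elim y)
    then have "summable (\<lambda>j. cmod (w j y))" by (intro summable_suminf_not_top) auto
    then have "summable (\<lambda>j. w j y)" by (rule summable_norm_cancel)
    then obtain l where "(\<lambda>n. \<Sum>j<n. w j y) \<longlonglongrightarrow> l" by (auto simp: summable_def sums_def)
    moreover have "(\<Sum>j<n. w j y) = u n y - u 0 y" for n
      unfolding w_def by (rule sum_lessThan_telescope)
    ultimately have "(\<lambda>n. u n y - u 0 y) \<longlonglongrightarrow> l" by simp
    then have "(\<lambda>n. u n y - u 0 y + u 0 y) \<longlonglongrightarrow> l + u 0 y" by (intro tendsto_intros)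
    then show ?case by (auto simp: convergent_def)
  qed
  define v where "v = (\<lambda>y. lim (\<lambda>j. u j y))"
  have vm: "v \<in> borel_measurable leb01" unfolding v_def by measurable
  have vlim: "AE y in leb01. (\<lambda>j. u j y) \<longlonglongrightarrow> v y"
    using conv by eventually_elim (simp add: v_def convergent_LIMSEQ_iff)
  have D: "(\<lambda>y. u i y - v y) \<in> L2 \<and> L2_norm (\<lambda>y. u i y - v y) \<le> B * (1/2) ^ i" for i
  proof -
    have l: "AE y in leb01. (\<lambda>j. u i y - u (j + i) y) \<longlonglongrightarrow> u i y - v y"
      using vlim by eventually_elim (intro tendsto_intros LIMSEQ_ignore_initial_segment)
    have n: "L2_norm (\<lambda>y. u i y - u (j + i) y) \<le> B * (1/2) ^ i" for j
      using d[of i "j + i"] by (simp add: L2_norm_def norm_minus_commute)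
    show ?thesis
      using L2_fatou[of "\<lambda>j y. u i y - u (j + i) y", OF L2_diff(1)[OF u u] n _ l] vm by auto
  qed
  have "v \<in> L2" using L2_diff(1)[OF u[of 0] conjunct1[OF D[of 0]]] by simp
  then show ?thesis using that D by blast
qed

section \<open>Functions of time with a strong derivative in L^2\<close>

lemma L2_norm_minus_commute: "L2_norm (\<lambda>y. u y - v y) = L2_norm (\<lambda>y. v y - u y)"
  by (simp add: L2_norm_def norm_minus_commute)

lemma L2_norm_diff_triangle:
  assumes "u \<in> L2" "v \<in> L2" "w \<in> L2"
  shows "L2_norm (\<lambda>y. u y - w y) \<le> L2_norm (\<lambda>y. u y - v y) + L2_norm (\<lambda>y. v y - w y)"
  using L2_add(2)[OF L2_diff(1)[OF assms(1,2)] L2_diff(1)[OF assms(2,3)]] by simp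

text \<open>Cauchy-Schwarz turns strong differentiability into differentiability of a scalar
  pairing. Real parts are taken so that monotonicity on the real line can be used, and t > 0 makes
  the one-sided derivative two-sided.\<close>

lemma L2_pairing_derivative:
  assumes W: "\<And>\<tau>. 0 \<le> \<tau> \<Longrightarrow> W \<tau> \<in> L2" and X: "X \<in> L2" and D: "D \<in> L2" and t: "0 < t"
    and der: "((\<lambda>\<tau>. L2_norm (\<lambda>y. (W \<tau> y - W t y) / of_real (\<tau> - t) - X y)) \<longlongrightarrow> 0) (at t within {0..})"
  shows "((\<lambda>\<tau>. Re (int01 (\<lambda>y. D y * W \<tau> y))) has_real_derivative Re (int01 (\<lambda>y. D y * X y))) (at t)"
proof -
  define w where "w = (\<lambda>\<tau>. Re (int01 (\<lambda>y. D y * W \<tau> y)))"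
  define w' where "w' = Re (int01 (\<lambda>y. D y * X y))"
  have le: "\<bar>(w \<tau> - w t) / (\<tau> - t) - w'\<bar> \<le>
     L2_norm D * L2_norm (\<lambda>y. (W \<tau> y - W t y) / of_real (\<tau> - t) - X y)" if \<tau>: "\<tau> \<in> {0..}" "\<tau> \<noteq> t" for \<tau>
  proof -
    define c where "c = 1 / (\<tau> - t)"
    define Z where "Z = (\<lambda>y. of_real c * (W \<tau> y - W t y) - X y)"
    have Ze: "(\<lambda>y. (W \<tau> y - W t y) / of_real (\<tau> - t) - X y) = Z"
      by (simp add: Z_def c_def)
    have Wt: "W \<tau> \<in> L2" "W t \<in> L2" using W \<tau> t by auto
    have Z: "Z \<in> L2"
      unfolding Z_def by (intro L2_cmult(1) L2_diff(1) Wt X)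
    have i: "integrable leb01 (\<lambda>y. D y * W \<tau> y)" "integrable leb01 (\<lambda>y. D y * W t y)" "integrable leb01 (\<lambda>y. D y * X y)"
      by (intro L2_mult_integrable D Wt X)+
    have "int01 (\<lambda>y. D y * Z y) =
      int01 (\<lambda>y. of_real c * (D y * W \<tau> y - D y * W t y) - D y * X y)"
      by (intro Bochner_Integration.integral_cong refl) (simp add: Z_def algebra_simps)
    also have "\<dots> = of_real c * (int01 (\<lambda>y. D y * W \<tau> y) - int01 (\<lambda>y. D y * W t y))
       - int01 (\<lambda>y. D y * X y)"
      using i by simp
    finally have "Re (int01 (\<lambda>y. D y * Z y)) = c * (w \<tau> - w t) - w'"
      by (simp add: w_def w'_def)
    then have "Re (int01 (\<lambda>y. D y * Z y)) = (w \<tau> - w t) / (\<tau> - t) - w'"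
      by (simp add: c_def)
    then have "\<bar>(w \<tau> - w t) / (\<tau> - t) - w'\<bar> \<le> cmod (int01 (\<lambda>y. D y * Z y))"
      using abs_Re_le_cmod by metis
    then show ?thesis using L2_Cauchy_Schwarz[OF D Z] unfolding Ze by linarith
  qed
  have "((\<lambda>\<tau>. (w \<tau> - w t) / (\<tau> - t) - w') \<longlongrightarrow> 0) (at t within {0..})"
  proof (rule Lim_null_comparison)
    show "((\<lambda>\<tau>. L2_norm D * L2_norm (\<lambda>y. (W \<tau> y - W t y) / of_real (\<tau> - t) - X y)) \<longlongrightarrow> 0) (at t within {0..})"
      using tendsto_mult_left[OF der, of "L2_norm D"] by simp
    show "\<forall>\<^sub>F \<tau> in at t within {0..}. norm ((w \<tau> - w t) / (\<tau> - t) - w') \<le>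
       L2_norm D * L2_norm (\<lambda>y. (W \<tau> y - W t y) / of_real (\<tau> - t) - X y)"
      unfolding eventually_at_filter using le by (intro always_eventually) auto
  qed
  then have "(w has_real_derivative w') (at t within {0..})"
    unfolding has_field_derivative_iff by (simp add: LIM_zero_cancel)
  moreover have "at t within {0..} = at t"
    by (rule at_within_interior) (use t in simp)
  ultimately show ?thesis by (simp add: w_def w'_def)
qed

text \<open>Pairing with the increment \<open>W t1 - W t0\<close> reduces the mean value inequality to a scalar one,
  which needs no integration in time.\<close>

lemma strong_derivative_increment_bound:
  fixes W X :: "real \<Rightarrow> 'k \<Rightarrow> real \<Rightarrow> complex"
  assumes K: "finite K" and W: "\<And>t k. 0 \<le> t \<Longrightarrow> k \<in> K \<Longrightarrow> W t k \<in> L2"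
    and X: "\<And>t k. 0 \<le> t \<Longrightarrow> k \<in> K \<Longrightarrow> X t k \<in> L2"
    and der: "\<And>t k. 0 \<le> t \<Longrightarrow> k \<in> K \<Longrightarrow>
      ((\<lambda>\<tau>. L2_norm (\<lambda>y. (W \<tau> k y - W t k y) / of_real (\<tau> - t) - X t k y)) \<longlongrightarrow> 0) (at t within {0..})"
    and s: "0 < s" and A: "0 \<le> A"
    and XA: "\<And>t. 1 \<le> t \<Longrightarrow> L2_set (\<lambda>k. L2_norm (X t k)) K \<le> A * t powr (- (1 + s))"
    and t: "1 \<le> t0" "t0 \<le> t1"
  shows "L2_set (\<lambda>k. L2_norm (\<lambda>y. W t1 k y - W t0 k y)) K \<le> A / s * t0 powr (- s)"
proof -
  \<comment> \<open>The conjugate compensates for the bilinear pairing: with it h t1 - h t0 is N^2,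
    the squared norm of the increment.\<close>
  define D where "D = (\<lambda>k y. cnj (W t1 k y - W t0 k y))"
  have nD: "L2_norm (D k) = L2_norm (\<lambda>y. W t1 k y - W t0 k y)" for k
    unfolding L2_norm_def D_def complex_mod_cnj ..
  have DL: "D k \<in> L2" if "k \<in> K" for k
  proof -
    have d: "(\<lambda>y. W t1 k y - W t0 k y) \<in> L2" using W that t by (intro L2_diff(1)) auto
    have "D k \<in> borel_measurable leb01"
      unfolding D_def by (rule measurable_compose[OF L2_measurable[OF d] borel_measurable_continuous_onI]) (intro continuous_intros)
    then show ?thesis using L2_mono(1)[OF d, of "D k" 1] by (simp add: D_def del: complex_cnj_diff)
  qed
  define N where "N = L2_set (\<lambda>k. L2_norm (D k)) K"
  have N0: "0 \<le> N" by (simp add: N_def)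
  define h where "h = (\<lambda>\<tau>. \<Sum>k\<in>K. Re (int01 (\<lambda>y. D k y * W \<tau> k y)))"
  define h' where "h' = (\<lambda>\<tau>. \<Sum>k\<in>K. Re (int01 (\<lambda>y. D k y * X \<tau> k y)))"
  have hd: "(h has_real_derivative h' \<tau>) (at \<tau>)" if "1 \<le> \<tau>" for \<tau>
    unfolding h_def h'_def
    by (intro DERIV_sum L2_pairing_derivative W X DL der) (use that in auto)
  have h'b: "h' \<tau> \<le> N * (A * \<tau> powr (- (1 + s)))" if \<tau>: "1 \<le> \<tau>" for \<tau>
  proof -
    have "h' \<tau> \<le> (\<Sum>k\<in>K. \<bar>L2_norm (D k)\<bar> * \<bar>L2_norm (X \<tau> k)\<bar>)"
      unfolding h'_def
    proof (rule sum_mono)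
      fix k assume k: "k \<in> K"
      have "Re (int01 (\<lambda>y. D k y * X \<tau> k y)) \<le> cmod (int01 (\<lambda>y. D k y * X \<tau> k y))"
        by (rule complex_Re_le_cmod)
      also have "\<dots> \<le> L2_norm (D k) * L2_norm (X \<tau> k)"
        by (rule L2_Cauchy_Schwarz) (use k \<tau> DL X in auto)
      finally show "Re (int01 (\<lambda>y. D k y * X \<tau> k y)) \<le> \<bar>L2_norm (D k)\<bar> * \<bar>L2_norm (X \<tau> k)\<bar>" by simp
    qed
    also have "\<dots> \<le> N * L2_set (\<lambda>k. L2_norm (X \<tau> k)) K" unfolding N_def by (rule L2_set_mult_ineq)
    also have "\<dots> \<le> N * (A * \<tau> powr (- (1 + s)))" by (rule mult_left_mono[OF XA[OF \<tau>] N0])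
    finally show ?thesis .
  qed
  \<comment> \<open>The added term has derivative - N A \<tau>^(-(1+s)), which offsets the bound on
    h', so G is nonincreasing. This gives N^2 <= N (A/s) t0^(-s), and N is divided out.\<close>
  define G where "G = (\<lambda>\<tau>. h \<tau> + N * A / s * \<tau> powr (- s))"
  have "G t1 \<le> G t0"
  proof (rule DERIV_nonpos_imp_nonincreasing[OF t(2)])
    fix x assume x: "t0 \<le> x" "x \<le> t1"
    then have x1: "1 \<le> x" using t by simp
    have "(G has_real_derivative (h' x + N * A / s * (- s * x powr (- s - 1)))) (at x)"
      unfolding G_def using x1 hd[OF x1]
      by (auto intro!: derivative_eq_intros has_real_derivative_powr)
    moreover have "h' x + N * A / s * (- s * x powr (- s - 1)) \<le> 0"
    proof -
      have e: "- (1 + s) = - s - 1" by simp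
      have "h' x \<le> N * (A * x powr (- s - 1))" using h'b[OF x1] unfolding e .
      moreover have "N * A / s * (- s * x powr (- s - 1)) = - (N * (A * x powr (- s - 1)))" using s by simp
      ultimately show ?thesis by simp
    qed
    ultimately show "\<exists>y. (G has_real_derivative y) (at x) \<and> y \<le> 0" by blast
  qed
  moreover have "h t1 - h t0 = N\<^sup>2"
  proof -
    have "h t1 - h t0 = (\<Sum>k\<in>K. (L2_norm (D k))\<^sup>2)"
      unfolding h_def sum_subtractf[symmetric]
    proof (rule sum.cong[OF refl])
      fix k assume k: "k \<in> K"
      have i: "integrable leb01 (\<lambda>y. D k y * W t1 k y)" "integrable leb01 (\<lambda>y. D k y * W t0 k y)"
        using k t by (auto intro!: L2_mult_integrable DL W)
      have "Re (int01 (\<lambda>y. D k y * W t1 k y)) - Re (int01 (\<lambda>y. D k y * W t0 k y)) =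
        Re (int01 (\<lambda>y. D k y * W t1 k y - D k y * W t0 k y))"
        using i by simp
      also have "(\<lambda>y. D k y * W t1 k y - D k y * W t0 k y) = (\<lambda>y. complex_of_real ((cmod (D k y))\<^sup>2))"
        unfolding complex_norm_square by (auto simp: D_def algebra_simps)
      finally show "Re (int01 (\<lambda>y. D k y * W t1 k y)) - Re (int01 (\<lambda>y. D k y * W t0 k y)) = (L2_norm (D k))\<^sup>2"
        by (simp only: integral_complex_of_real Re_complex_of_real L2_norm_sq)
    qed
    also have "\<dots> = N\<^sup>2" by (simp add: N_def L2_set_def sum_nonneg)
    finally show ?thesis .
  qed
  moreover have "0 \<le> N * A / s * t1 powr (- s)" using N0 A s by simp
  ultimately have "N\<^sup>2 \<le> N * A / s * t0 powr (- s)" unfolding G_def by linarith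
  then have le: "N * N \<le> N * (A / s * t0 powr (- s))" by (simp add: power2_eq_square mult_ac)
  have "N \<le> A / s * t0 powr (- s)"
  proof (cases "N = 0")
    case True
    then show ?thesis using A s by simp
  next
    case False
    then have "0 < N" using N0 by simp
    then show ?thesis using mult_left_le_imp_le[OF le] by simp
  qed
  then show ?thesis unfolding N_def nD .
qed

text \<open>Increments after time t are at most (A/s) t^(-s), so W is Cauchy as t tends to infinity,
  and letting the later time grow gives the rate. Convergence along \<tau> is recorded because the
  regularity of the limit is read off from Fourier coefficients along a sequence.\<close>

lemma strong_derivative_limit:
  fixes W X :: "real \<Rightarrow> 'k \<Rightarrow> real \<Rightarrow> complex"
  assumes W: "\<And>t k. 0 \<le> t \<Longrightarrow> k \<in> S \<Longrightarrow> W t k \<in> L2"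
    and X: "\<And>t k. 0 \<le> t \<Longrightarrow> k \<in> S \<Longrightarrow> X t k \<in> L2"
    and der: "\<And>t k. 0 \<le> t \<Longrightarrow> k \<in> S \<Longrightarrow>
      ((\<lambda>\<tau>. L2_norm (\<lambda>y. (W \<tau> k y - W t k y) / of_real (\<tau> - t) - X t k y)) \<longlongrightarrow> 0) (at t within {0..})"
    and s: "0 < s" and A: "0 \<le> A"
    and XA: "\<And>t K. 1 \<le> t \<Longrightarrow> finite K \<Longrightarrow> K \<subseteq> S \<Longrightarrow> L2_set (\<lambda>k. L2_norm (X t k)) K \<le> A * t powr (- (1 + s))"
  shows "\<exists>V \<tau>. (\<forall>k\<in>S. V k \<in> L2) \<and> (\<forall>j. 1 \<le> \<tau> j) \<and>
    (\<forall>k\<in>S. (\<lambda>j::nat. L2_norm (\<lambda>y. W (\<tau> j) k y - V k y)) \<longlonglongrightarrow> 0) \<and>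
    (\<forall>t K. 1 \<le> t \<longrightarrow> finite K \<longrightarrow> K \<subseteq> S \<longrightarrow>
       L2_set (\<lambda>k. L2_norm (\<lambda>y. W t k y - V k y)) K \<le> A / s * t powr (- s))"
proof -
  \<comment> \<open>Chosen so that \<tau> j powr (- s) = 2^(-j): along these times the increments
    decay geometrically.\<close>
  define \<tau> where "\<tau> = (\<lambda>j::nat. 2 powr (real j / s))"
  have \<tau>1: "1 \<le> \<tau> j" for j unfolding \<tau>_def using s by (intro ge_one_powr_ge_zero) auto
  have \<tau>s: "\<tau> j powr (- s) = (1/2) ^ j" for j
  proof -
    have "\<tau> j powr (- s) = 2 powr (- real j)" unfolding \<tau>_def powr_powr using s by simp
    also have "\<dots> = (1/2) ^ j" by (simp add: powr_minus powr_realpow power_one_over inverse_eq_divide)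
    finally show ?thesis .
  qed
  have \<tau>mono: "\<tau> i \<le> \<tau> j" if "i \<le> j" for i j
    unfolding \<tau>_def using s that by (intro powr_mono) (auto intro: divide_right_mono)
  have incr: "L2_set (\<lambda>k. L2_norm (\<lambda>y. W t1 k y - W t0 k y)) K \<le> A / s * t0 powr (- s)"
    if "finite K" "K \<subseteq> S" "1 \<le> t0" "t0 \<le> t1" for K t0 t1
    by (rule strong_derivative_increment_bound[where X=X]) (use that W X der s A XA in auto)
  have "\<exists>v\<in>L2. \<forall>i. L2_norm (\<lambda>y. W (\<tau> i) k y - v y) \<le> A / s * (1/2) ^ i" if k: "k \<in> S" for k
  proof -
    have \<tau>0: "0 \<le> \<tau> j" for j using \<tau>1[of j] by simp
    have "L2_norm (\<lambda>y. W (\<tau> j) k y - W (\<tau> i) k y) \<le> A / s * (1/2) ^ i" if "i \<le> j" for i j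
      using incr[of "{k}" "\<tau> i" "\<tau> j"] k \<tau>1 \<tau>mono[OF that] by (simp add: \<tau>s L2_set_def)
    moreover have "0 \<le> A / s" using A s by simp
    ultimately show ?thesis
      using L2_fast_Cauchy_converges[of "\<lambda>j. W (\<tau> j) k" "A / s"] W[OF \<tau>0 k] by metis
  qed
  then obtain V where V: "\<And>k. k \<in> S \<Longrightarrow> V k \<in> L2"
    "\<And>k i. k \<in> S \<Longrightarrow> L2_norm (\<lambda>y. W (\<tau> i) k y - V k y) \<le> A / s * (1/2) ^ i" by metis
  have conv: "(\<lambda>j. L2_norm (\<lambda>y. W (\<tau> j) k y - V k y)) \<longlonglongrightarrow> 0" if k: "k \<in> S" for k
  proof (rule Lim_null_comparison)
    show "\<forall>\<^sub>F j in sequentially. norm (L2_norm (\<lambda>y. W (\<tau> j) k y - V k y)) \<le> A / s * (1/2) ^ j"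
      using V(2)[OF k] by simp
    show "(\<lambda>j. A / s * (1/2) ^ j) \<longlonglongrightarrow> 0"
      using tendsto_mult_left[OF LIMSEQ_power_zero[of "1/2::real"], of "A / s"] by simp
  qed
  show ?thesis
  proof (intro exI[of _ V] exI[of _ \<tau>] conjI ballI allI impI V(1) \<tau>1 conv)
    fix t :: real and K assume t: "1 \<le> t" and K: "finite K" "K \<subseteq> S"
    have lim: "(\<lambda>j. L2_norm (\<lambda>y. W (\<tau> j) k y - W t k y)) \<longlonglongrightarrow> L2_norm (\<lambda>y. W t k y - V k y)" if "k \<in> K" for k
    proof -
      have k: "k \<in> S" using that K by auto
      have L: "W t k \<in> L2" "V k \<in> L2" "W (\<tau> j) k \<in> L2" for j
        using W[of t k] W[of "\<tau> j" k] V(1)[OF k] k t \<tau>1[of j] by auto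
      have "(\<lambda>j. L2_norm (\<lambda>y. W (\<tau> j) k y - W t k y) - L2_norm (\<lambda>y. W t k y - V k y)) \<longlonglongrightarrow> 0"
      proof (rule Lim_null_comparison[OF always_eventually conv[OF k]], rule allI)
        fix j
        show "norm (L2_norm (\<lambda>y. W (\<tau> j) k y - W t k y) - L2_norm (\<lambda>y. W t k y - V k y)) \<le> L2_norm (\<lambda>y. W (\<tau> j) k y - V k y)"
          using L2_norm_diff_triangle[OF L(3)[of j] L(2) L(1)] L2_norm_diff_triangle[OF L(1) L(3)[of j] L(2)]
            L2_norm_minus_commute[of "V k" "W t k"] L2_norm_minus_commute[of "W (\<tau> j) k" "W t k"]
          by (simp add: abs_le_iff)
      qed
      then show ?thesis by (rule LIM_zero_cancel)
    qed
    have "(\<lambda>j. L2_set (\<lambda>k. L2_norm (\<lambda>y. W (\<tau> j) k y - W t k y)) K) \<longlonglongrightarrow> L2_set (\<lambda>k. L2_norm (\<lambda>y. W t k y - V k y)) K"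
      unfolding L2_set_def by (intro tendsto_intros lim)
    moreover have "\<forall>\<^sub>F j in sequentially. L2_set (\<lambda>k. L2_norm (\<lambda>y. W (\<tau> j) k y - W t k y)) K \<le> A / s * t powr (- s)"
    proof -
      \<comment> \<open>That \<tau> j eventually exceeds t is read off from \<tau> j powr (- s) =
        2^(-j); the increment bound from t to \<tau> j then applies.\<close>
      have "(\<lambda>j. (1/2) ^ j * 1 :: real) \<longlonglongrightarrow> 0" by (auto intro!: LIMSEQ_power_zero)
      then have "\<forall>\<^sub>F j in sequentially. (1/2 :: real) ^ j < t powr (- s)"
        using order_tendstoD(2)[of "\<lambda>j. (1/2 :: real) ^ j" 0 sequentially "t powr (- s)"] t by simp
      then show ?thesis
      proof eventually_elim
        case (elim j)
        have "t \<le> \<tau> j"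
        proof (rule ccontr)
          assume "\<not> t \<le> \<tau> j"
          then have "t powr (- s) \<le> \<tau> j powr (- s)" using s \<tau>1[of j] by (intro powr_mono2') auto
          then show False using elim by (simp add: \<tau>s)
        qed
        then show ?case using incr[OF K t] by simp
      qed
    qed
    ultimately show "L2_set (\<lambda>k. L2_norm (\<lambda>y. W t k y - V k y)) K \<le> A / s * t powr (- s)"
      by (rule tendsto_upperbound) simp
  qed
qed

subsection \<open>Sums over the modes\<close>

lemma L2x_norm_nonneg: "0 \<le> L2x_norm L N u"
  unfolding L2x_norm_def by (intro real_sqrt_ge_zero infsum_nonneg) simp

text \<open>Estimates are proved for finite sets of modes, uniformly in the set. Since the terms are
  nonnegative, such a bound gives summability and the norm estimate at once.\<close>

lemma L2x_I:
  assumes X: "\<And>k. k \<in> modes L \<Longrightarrow> u k \<in> X"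
    and b: "\<And>K. finite K \<Longrightarrow> K \<subseteq> modes L \<Longrightarrow> L2_set (\<lambda>k. N (u k)) K \<le> B"
  shows "u \<in> L2x L X N" "L2x_norm L N u \<le> B"
proof -
  have B: "0 \<le> B" using b[of "{}"] by simp
  have s: "(\<Sum>k\<in>K. (N (u k))\<^sup>2) \<le> B\<^sup>2" if "finite K" "K \<subseteq> modes L" for K
    using power_mono[OF b[OF that], of 2] by (simp add: L2_set_def sum_nonneg)
  have sm: "(\<lambda>k. (N (u k))\<^sup>2) summable_on modes L"
    by (rule nonneg_bdd_above_summable_on) (use s in \<open>auto intro!: bdd_aboveI2[where M="B\<^sup>2"]\<close>)
  then show "u \<in> L2x L X N" using X by (simp add: L2x_def)
  have "(\<Sum>\<^sub>\<infinity>k\<in>modes L. (N (u k))\<^sup>2) \<le> B\<^sup>2" by (rule infsum_le_finite_sums[OF sm s])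
  then show "L2x_norm L N u \<le> B" unfolding L2x_norm_def using B by (intro real_le_lsqrt) (auto intro: infsum_nonneg)
qed

lemma L2x_finite_le:
  assumes "u \<in> L2x L X N" "finite K" "K \<subseteq> modes L"
  shows "L2_set (\<lambda>k. N (u k)) K \<le> L2x_norm L N u"
  unfolding L2_set_def L2x_norm_def
  by (intro real_sqrt_le_mono finite_sum_le_infsum) (use assms in \<open>auto simp: L2x_def\<close>)

lemma Hs_torus_closed:
  assumes v: "v \<in> L2" and b: "\<And>F. finite F \<Longrightarrow> (\<Sum>n\<in>F. (1 + (of_int n)\<^sup>2) powr s * (cmod (fourier_coeff v n))\<^sup>2) \<le> B"
  shows "v \<in> Hs_torus s"
proof -
  have "(\<lambda>n. (1 + (of_int n)\<^sup>2) powr s * (cmod (fourier_coeff v n))\<^sup>2) summable_on UNIV"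
    by (rule nonneg_bdd_above_summable_on) (use b in \<open>auto intro!: bdd_aboveI2[where M=B]\<close>)
  then show ?thesis using v by (simp add: Hs_torus_def)
qed

text \<open>The finite sum over modes is interchanged with the infinite sum over frequencies. Finite
  double sums are what passes to the limit in time, and they suffice to control the H^s
  norms.\<close>

lemma Hs_torus_norm_sum_le:
  fixes v :: "'k \<Rightarrow> real \<Rightarrow> complex"
  assumes v: "\<And>k. k \<in> K \<Longrightarrow> v k \<in> Hs_torus s" and K: "finite K"
    and b: "\<And>F. finite F \<Longrightarrow> (\<Sum>k\<in>K. \<Sum>n\<in>F. (1 + (of_int n)\<^sup>2) powr s * (cmod (fourier_coeff (v k) n))\<^sup>2) \<le> B"
  shows "(\<Sum>k\<in>K. (Hs_torus_norm s (v k))\<^sup>2) \<le> B"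
proof -
  define g where "g = (\<lambda>k n. (1 + (real_of_int n)\<^sup>2) powr s * (cmod (fourier_coeff (v k) n))\<^sup>2)"
  have g: "g k summable_on UNIV" if "k \<in> K" for k
    using v[OF that] by (simp add: Hs_torus_def g_def)
  have "(\<Sum>k\<in>K. (Hs_torus_norm s (v k))\<^sup>2) = (\<Sum>k\<in>K. infsum (g k) UNIV)"
    by (intro sum.cong refl) (simp add: Hs_torus_norm_def g_def infsum_nonneg)
  moreover have hs: "((\<lambda>n. \<Sum>k\<in>K. g k n) has_sum (\<Sum>k\<in>K. infsum (g k) UNIV)) UNIV"
    using K g
  proof (induction K rule: finite_induct)
    case (insert x K)
    then show ?case by (simp add: has_sum_add has_sum_infsum)
  qed simp
  moreover have "(\<Sum>k\<in>K. infsum (g k) UNIV) \<le> B"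
  proof (rule has_sum_le_finite_sums[OF hs])
    fix F :: "int set" assume "finite F"
    then show "(\<Sum>n\<in>F. \<Sum>k\<in>K. g k n) \<le> B"
      using b[of F] by (subst sum.swap) (simp add: g_def)
  qed
  ultimately show ?thesis by simp
qed

lemma fourier_coeff_L2_limit:
  assumes "\<And>j. u j \<in> L2" "v \<in> L2" "(\<lambda>j. L2_norm (\<lambda>y. u j y - v y)) \<longlonglongrightarrow> 0"
  shows "(\<lambda>j::nat. fourier_coeff (u j) n) \<longlonglongrightarrow> fourier_coeff v n"
proof -
  have "(\<lambda>j. fourier_coeff (u j) n - fourier_coeff v n) \<longlonglongrightarrow> 0"
  proof (rule Lim_null_comparison[OF always_eventually assms(3)], rule allI)
    fix j
    show "norm (fourier_coeff (u j) n - fourier_coeff v n) \<le> L2_norm (\<lambda>y. u j y - v y)"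
      using fourier_coeff_le_L2[OF L2_diff(1)[OF assms(1)[of j] assms(2)], of n]
      by (simp add: fourier_coeff_diff[OF L2_integrable[OF assms(1)] L2_integrable[OF assms(2)]])
  qed
  then show ?thesis by (rule LIM_zero_cancel)
qed

text \<open>With k = 0 removed, |k| has a positive lower bound. It enters the constant of the
  elliptic estimate and controls the factor 1/k in the velocity.\<close>

lemma modes_ge:
  assumes "L > 0" "k \<in> modes L" shows "2 * pi / L \<le> \<bar>k\<bar>"
proof -
  obtain n :: int where n: "k = 2 * pi / L * of_int n" "n \<noteq> 0" using assms(2) by (auto simp: modes_def)
  have "1 \<le> \<bar>real_of_int n\<bar>" using n(2) by simp
  then have "2 * pi / L * 1 \<le> 2 * pi / L * \<bar>real_of_int n\<bar>"
    using assms(1) by (intro mult_left_mono) auto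
  then show ?thesis using assms(1) by (simp add: n abs_mult)
qed

lemma L2_norm_le_H1_norm: "L2_norm u \<le> H1_norm u" "L2_norm (wderiv u) \<le> H1_norm u"
  unfolding H1_norm_def by (auto intro!: real_le_rsqrt)

theorem corollary3p3:
  fixes L a b c s :: real
    and U U' U'' f g :: "real \<Rightarrow> real"
    and \<omega>\<^sub>0 :: "real \<Rightarrow> real \<Rightarrow> complex"
    and W \<Phi> :: "real \<Rightarrow> real \<Rightarrow> real \<Rightarrow> complex"
  assumes "L > 0" and "a < b"
    and "0 < s" and "s < 1/2"
    and "strict_mono_on {a..b} U \<or> strict_antimono_on {a..b} U"
    and "U ` {a..b} = {0..1}"
    and "\<And>z. z \<in> {a..b} \<Longrightarrow> (U has_real_derivative U' z) (at z within {a..b})"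
    and "\<And>z. z \<in> {a..b} \<Longrightarrow> (U' has_real_derivative U'' z) (at z within {a..b})"
    and "\<And>y. y \<in> {0..1} \<Longrightarrow> f y = U'' (inv_into {a..b} U y)"
    and "\<And>y. y \<in> {0..1} \<Longrightarrow> g y = U' (inv_into {a..b} U y)"
    and "f \<in> W2inf_torus" and "g \<in> W2inf_torus"
    and "c > 0" and "\<And>y. y \<in> {0..1} \<Longrightarrow> (g y)\<^sup>2 > c"
    and "linearized_euler_solution L f g \<omega>\<^sub>0 W \<Phi>"
    and "\<And>t. t \<ge> 0 \<Longrightarrow> W t \<in> L2x L H1 H1_norm"
    and "\<And>t. t \<ge> 0 \<Longrightarrow> (\<lambda>k. wderiv (W t k)) \<in> L2x L (Hs_torus s) (Hs_torus_norm s)"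
    and "\<exists>C. \<forall>t\<ge>0. L2x_norm L H1_norm (W t) \<le> C"
    and "\<exists>C. \<forall>t\<ge>0. L2x_norm L (Hs_torus_norm s) (\<lambda>k. wderiv (W t k)) \<le> C"
  shows "\<exists>Winf \<in> L2x L (Hs_torus s) (Hs_torus_norm s).
     (\<forall>t\<ge>0. vertical_velocity (\<Phi> t) \<in> L2x L L2 L2_norm) \<and>
     (\<lambda>t. L2x_norm L L2_norm (vertical_velocity (\<Phi> t))) \<in> O[at_top](\<lambda>t. t powr (-(1 + s))) \<and>
     (\<forall>t\<ge>0. (\<lambda>k y. W t k y - Winf k y) \<in> L2x L L2 L2_norm) \<and>
     ((\<lambda>t. L2x_norm L L2_norm (\<lambda>k y. W t k y - Winf k y)) \<longlongrightarrow> 0) at_top \<and>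
     (\<lambda>t. L2x_norm L L2_norm (\<lambda>k y. W t k y - Winf k y)) \<in> O[at_top](\<lambda>t. t powr (-s))"
proof -
  note L = assms(1) and s = assms(3,4) and c = assms(13,14) and sol = assms(15)
    and WH1 = assms(16) and WHs = assms(17)
  have s': "0 \<le> s" "s \<le> 1" using s by auto
  have gnz: "g y \<noteq> 0" if "y \<in> {0..1}" for y using c(2)[OF that] c(1) by auto
  have gd: "(g has_real_derivative f y / g y) (at y within {0..1})" if y: "y \<in> {0..1}" for y
    by (rule profile_derivative[OF assms(5-10) y gnz[OF y]])
  obtain \<sigma> r r1 r2 m M where \<sigma>: "\<sigma> = 1 \<or> \<sigma> = -1" and gr: "\<And>y. y \<in> {0..1} \<Longrightarrow> 1 / g y = \<sigma> * r y"
    and "shear_weight r r1 r2 m M"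
    using profile_shear_weight[OF assms(11) c gd] by metis
  then interpret shear_weight r r1 r2 m M by simp
  obtain CH where CH: "\<And>t. t \<ge> 0 \<Longrightarrow> L2x_norm L H1_norm (W t) \<le> CH" using assms(18) by blast
  obtain CS where CS: "\<And>t. t \<ge> 0 \<Longrightarrow> L2x_norm L (Hs_torus_norm s) (\<lambda>k. wderiv (W t k)) \<le> CS" using assms(19) by blast
  have CH0: "0 \<le> CH" by (rule order_trans[OF L2x_norm_nonneg CH[OF order_refl]])
  have CS0: "0 \<le> CS" by (rule order_trans[OF L2x_norm_nonneg CS[OF order_refl]])
  define k0 where "k0 = 2 * pi / L"
  have k0: "0 < k0" using L by (simp add: k0_def)
  have k0k: "k0 \<le> \<bar>k\<bar>" "k \<noteq> 0" if "k \<in> modes L" for k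
    using modes_ge[OF L that] k0 by (auto simp: k0_def)
  obtain C where C0: "0 \<le> C" and decay: "\<And>\<kappa> \<xi> t P Q u u'.
    \<lbrakk>k0 \<le> \<bar>\<kappa>\<bar>; 1 \<le> t; \<bar>\<xi>\<bar> = \<bar>\<kappa>\<bar> * t; ac u u'; u' \<in> Hs_torus s;
     elliptic_pair r \<kappa> P Q (\<lambda>y. cis (- \<xi> * y) * u y)\<rbrakk>
    \<Longrightarrow> L2_norm P \<le> C * t powr (- (1 + s)) * (Hs_torus_norm s u' + (L2_norm u + L2_norm u'))"
    using elliptic_decay[OF k0 s'] by blast
  have WL2: "W t k \<in> L2" and WkH1: "W t k \<in> H1" and wdHs: "wderiv (W t k) \<in> Hs_torus s"
    and wdL2: "wderiv (W t k) \<in> L2" if "0 \<le> t" "k \<in> modes L" for t k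
    using WH1[OF that(1)] WHs[OF that(1)] that(2) by (auto simp: L2x_def H1_def Hs_torus_def)
  have mode: "\<Phi> t k \<in> L2 \<and> L2_norm (\<Phi> t k) \<le> (M / m)\<^sup>2 * L2_norm (W t k) \<and>
      (1 \<le> t \<longrightarrow> L2_norm (\<Phi> t k) \<le> C * t powr (- (1 + s)) *
         (Hs_torus_norm s (wderiv (W t k)) + (L2_norm (W t k) + L2_norm (wderiv (W t k)))))"
    if t: "0 \<le> t" and k: "k \<in> modes L" for t k
  proof -
    have h: "\<Phi> t k \<in> H1_dirichlet" "shear_deriv g t k (\<Phi> t k) \<in> H1"
      "AE y in leb01. - \<Phi> t k y + shear_deriv g t k (shear_deriv g t k (\<Phi> t k)) y = W t k y"
      using sol t k by (auto simp: linearized_euler_solution_def)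
    obtain P Q where pair: "elliptic_pair r (\<sigma> * k) P Q (\<lambda>y. cis (- (k * t) * y) * W t k y)"
      and n: "L2_norm P = L2_norm (\<Phi> t k)" and \<Phi>L: "\<Phi> t k \<in> L2"
      by (rule mode_elliptic_reduction[OF gr gnz k0k(2)[OF k] h])
    have \<kappa>: "\<sigma> * k \<noteq> 0" "\<bar>\<sigma> * k\<bar> = \<bar>k\<bar>" using \<sigma> k0k(2)[OF k] by auto
    have cm: "(\<lambda>y. cis (- (k * t) * y)) \<in> borel_measurable leb01"
      by (intro continuous_measurable_leb01 continuous_intros)
    have F: "(\<lambda>y. cis (- (k * t) * y) * W t k y) \<in> L2" "L2_norm (\<lambda>y. cis (- (k * t) * y) * W t k y) \<le> L2_norm (W t k)"
      using L2_mult_bounded[OF WL2[OF t k] cm, of 1] by auto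
    have "L2_norm P \<le> (M / m)\<^sup>2 * L2_norm (\<lambda>y. cis (- (k * t) * y) * W t k y)"
      by (rule elliptic_bound[OF \<kappa>(1) F(1) pair])
    also have "\<dots> \<le> (M / m)\<^sup>2 * L2_norm (W t k)" by (rule mult_left_mono[OF F(2)]) simp
    finally have 1: "L2_norm (\<Phi> t k) \<le> (M / m)\<^sup>2 * L2_norm (W t k)" by (simp add: n)
    obtain v where v: "ac v (wderiv (W t k))" "AE y in leb01. W t k y = v y"
      using H1_ac_representative[OF WkH1[OF t k]] by blast
    have nv: "L2_norm v = L2_norm (W t k)"
      by (rule L2_cong_AE(2)[OF WL2[OF t k] continuous_measurable_leb01[OF ac_continuous[OF v(1)]] v(2)])
    have "AE y in leb01. cis (- (k * t) * y) * W t k y = cis (- (k * t) * y) * v y"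
      using v(2) by eventually_elim simp
    \<comment> \<open>An elliptic pair tolerates changes of the right-hand side on null sets, so W
      may be replaced by its absolutely continuous representative, which can be integrated by
      parts.\<close>
    note pair_v = elliptic_pair_cong_AE[OF pair this]
    have 2: "L2_norm (\<Phi> t k) \<le> C * t powr (- (1 + s)) *
         (Hs_torus_norm s (wderiv (W t k)) + (L2_norm (W t k) + L2_norm (wderiv (W t k))))" if t1: "1 \<le> t"
    proof -
      have "k0 \<le> \<bar>\<sigma> * k\<bar>" "\<bar>k * t\<bar> = \<bar>\<sigma> * k\<bar> * t" unfolding \<kappa>(2) using k0k(1)[OF k] t by (simp_all add: abs_mult)
      from decay[OF this(1) t1 this(2) v(1) wdHs[OF t k] pair_v]
      show ?thesis by (simp add: n nv)
    qed
    show ?thesis using 1 2 \<Phi>L by blast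
  qed
  have setH1: "L2_set (\<lambda>k. H1_norm (W t k)) K \<le> CH" if "0 \<le> t" "finite K" "K \<subseteq> modes L" for t K
    using L2x_finite_le[OF WH1[OF that(1)] that(2,3)] CH[OF that(1)] by simp
  have setHs: "L2_set (\<lambda>k. Hs_torus_norm s (wderiv (W t k))) K \<le> CS" if "0 \<le> t" "finite K" "K \<subseteq> modes L" for t K
    using L2x_finite_le[OF WHs[OF that(1)] that(2,3)] CS[OF that(1)] by simp
  have setW: "L2_set (\<lambda>k. L2_norm (W t k)) K \<le> CH" if "0 \<le> t" "finite K" "K \<subseteq> modes L" for t K
  proof -
    have "L2_set (\<lambda>k. L2_norm (W t k)) K \<le> L2_set (\<lambda>k. H1_norm (W t k)) K"
      by (rule L2_set_mono) (simp_all add: L2_norm_le_H1_norm)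
    then show ?thesis using setH1[OF that] by simp
  qed
  \<comment> \<open>CS accounts for the H^s norm of the derivative, 2 CH for the L^2 norms of W and
    of its derivative, each at most the H^1 norm.\<close>
  define A0 where "A0 = C * (CS + 2 * CH)"
  have A00: "0 \<le> A0" using C0 CS0 CH0 by (simp add: A0_def)
  have set\<Phi>: "L2_set (\<lambda>k. L2_norm (\<Phi> t k)) K \<le> A0 * t powr (- (1 + s))"
    if t: "1 \<le> t" and K: "finite K" "K \<subseteq> modes L" for t K
  proof -
    have t0: "0 \<le> t" using t by simp
    define T where "T = C * t powr (- (1 + s))"
    have T0: "0 \<le> T" using C0 by (simp add: T_def)
    have "L2_set (\<lambda>k. L2_norm (\<Phi> t k)) K \<le> L2_set (\<lambda>k. T * (Hs_torus_norm s (wderiv (W t k)) + 2 * H1_norm (W t k))) K"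
    proof (rule L2_set_mono)
      fix k assume "k \<in> K"
      then have k: "k \<in> modes L" using K by auto
      have "L2_norm (\<Phi> t k) \<le> T * (Hs_torus_norm s (wderiv (W t k)) + (L2_norm (W t k) + L2_norm (wderiv (W t k))))"
        using mode[OF t0 k] t by (simp add: T_def)
      also have "\<dots> \<le> T * (Hs_torus_norm s (wderiv (W t k)) + 2 * H1_norm (W t k))"
        using L2_norm_le_H1_norm[of "W t k"] by (intro mult_left_mono T0) simp
      finally show "L2_norm (\<Phi> t k) \<le> T * (Hs_torus_norm s (wderiv (W t k)) + 2 * H1_norm (W t k))" .
    qed simp
    also have "\<dots> = T * L2_set (\<lambda>k. Hs_torus_norm s (wderiv (W t k)) + 2 * H1_norm (W t k)) K"
      by (rule L2_set_right_distrib[OF T0, symmetric])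
    also have "\<dots> \<le> T * (L2_set (\<lambda>k. Hs_torus_norm s (wderiv (W t k))) K + L2_set (\<lambda>k. 2 * H1_norm (W t k)) K)"
      by (intro mult_left_mono L2_set_triangle_ineq T0)
    also have "L2_set (\<lambda>k. 2 * H1_norm (W t k)) K = 2 * L2_set (\<lambda>k. H1_norm (W t k)) K"
      by (rule L2_set_right_distrib[symmetric]) simp
    also have "T * (L2_set (\<lambda>k. Hs_torus_norm s (wderiv (W t k))) K + 2 * L2_set (\<lambda>k. H1_norm (W t k)) K) \<le> T * (CS + 2 * CH)"
      using setHs[OF t0 K] setH1[OF t0 K] by (intro mult_left_mono T0) simp
    finally show ?thesis by (simp add: T_def A0_def mult_ac)
  qed
  have vv: "vertical_velocity (\<Phi> t) k \<in> L2" "L2_norm (vertical_velocity (\<Phi> t) k) \<le> 1 / k0 * L2_norm (\<Phi> t k)"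
    if "0 \<le> t" "k \<in> modes L" for t k
  proof -
    have p: "\<Phi> t k \<in> L2" using mode[OF that] by blast
    show "vertical_velocity (\<Phi> t) k \<in> L2" unfolding vertical_velocity_def by (rule L2_cmult(1)[OF p])
    have "cmod (\<i> / of_real k) \<le> 1 / k0" using k0k[OF that(2)] k0 by (simp add: norm_divide frac_le)
    then show "L2_norm (vertical_velocity (\<Phi> t) k) \<le> 1 / k0 * L2_norm (\<Phi> t k)"
      unfolding vertical_velocity_def L2_cmult(2)[OF p] by (intro mult_right_mono) simp_all
  qed
  have vvset: "L2_set (\<lambda>k. L2_norm (vertical_velocity (\<Phi> t) k)) K \<le> 1 / k0 * L2_set (\<lambda>k. L2_norm (\<Phi> t k)) K"
    if t: "0 \<le> t" and K: "K \<subseteq> modes L" for t K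
  proof -
    have "L2_set (\<lambda>k. L2_norm (vertical_velocity (\<Phi> t) k)) K \<le> L2_set (\<lambda>k. 1 / k0 * L2_norm (\<Phi> t k)) K"
      by (rule L2_set_mono) (use vv t K in auto)
    then show ?thesis using L2_set_right_distrib[of "1 / k0" "\<lambda>k. L2_norm (\<Phi> t k)" K] k0 by simp
  qed
  have V1: "vertical_velocity (\<Phi> t) \<in> L2x L L2 L2_norm" if t: "0 \<le> t" for t
  proof (rule L2x_I(1)[where B="1 / k0 * ((M / m)\<^sup>2 * CH)"])
    fix K assume K: "finite K" "K \<subseteq> modes L"
    have "L2_set (\<lambda>k. L2_norm (\<Phi> t k)) K \<le> L2_set (\<lambda>k. (M / m)\<^sup>2 * L2_norm (W t k)) K"
      by (rule L2_set_mono) (use mode[OF t] K in auto)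
    also have "\<dots> = (M / m)\<^sup>2 * L2_set (\<lambda>k. L2_norm (W t k)) K"
      by (rule L2_set_right_distrib[symmetric]) simp
    also have "\<dots> \<le> (M / m)\<^sup>2 * CH" by (rule mult_left_mono[OF setW[OF t K]]) simp
    finally have "1 / k0 * L2_set (\<lambda>k. L2_norm (\<Phi> t k)) K \<le> 1 / k0 * ((M / m)\<^sup>2 * CH)"
      using k0 by (intro mult_left_mono) auto
    then show "L2_set (\<lambda>k. L2_norm (vertical_velocity (\<Phi> t) k)) K \<le> 1 / k0 * ((M / m)\<^sup>2 * CH)"
      using vvset[OF t K(2)] by linarith
  qed (use vv t in auto)
  have V2: "L2x_norm L L2_norm (vertical_velocity (\<Phi> t)) \<le> 1 / k0 * A0 * t powr (- (1 + s))" if t: "1 \<le> t" for t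
  proof (rule L2x_I(2)[where X=L2])
    fix K assume K: "finite K" "K \<subseteq> modes L"
    have "1 / k0 * L2_set (\<lambda>k. L2_norm (\<Phi> t k)) K \<le> 1 / k0 * (A0 * t powr (- (1 + s)))"
      using k0 set\<Phi>[OF t K] by (intro mult_left_mono) auto
    then show "L2_set (\<lambda>k. L2_norm (vertical_velocity (\<Phi> t) k)) K \<le> 1 / k0 * A0 * t powr (- (1 + s))"
      using vvset[OF _ K(2), of t] t by (simp add: mult.assoc)
  qed (use vv t in auto)
  have fLinf: "f \<in> Linf" using assms(11) by (auto simp: W2inf_torus_def)
  obtain Bf where Bf: "AE y in leb01. \<bar>f y\<bar> \<le> Bf" "Bf > 0" using Linf_bound[OF fLinf] by blast
  \<comment> \<open>X is f V_2, the time derivative of W; as f is bounded, it decays like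
    \<Phi>.\<close>
  define X where "X = (\<lambda>t k y. \<i> * of_real (f y) / of_real k * \<Phi> t k y)"
  have X: "X t k \<in> L2" "L2_norm (X t k) \<le> Bf / k0 * L2_norm (\<Phi> t k)"
    if "0 \<le> t" "k \<in> modes L" for t k
  proof -
    have p: "\<Phi> t k \<in> L2" using mode[OF that] by blast
    have fm: "(\<lambda>y. complex_of_real (f y)) \<in> borel_measurable leb01"
      by (rule borel_measurable_integrable[OF Linf_integrable[OF fLinf]])
    have mm: "(\<lambda>y. \<i> * of_real (f y) / of_real k) \<in> borel_measurable leb01"
      using fm by measurable
    have mb: "AE y in leb01. cmod (\<i> * of_real (f y) / of_real k) \<le> Bf / k0"
      using Bf(1) by eventually_elim (use k0k[OF that(2)] k0 Bf(2) in \<open>simp add: norm_divide norm_mult frac_le\<close>)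
    show "X t k \<in> L2" "L2_norm (X t k) \<le> Bf / k0 * L2_norm (\<Phi> t k)"
      unfolding X_def using L2_mult_bounded[OF p mm mb] Bf(2) k0 by simp_all
  qed
  define A where "A = Bf / k0 * A0"
  have A0': "0 \<le> A" using A00 Bf k0 by (simp add: A_def)
  have XA: "L2_set (\<lambda>k. L2_norm (X t k)) K \<le> A * t powr (- (1 + s))"
    if t: "1 \<le> t" and K: "finite K" "K \<subseteq> modes L" for t K
  proof -
    have t0: "0 \<le> t" using t by simp
    have "L2_set (\<lambda>k. L2_norm (X t k)) K \<le> L2_set (\<lambda>k. Bf / k0 * L2_norm (\<Phi> t k)) K"
      by (rule L2_set_mono) (use X[OF t0] K in auto)
    also have "\<dots> = Bf / k0 * L2_set (\<lambda>k. L2_norm (\<Phi> t k)) K"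
      by (rule L2_set_right_distrib[symmetric]) (use Bf k0 in simp)
    also have "\<dots> \<le> Bf / k0 * (A0 * t powr (- (1 + s)))"
      by (rule mult_left_mono[OF set\<Phi>[OF t K]]) (use Bf k0 in simp)
    finally show ?thesis by (simp add: A_def mult.assoc)
  qed
  have der: "((\<lambda>\<tau>. L2_norm (\<lambda>y. (W \<tau> k y - W t k y) / of_real (\<tau> - t) - X t k y)) \<longlongrightarrow> 0) (at t within {0..})"
    if "0 \<le> t" "k \<in> modes L" for t k
    using sol that by (auto simp: linearized_euler_solution_def X_def)
  have "\<exists>V \<tau>. (\<forall>k\<in>modes L. V k \<in> L2) \<and> (\<forall>j. 1 \<le> \<tau> j) \<and>
    (\<forall>k\<in>modes L. (\<lambda>j::nat. L2_norm (\<lambda>y. W (\<tau> j) k y - V k y)) \<longlonglongrightarrow> 0) \<and>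
    (\<forall>t K. 1 \<le> t \<longrightarrow> finite K \<longrightarrow> K \<subseteq> modes L \<longrightarrow>
       L2_set (\<lambda>k. L2_norm (\<lambda>y. W t k y - V k y)) K \<le> A / s * t powr (- s))"
    by (rule strong_derivative_limit[OF WL2 X(1) der s(1) A0' XA])
  then obtain V \<tau> where "\<forall>k\<in>modes L. V k \<in> L2" "\<forall>j. 1 \<le> \<tau> j"
    "\<forall>k\<in>modes L. (\<lambda>j::nat. L2_norm (\<lambda>y. W (\<tau> j) k y - V k y)) \<longlonglongrightarrow> 0"
    "\<forall>t K. 1 \<le> t \<longrightarrow> finite K \<longrightarrow> K \<subseteq> modes L \<longrightarrow>
       L2_set (\<lambda>k. L2_norm (\<lambda>y. W t k y - V k y)) K \<le> A / s * t powr (- s)"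
    by (elim exE conjE) (rule that)
  note V = this(1)[rule_format] and \<tau> = this(2)[rule_format] and lim = this(3)[rule_format]
    and rate = this(4)[rule_format]
  have \<tau>0: "0 \<le> \<tau> j" for j using \<tau>[of j] by simp
  obtain C1 where C1: "0 \<le> C1" "\<And>u (F :: int set). \<lbrakk>u \<in> H1; wderiv u \<in> L2; finite F\<rbrakk> \<Longrightarrow>
    (\<Sum>n\<in>F. (1 + (of_int n)\<^sup>2) powr s * (cmod (fourier_coeff u n))\<^sup>2) \<le> C1 * (H1_norm u)\<^sup>2"
    using H1_subset_Hs_torus[OF s'(1) s(2)] by blast
  \<comment> \<open>The regularity of the limit comes from the uniform H^1 bound on W through the
    embedding for s < 1/2. Finite double sums depend continuously on the coefficients, so the bound
    survives the limit j -> infinity.\<close>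
  have VHs: "(\<Sum>k\<in>K. \<Sum>n\<in>F. (1 + (of_int n)\<^sup>2) powr s * (cmod (fourier_coeff (V k) n))\<^sup>2) \<le> C1 * CH\<^sup>2"
    if K: "finite K" "K \<subseteq> modes L" and F: "finite F" for K and F :: "int set"
  proof (rule LIMSEQ_le_const2)
    show "(\<lambda>j. \<Sum>k\<in>K. \<Sum>n\<in>F. (1 + (of_int n)\<^sup>2) powr s * (cmod (fourier_coeff (W (\<tau> j) k) n))\<^sup>2) \<longlonglongrightarrow>
      (\<Sum>k\<in>K. \<Sum>n\<in>F. (1 + (of_int n)\<^sup>2) powr s * (cmod (fourier_coeff (V k) n))\<^sup>2)"
      by (intro tendsto_sum tendsto_mult tendsto_const tendsto_power tendsto_norm fourier_coeff_L2_limit WL2 V lim)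
        (use K \<tau>0 in auto)
    have "(\<Sum>k\<in>K. \<Sum>n\<in>F. (1 + (of_int n)\<^sup>2) powr s * (cmod (fourier_coeff (W (\<tau> j) k) n))\<^sup>2) \<le> C1 * CH\<^sup>2" for j
    proof -
      have "(\<Sum>k\<in>K. \<Sum>n\<in>F. (1 + (of_int n)\<^sup>2) powr s * (cmod (fourier_coeff (W (\<tau> j) k) n))\<^sup>2) \<le> (\<Sum>k\<in>K. C1 * (H1_norm (W (\<tau> j) k))\<^sup>2)"
        by (intro sum_mono C1(2) WkH1 wdL2 F) (use K \<tau>0 in auto)
      also have "\<dots> = C1 * (L2_set (\<lambda>k. H1_norm (W (\<tau> j) k)) K)\<^sup>2"
        by (simp add: L2_set_def sum_nonneg sum_distrib_left)
      also have "\<dots> \<le> C1 * CH\<^sup>2"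
        using setH1[OF \<tau>0 K] by (intro mult_left_mono power_mono C1(1)) auto
      finally show ?thesis .
    qed
    then show "\<exists>N. \<forall>j\<ge>N. (\<Sum>k\<in>K. \<Sum>n\<in>F. (1 + (of_int n)\<^sup>2) powr s * (cmod (fourier_coeff (W (\<tau> j) k) n))\<^sup>2) \<le> C1 * CH\<^sup>2"
      by blast
  qed
  have VkHs: "V k \<in> Hs_torus s" if "k \<in> modes L" for k
    by (rule Hs_torus_closed[OF V[OF that], where B="C1 * CH\<^sup>2"]) (use VHs[of "{k}"] that in auto)
  have Vin: "V \<in> L2x L (Hs_torus s) (Hs_torus_norm s)"
  proof (rule L2x_I(1)[where B="sqrt (C1 * CH\<^sup>2)"])
    fix K assume K: "finite K" "K \<subseteq> modes L"
    show "L2_set (\<lambda>k. Hs_torus_norm s (V k)) K \<le> sqrt (C1 * CH\<^sup>2)"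
      unfolding L2_set_def
      by (intro real_sqrt_le_mono Hs_torus_norm_sum_le VHs K) (use VkHs K in auto)
  qed (rule VkHs)
  \<comment> \<open>The rate is available from t = 1 on; comparing with W 1 covers every t >=
    0.\<close>
  have D1: "(\<lambda>k y. W t k y - V k y) \<in> L2x L L2 L2_norm" if t: "0 \<le> t" for t
  proof (rule L2x_I(1)[where B="CH + CH + A / s"])
    show "(\<lambda>y. W t k y - V k y) \<in> L2" if "k \<in> modes L" for k
      by (rule L2_diff(1)[OF WL2[OF t that] V[OF that]])
    fix K assume K: "finite K" "K \<subseteq> modes L"
    have "L2_set (\<lambda>k. L2_norm (\<lambda>y. W t k y - V k y)) K \<le>
      L2_set (\<lambda>k. (L2_norm (W t k) + L2_norm (W 1 k)) + L2_norm (\<lambda>y. W 1 k y - V k y)) K"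
    proof (rule L2_set_mono)
      fix k assume "k \<in> K"
      then have k: "k \<in> modes L" using K by auto
      have w: "W t k \<in> L2" "W 1 k \<in> L2" using WL2[OF _ k] t by auto
      show "L2_norm (\<lambda>y. W t k y - V k y) \<le> (L2_norm (W t k) + L2_norm (W 1 k)) + L2_norm (\<lambda>y. W 1 k y - V k y)"
        using L2_norm_diff_triangle[OF w V[OF k]] L2_diff(2)[OF w] by linarith
    qed simp
    also have "\<dots> \<le> L2_set (\<lambda>k. L2_norm (W t k) + L2_norm (W 1 k)) K + L2_set (\<lambda>k. L2_norm (\<lambda>y. W 1 k y - V k y)) K"
      by (rule L2_set_triangle_ineq)
    also have "\<dots> \<le> (L2_set (\<lambda>k. L2_norm (W t k)) K + L2_set (\<lambda>k. L2_norm (W 1 k)) K) + L2_set (\<lambda>k. L2_norm (\<lambda>y. W 1 k y - V k y)) K"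
      by (intro add_right_mono L2_set_triangle_ineq)
    also have "\<dots> \<le> CH + CH + A / s"
      using setW[OF t K] setW[OF zero_le_one K] rate[OF order_refl K] by simp
    finally show "L2_set (\<lambda>k. L2_norm (\<lambda>y. W t k y - V k y)) K \<le> CH + CH + A / s" .
  qed
  have D2: "L2x_norm L L2_norm (\<lambda>k y. W t k y - V k y) \<le> A / s * t powr (- s)" if t: "1 \<le> t" for t
    by (rule L2x_I(2)[where X=L2]) (use rate[OF t] L2_diff(1) WL2 V t in auto)
  have O1: "(\<lambda>t. L2x_norm L L2_norm (vertical_velocity (\<Phi> t))) \<in> O[at_top](\<lambda>t. t powr (-(1 + s)))"
  proof (rule bigoI[where c="1 / k0 * A0"])
    show "\<forall>\<^sub>F t in at_top. norm (L2x_norm L L2_norm (vertical_velocity (\<Phi> t))) \<le> 1 / k0 * A0 * norm (t powr (-(1 + s)))"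
      using eventually_ge_at_top[of 1] by eventually_elim (use V2 in \<open>simp add: L2x_norm_nonneg\<close>)
  qed
  have O2: "(\<lambda>t. L2x_norm L L2_norm (\<lambda>k y. W t k y - V k y)) \<in> O[at_top](\<lambda>t. t powr (-s))"
  proof (rule bigoI[where c="A / s"])
    show "\<forall>\<^sub>F t in at_top. norm (L2x_norm L L2_norm (\<lambda>k y. W t k y - V k y)) \<le> A / s * norm (t powr (-s))"
      using eventually_ge_at_top[of 1] by eventually_elim (use D2 in \<open>simp add: L2x_norm_nonneg\<close>)
  qed
  have T: "((\<lambda>t. L2x_norm L L2_norm (\<lambda>k y. W t k y - V k y)) \<longlongrightarrow> 0) at_top"
  proof (rule Lim_null_comparison)
    show "\<forall>\<^sub>F t in at_top. norm (L2x_norm L L2_norm (\<lambda>k y. W t k y - V k y)) \<le> A / s * t powr (-s)"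
      using eventually_ge_at_top[of 1] by eventually_elim (use D2 in \<open>simp add: L2x_norm_nonneg\<close>)
    have "((\<lambda>t::real. t powr (-s)) \<longlongrightarrow> 0) at_top"
      by (rule tendsto_neg_powr) (use s in \<open>auto intro: filterlim_ident\<close>)
    from tendsto_mult_left[OF this, of "A / s"]
    show "((\<lambda>t. A / s * t powr (-s)) \<longlongrightarrow> 0) at_top" by simp
  qed
  show ?thesis
    by (intro bexI[OF _ Vin] conjI allI impI V1 D1 O1 O2 T)
qed

end
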